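(* Let $0<a<1$, $\alpha>-1$, $\sigma(z)=\frac{az}{-(1-a)z+1}$, and let $\beta_\alpha(0)=1$, $\beta_\alpha(j)=\sqrt{\frac{\Gamma(j+\alpha+1)}{(j-1)!\,\Gamma(\alpha+2)}}$ for $j\ge1$. Then the sequence $\widetilde{C_\sigma}^{(n)}$ of iterated Aluthge transforms of the composition operator $C_\sigma$ on $H^2(\beta_\alpha)$ converges, as $n\to\infty$, in the strong operator topology to the normal operator $$(K_0\otimes K_0)\oplus V\left(\frac{1}{a^{\alpha/2}}\,T_{\left(\frac{2\sqrt a}{-(1-a)z+(1+a)}\right)^{\alpha+2}}\,C_{\frac{(1+a)z-(1-a)}{-(1-a)z+(1+a)}}\right)V^*$$ with respect to the decomposition $H^2(\beta_\alpha)=(zH^2(\beta_\alpha))^\perp\oplus(zH^2(\beta_\alpha))$.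
   Context: $\mathbb{D}$ is the open unit disk in $\mathbb{C}$. For a sequence $\beta(n)$ of positive numbers with $\beta(0)=1$ and $\lim_{n\to\infty}\beta(n)^{1/n}=1$, the weighted Hardy space $H^2(\beta)$ is the Hilbert space of analytic functions $f(z)=\sum_{n\ge0}a_nz^n$ on $\mathbb{D}$ with $\|f\|^2=\sum_n|a_n|^2\beta(n)^2<\infty$, and inner product $\langle\sum a_nz^n,\sum b_nz^n\rangle=\sum_n a_n\overline{b_n}\beta(n)^2$; its reproducing kernel at $\omega\in\mathbb{D}$ is $K_\omega(z)=\sum_j \frac{(\overline{\omega}z)^j}{\beta(j)^2}$ (so $K_0=1$). Here $zH^2(\beta)=\{zf:f\in H^2(\beta)\}$, so $(zH^2(\beta))^\perp=\operatorname{span}\{1\}$. For elements $f,g$ of a Hilbert space, $(f\otimes g)h=\langle h,g\rangle f$. For $\alpha>-1$, put $\gamma_\alpha(j)=\sqrt{\frac{j!\,\Gamma(\alpha+2)}{\Gamma(j+\alpha+2)}}$; the weighted Bergman space $\mathcal{A}_\alpha^2(\mathbb{D})=H^2(\gamma_\alpha)$ has inner product $\langle \sum a_nz^n,\sum b_nz^n\rangle=\sum_{n}\gamma_\alpha(n)^2a_n\overline{b_n}$. The unitary operator $V:\mathcal{A}_\alpha^2(\mathbb{D})\to zH^2(\beta_\alpha)$ is given by $Vz^j=\frac{\gamma_\alpha(j)}{\beta_\alpha(j+1)}z^{j+1}$, $j\ge0$. For bounded analytic $f$ on $\mathbb{D}$, $T_fh=fh$, and for an analytic self-map $\phi$ of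 $\mathbb{D}$, $C_\phi h=h\circ\phi$; the operators $T$ and $C$ inside the large parentheses act on $\mathcal{A}_\alpha^2(\mathbb{D})$. Powers with exponent $\alpha+2$ are taken with the principal branch (the base has positive real part on $\mathbb{D}$). For a bounded operator $T$ on a Hilbert space $H$, let $|T|=(T^*T)^{1/2}$ and let $T=U|T|$ be the polar decomposition, $U$ being the partial isometry with $\ker U=\ker T=\ker|T|$. The Aluthge transform of $T$ is $\widetilde{T}=|T|^{1/2}U|T|^{1/2}$. The iterated Aluthge transforms are $\widetilde{T}^{(0)}=T$ and $\widetilde{T}^{(n+1)}=\widetilde{(\widetilde{T}^{(n)})}$ for every integer $n\ge0$. *)

theory Defs
  imports "HOL-Complex_Analysis.Complex_Analysis" "HOL-Library.FuncSet"
begin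

text \<open>
  A Hilbert space of complex-valued functions is given by its carrier and its inner product
  (linear in the first argument); the vector space operations are the pointwise ones.
  Operators are extensional functions (\<open>undefined\<close> outside the carrier), so that equality of
  operators is equality on the carrier and the definite descriptions below can be unique.
\<close>

record 'x fun_space =
  hcarrier :: "('x \<Rightarrow> complex) set"
  hinner :: "('x \<Rightarrow> complex) \<Rightarrow> ('x \<Rightarrow> complex) \<Rightarrow> complex"

type_synonym ('x, 'y) fun_op = "('x \<Rightarrow> complex) \<Rightarrow> ('y \<Rightarrow> complex)"

definition hnorm :: "'x fun_space \<Rightarrow> ('x \<Rightarrow> complex) \<Rightarrow> real" where
  "hnorm H f = sqrt (Re (hinner H f f))"

definition bounded_ops :: "'x fun_space \<Rightarrow> 'y fun_space \<Rightarrow> ('x, 'y) fun_op set" where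
  "bounded_ops H K = {T \<in> hcarrier H \<rightarrow>\<^sub>E hcarrier K.
     (\<forall>f\<in>hcarrier H. \<forall>g\<in>hcarrier H. \<forall>c d.
        T (\<lambda>x. c * f x + d * g x) = (\<lambda>y. c * T f y + d * T g y)) \<and>
     (\<exists>C. \<forall>f\<in>hcarrier H. hnorm K (T f) \<le> C * hnorm H f)}"

definition adjoint_op :: "'x fun_space \<Rightarrow> 'y fun_space \<Rightarrow> ('x, 'y) fun_op \<Rightarrow> ('y, 'x) fun_op" where
  "adjoint_op H K T = (\<lambda>g\<in>hcarrier K.
     THE h. h \<in> hcarrier H \<and> (\<forall>f\<in>hcarrier H. hinner K (T f) g = hinner H f h))"

definition positive_op :: "'x fun_space \<Rightarrow> ('x, 'x) fun_op \<Rightarrow> bool" where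
  "positive_op H T \<longleftrightarrow> T \<in> bounded_ops H H \<and>
     (\<forall>f\<in>hcarrier H. hinner H (T f) f \<in> \<real> \<and> 0 \<le> Re (hinner H (T f) f))"

definition normal_op :: "'x fun_space \<Rightarrow> ('x, 'x) fun_op \<Rightarrow> bool" where
  "normal_op H T \<longleftrightarrow> T \<in> bounded_ops H H \<and>
     compose (hcarrier H) (adjoint_op H H T) T = compose (hcarrier H) T (adjoint_op H H T)"

definition unitary_op :: "'x fun_space \<Rightarrow> 'y fun_space \<Rightarrow> ('x, 'y) fun_op \<Rightarrow> bool" where
  "unitary_op H K T \<longleftrightarrow> T \<in> bounded_ops H K \<and> T ` hcarrier H = hcarrier K \<and>
     (\<forall>f\<in>hcarrier H. \<forall>g\<in>hcarrier H. hinner K (T f) (T g) = hinner H f g)"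

definition op_sqrt :: "'x fun_space \<Rightarrow> ('x, 'x) fun_op \<Rightarrow> ('x, 'x) fun_op" where
  "op_sqrt H T = (THE S. positive_op H S \<and> compose (hcarrier H) S S = T)"

definition op_abs :: "'x fun_space \<Rightarrow> ('x, 'x) fun_op \<Rightarrow> ('x, 'x) fun_op" where
  "op_abs H T = op_sqrt H (compose (hcarrier H) (adjoint_op H H T) T)"

definition op_ker :: "'x fun_space \<Rightarrow> ('x, 'x) fun_op \<Rightarrow> ('x \<Rightarrow> complex) set" where
  "op_ker H T = {f \<in> hcarrier H. T f = (\<lambda>_. 0)}"

definition orth_compl :: "'x fun_space \<Rightarrow> ('x \<Rightarrow> complex) set \<Rightarrow> ('x \<Rightarrow> complex) set" where
  "orth_compl H M = {f \<in> hcarrier H. \<forall>g\<in>M. hinner H f g = 0}"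

definition partial_isometry :: "'x fun_space \<Rightarrow> ('x, 'x) fun_op \<Rightarrow> bool" where
  "partial_isometry H U \<longleftrightarrow> U \<in> bounded_ops H H \<and>
     (\<forall>f\<in>orth_compl H (op_ker H U). hnorm H (U f) = hnorm H f)"

text \<open>The partial isometry \<open>U\<close> of the polar decomposition \<open>T = U |T|\<close>.\<close>

definition polar_part :: "'x fun_space \<Rightarrow> ('x, 'x) fun_op \<Rightarrow> ('x, 'x) fun_op" where
  "polar_part H T = (THE U. partial_isometry H U \<and>
     compose (hcarrier H) U (op_abs H T) = T \<and>
     op_ker H U = op_ker H T \<and> op_ker H T = op_ker H (op_abs H T))"

definition aluthge :: "'x fun_space \<Rightarrow> ('x, 'x) fun_op \<Rightarrow> ('x, 'x) fun_op" where
  "aluthge H T = (let R = op_sqrt H (op_abs H T)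
     in compose (hcarrier H) R (compose (hcarrier H) (polar_part H T) R))"

definition sot_tendsto :: "'x fun_space \<Rightarrow> (nat \<Rightarrow> ('x, 'x) fun_op) \<Rightarrow> ('x, 'x) fun_op \<Rightarrow> bool" where
  "sot_tendsto H X T \<longleftrightarrow> (\<forall>n. X n \<in> bounded_ops H H) \<and> T \<in> bounded_ops H H \<and>
     (\<forall>f\<in>hcarrier H. (\<lambda>n. hnorm H (\<lambda>x. X n f x - T f x)) \<longlonglongrightarrow> 0)"

definition scale_op :: "'x fun_space \<Rightarrow> complex \<Rightarrow> ('x, 'y) fun_op \<Rightarrow> ('x, 'y) fun_op" where
  "scale_op H c T = (\<lambda>f\<in>hcarrier H. \<lambda>y. c * T f y)"

definition rank_one :: "'x fun_space \<Rightarrow> ('x \<Rightarrow> complex) \<Rightarrow> ('x \<Rightarrow> complex) \<Rightarrow> ('x, 'x) fun_op" where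
  "rank_one H f g = (\<lambda>h\<in>hcarrier H. \<lambda>x. hinner H h g * f x)"

text \<open>
  \<open>A \<oplus> B\<close> with respect to the decomposition of \<open>H\<close> into the orthogonal complement of \<open>M\<close>
  (on which \<open>A\<close> acts) and the closed subspace \<open>M\<close> (on which \<open>B\<close> acts).
\<close>

definition direct_sum_op ::
  "'x fun_space \<Rightarrow> ('x \<Rightarrow> complex) set \<Rightarrow> ('x, 'x) fun_op \<Rightarrow> ('x, 'x) fun_op \<Rightarrow> ('x, 'x) fun_op" where
  "direct_sum_op H M A B = (\<lambda>f\<in>hcarrier H.
     THE h. \<exists>u\<in>orth_compl H M. \<exists>v\<in>M. f = (\<lambda>x. u x + v x) \<and> h = (\<lambda>x. A u x + B v x))"

text \<open>
  A function on the open unit disk is represented by its extension by \<open>0\<close> to the whole plane.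
\<close>

definition on_disk :: "(complex \<Rightarrow> complex) \<Rightarrow> complex \<Rightarrow> complex" where
  "on_disk f z = (if z \<in> ball 0 1 then f z else 0)"

definition taylor_coeff :: "(complex \<Rightarrow> complex) \<Rightarrow> nat \<Rightarrow> complex" where
  "taylor_coeff f n = (deriv ^^ n) f 0 / fact n"

definition H2 :: "(nat \<Rightarrow> real) \<Rightarrow> complex fun_space" where
  "H2 \<beta> = \<lparr>hcarrier = {f. f holomorphic_on ball 0 1 \<and> (\<forall>z. z \<notin> ball 0 1 \<longrightarrow> f z = 0) \<and>
                summable (\<lambda>n. (cmod (taylor_coeff f n))\<^sup>2 * (\<beta> n)\<^sup>2)},
     hinner = (\<lambda>f g. \<Sum>n. taylor_coeff f n * cnj (taylor_coeff g n) * of_real ((\<beta> n)\<^sup>2))\<rparr>"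

definition H2_kernel :: "(nat \<Rightarrow> real) \<Rightarrow> complex \<Rightarrow> complex \<Rightarrow> complex" where
  "H2_kernel \<beta> \<omega> = on_disk (\<lambda>z. \<Sum>j. (cnj \<omega> * z) ^ j / of_real ((\<beta> j)\<^sup>2))"

definition zH2 :: "(nat \<Rightarrow> real) \<Rightarrow> complex fun_space" where
  "zH2 \<beta> = (H2 \<beta>)\<lparr>hcarrier := (\<lambda>f z. z * f z) ` hcarrier (H2 \<beta>)\<rparr>"

definition comp_op :: "complex fun_space \<Rightarrow> (complex \<Rightarrow> complex) \<Rightarrow> (complex, complex) fun_op" where
  "comp_op H \<phi> = (\<lambda>h\<in>hcarrier H. on_disk (\<lambda>z. h (\<phi> z)))"

definition mult_op :: "complex fun_space \<Rightarrow> (complex \<Rightarrow> complex) \<Rightarrow> (complex, complex) fun_op" where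
  "mult_op H f = (\<lambda>h\<in>hcarrier H. on_disk (\<lambda>z. f z * h z))"

definition \<beta>\<^sub>w :: "real \<Rightarrow> nat \<Rightarrow> real" where
  "\<beta>\<^sub>w \<alpha> j = (if j = 0 then 1
     else sqrt (Gamma (real j + \<alpha> + 1) / (fact (j - 1) * Gamma (\<alpha> + 2))))"

definition \<gamma>\<^sub>w :: "real \<Rightarrow> nat \<Rightarrow> real" where
  "\<gamma>\<^sub>w \<alpha> j = sqrt (fact j * Gamma (\<alpha> + 2) / Gamma (real j + \<alpha> + 2))"

definition weighted_bergman :: "real \<Rightarrow> complex fun_space" where
  "weighted_bergman \<alpha> = H2 (\<gamma>\<^sub>w \<alpha>)"

definition V_op :: "real \<Rightarrow> (complex, complex) fun_op" where
  "V_op \<alpha> = (THE V. unitary_op (weighted_bergman \<alpha>) (zH2 (\<beta>\<^sub>w \<alpha>)) V \<and>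
     (\<forall>j. V (on_disk (\<lambda>z. z ^ j)) =
        on_disk (\<lambda>z. of_real (\<gamma>\<^sub>w \<alpha> j / \<beta>\<^sub>w \<alpha> (j + 1)) * z ^ (j + 1))))"

end

theory Submission imports Defs begin

text \<open>
  Write \<open>s = \<alpha> + 2\<close>. The substitution \<open>z = (w - 1) / (w + 1)\<close>, \<open>F(w) = (w + 1)\<^bsup>-s\<^esup> f(z)\<close> turns the
  Bergman space into a space of functions on the right half-plane. Two families of operators act
  there: the dilations \<open>U F(w) = a\<^bsup>s/2\<^esup> F(a w)\<close>, which are unitary, and the translations
  \<open>P\<^sub>t F(w) = F(w + t)\<close> with \<open>t \<ge> 0\<close>, a semigroup of positive injective contractions tending
  strongly to the identity as \<open>t\<close> decreases to \<open>0\<close>. They satisfy \<open>P\<^sub>t U = U P\<^bsub>at\<^esub>\<close>. (On the Laplace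
  transform side \<open>P\<^sub>t\<close> is multiplication by \<open>exp (- t x)\<close> and \<open>U\<close> is a dilation.)

  The symbol \<open>\<sigma>\<close> fixes \<open>0\<close>, so \<open>C\<^sub>\<sigma>\<close> fixes the constants and maps the functions vanishing at \<open>0\<close> to
  themselves; transported to the Bergman space by \<open>V\<close>, the second part is
  \<open>\<kappa> U P\<^bsub>1-a\<^esub>\<close> with \<open>\<kappa> = a\<^bsup>-\<alpha>/2\<^esup>\<close> (\<open>V_intertwines\<close>, \<open>comp_op_eq_model_op\<close>).
  For \<open>T = \<kappa> U P\<^sub>t\<close> the semigroup laws give \<open>T\<^sup>* T = (\<kappa> P\<^sub>t)\<^sup>2\<close>, so \<open>|T| = \<kappa> P\<^sub>t\<close>,
  \<open>|T|\<^bsup>1/2\<^esup> = \<kappa>\<^bsup>1/2\<^esup> P\<^bsub>t/2\<^esub>\<close>, the partial isometry is \<open>U\<close>, and the Aluthge transform is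
  \<open>\<kappa> P\<^bsub>t/2\<^esub> U P\<^bsub>t/2\<^esub> = \<kappa> U P\<^bsub>(1+a)t/2\<^esub>\<close> (\<open>aluthge_model_op\<close>). The \<open>n\<close>-th iterate is therefore
  \<open>\<kappa> U P\<close> with the translation length \<open>((1 + a) / 2)\<^sup>n (1 - a)\<close>. This length tends to \<open>0\<close>, so the iterates
  converge strongly to \<open>\<kappa> U\<close> (\<open>model_op_tendsto\<close>), a multiple of a unitary operator. In the
  coordinates of the disk, \<open>\<kappa> U\<close> is the weighted composition operator of the theorem (\<open>limit_eq\<close>).

  Square roots and polar parts are given by definite descriptions, so it must also be shown that a
  positive square root is unique (\<open>positive_sqrt_unique\<close>) and that a partial isometry is
  determined by its values on the range of \<open>|T|\<close>, which is dense. Boundedness of \<open>U\<close> and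
  \<open>P\<^sub>t\<close> and all identities between them are checked on the reproducing kernels at the real points of
  the half-plane, where each of these operators maps a kernel to a multiple of a kernel; the kernels at
  the points \<open>x > 1\<close> already span a dense subspace (\<open>kernels_dense\<close>, \<open>hk_dense\<close>).
\<close>

section \<open>Inner product spaces of functions\<close>

definition linear_on :: "('x \<Rightarrow> complex) set \<Rightarrow> (('x \<Rightarrow> complex) \<Rightarrow> 'y \<Rightarrow> complex) \<Rightarrow> bool" where
  "linear_on C T \<longleftrightarrow> (\<forall>f\<in>C. \<forall>g\<in>C. \<forall>c d.
     T (\<lambda>x. c * f x + d * g x) = (\<lambda>y. c * T f y + d * T g y))"

lemma linear_onD:
  "linear_on C T \<Longrightarrow> f \<in> C \<Longrightarrow> g \<in> C \<Longrightarrow>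
     T (\<lambda>x. c * f x + d * g x) = (\<lambda>y. c * T f y + d * T g y)"
  by (simp add: linear_on_def)

lemma linear_on_add:
  "linear_on C T \<Longrightarrow> f \<in> C \<Longrightarrow> g \<in> C \<Longrightarrow> T (\<lambda>x. f x + g x) = (\<lambda>y. T f y + T g y)"
  using linear_onD[of C T f g 1 1] by simp

lemma linear_on_diff:
  "linear_on C T \<Longrightarrow> f \<in> C \<Longrightarrow> g \<in> C \<Longrightarrow> T (\<lambda>x. f x - g x) = (\<lambda>y. T f y - T g y)"
  using linear_onD[of C T f g 1 "-1"] by simp

lemma linear_on_scale:
  "linear_on C T \<Longrightarrow> f \<in> C \<Longrightarrow> T (\<lambda>x. c * f x) = (\<lambda>y. c * T f y)"
  using linear_onD[of C T f f c 0] by simp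

lemma linear_on_minus:
  "linear_on C T \<Longrightarrow> f \<in> C \<Longrightarrow> T (\<lambda>x. - f x) = (\<lambda>y. - T f y)"
  using linear_onD[of C T f f "-1" 0] by simp

lemma bounded_opsD:
  assumes "T \<in> bounded_ops H K"
  shows "f \<in> hcarrier H \<Longrightarrow> T f \<in> hcarrier K" and "linear_on (hcarrier H) T"
    and "T \<in> extensional (hcarrier H)"
    and "\<exists>c. \<forall>f\<in>hcarrier H. hnorm K (T f) \<le> c * hnorm H f"
  using assms by (auto simp: bounded_ops_def linear_on_def PiE_def)

lemma bounded_opsI:
  assumes "\<And>f. f \<in> hcarrier H \<Longrightarrow> T f \<in> hcarrier K" and "linear_on (hcarrier H) T"
    and "T \<in> extensional (hcarrier H)"
    and "\<And>f. f \<in> hcarrier H \<Longrightarrow> hnorm K (T f) \<le> c * hnorm H f"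
  shows "T \<in> bounded_ops H K"
proof -
  have "\<exists>c. \<forall>f\<in>hcarrier H. hnorm K (T f) \<le> c * hnorm H f" using assms(4) by blast
  then show ?thesis using assms(1-3) by (simp add: bounded_ops_def linear_on_def PiE_def Pi_def)
qed

text \<open>
  The form need not be definite: besides the inner product of a space, it will be instantiated with
  \<open>\<lambda>f g. \<langle>T f, g\<rangle>\<close> for a positive operator \<open>T\<close>.
\<close>
locale psd_form =
  fixes C :: "('x \<Rightarrow> complex) set" and B :: "('x \<Rightarrow> complex) \<Rightarrow> ('x \<Rightarrow> complex) \<Rightarrow> complex"
  assumes C_lin: "f \<in> C \<Longrightarrow> g \<in> C \<Longrightarrow> (\<lambda>x. c * f x + d * g x) \<in> C"
    and B_lin: "f \<in> C \<Longrightarrow> g \<in> C \<Longrightarrow> h \<in> C \<Longrightarrow> B (\<lambda>x. c * f x + d * g x) h = c * B f h + d * B g h"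
    and B_sym: "f \<in> C \<Longrightarrow> g \<in> C \<Longrightarrow> B g f = cnj (B f g)"
    and B_pos: "f \<in> C \<Longrightarrow> 0 \<le> Re (B f f)"
begin

lemma C_add: "f \<in> C \<Longrightarrow> g \<in> C \<Longrightarrow> (\<lambda>x. f x + g x) \<in> C"
  using C_lin[of f g 1 1] by simp

lemma C_diff: "f \<in> C \<Longrightarrow> g \<in> C \<Longrightarrow> (\<lambda>x. f x - g x) \<in> C"
  using C_lin[of f g 1 "-1"] by simp

lemma C_scale: "f \<in> C \<Longrightarrow> (\<lambda>x. c * f x) \<in> C"
  using C_lin[of f f c 0] by simp

lemma C_minus: "f \<in> C \<Longrightarrow> (\<lambda>x. - f x) \<in> C"
  using C_lin[of f f "-1" 0] by simp

lemma B_add: "f \<in> C \<Longrightarrow> g \<in> C \<Longrightarrow> h \<in> C \<Longrightarrow> B (\<lambda>x. f x + g x) h = B f h + B g h"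
  using B_lin[of f g h 1 1] by simp

lemma B_diff: "f \<in> C \<Longrightarrow> g \<in> C \<Longrightarrow> h \<in> C \<Longrightarrow> B (\<lambda>x. f x - g x) h = B f h - B g h"
  using B_lin[of f g h 1 "-1"] by simp

lemma B_scale: "f \<in> C \<Longrightarrow> h \<in> C \<Longrightarrow> B (\<lambda>x. c * f x) h = c * B f h"
  using B_lin[of f f h c 0] by simp

lemma B_minus: "f \<in> C \<Longrightarrow> h \<in> C \<Longrightarrow> B (\<lambda>x. - f x) h = - B f h"
  using B_lin[of f f h "-1" 0] by simp

lemma B_lin_right:
  "f \<in> C \<Longrightarrow> g \<in> C \<Longrightarrow> h \<in> C \<Longrightarrow> B h (\<lambda>x. c * f x + d * g x) = cnj c * B h f + cnj d * B h g"
  by (subst B_sym[OF C_lin]) (simp_all add: B_lin, metis B_sym)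

lemma B_add_right: "f \<in> C \<Longrightarrow> g \<in> C \<Longrightarrow> h \<in> C \<Longrightarrow> B h (\<lambda>x. f x + g x) = B h f + B h g"
  using B_lin_right[of f g h 1 1] by simp

lemma B_diff_right: "f \<in> C \<Longrightarrow> g \<in> C \<Longrightarrow> h \<in> C \<Longrightarrow> B h (\<lambda>x. f x - g x) = B h f - B h g"
  using B_lin_right[of f g h 1 "-1"] by simp

lemma B_scale_right: "f \<in> C \<Longrightarrow> h \<in> C \<Longrightarrow> B h (\<lambda>x. c * f x) = cnj c * B h f"
  using B_lin_right[of f f h c 0] by simp

lemma B_minus_right: "f \<in> C \<Longrightarrow> h \<in> C \<Longrightarrow> B h (\<lambda>x. - f x) = - B h f"
  using B_lin_right[of f f h "-1" 0] by simp

lemmas form_simps = B_minus B_minus_right C_add C_diff C_scale C_minus B_add B_diff B_scale B_add_right B_diff_right B_scale_right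

lemma B_real: "f \<in> C \<Longrightarrow> B f f = of_real (Re (B f f))"
  using B_sym[of f f] by (auto simp: complex_eq_iff)

lemma Cauchy_Schwarz:
  assumes f: "f \<in> C" and g: "g \<in> C"
  shows "(cmod (B f g))\<^sup>2 \<le> Re (B f f) * Re (B g g)"
proof -
  define p q b where "p = Re (B f f)" and "q = Re (B g g)" and "b = B f g"
  have gf: "B g f = cnj b" unfolding b_def by (rule B_sym[OF f g])
  have bb: "cnj b * b = of_real ((cmod b)\<^sup>2)"
    by (simp add: complex_norm_square mult.commute del: of_real_power)
  have quad: "0 \<le> p - 2 * t * (cmod b)\<^sup>2 + t\<^sup>2 * (cmod b)\<^sup>2 * q" for t :: real
  proof -
    let ?d = "of_real t * b"
    let ?h = "\<lambda>x. f x - ?d * g x"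
    have ff: "B f f = of_real p" and gg: "B g g = of_real q"
      unfolding p_def q_def using B_real f g by auto
    have "B ?h ?h = of_real p - of_real t * (cnj b * b) - of_real t * (cnj b * b)
            + of_real (t\<^sup>2) * of_real q * (cnj b * b)"
      using f g by (simp add: form_simps gf ff gg b_def[symmetric] algebra_simps power2_eq_square)
    then have "B ?h ?h = of_real (p - 2 * t * (cmod b)\<^sup>2 + t\<^sup>2 * (cmod b)\<^sup>2 * q)"
      unfolding bb by (simp add: algebra_simps)
    moreover have "0 \<le> Re (B ?h ?h)"
      using f g by (intro B_pos) (simp add: form_simps)
    ultimately show ?thesis by (metis Re_complex_of_real)
  qed
  have p0: "0 \<le> p" and q0: "0 \<le> q" unfolding p_def q_def using B_pos f g by auto
  have "(cmod b)\<^sup>2 \<le> p * q"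
  proof (cases "q = 0")
    case True
    have "(cmod b)\<^sup>2 = 0"
    proof (rule ccontr)
      assume "(cmod b)\<^sup>2 \<noteq> 0"
      \<comment> \<open>For \<open>q = 0\<close> the quadratic in \<open>t\<close> is affine; this \<open>t\<close> would make it equal to \<open>- p - 2\<close>.\<close>
      then have "2 * ((p + 1) / (cmod b)\<^sup>2) * (cmod b)\<^sup>2 = 2 * (p + 1)" by simp
      then show False using quad[of "(p + 1) / (cmod b)\<^sup>2"] True p0 by simp
    qed
    then show ?thesis using True by simp
  next
    case False
    then have "0 \<le> p - 2 * (1 / q) * (cmod b)\<^sup>2 + (1 / q) * (cmod b)\<^sup>2"
      using quad[of "1 / q"] by (simp add: power2_eq_square)
    then have "(cmod b)\<^sup>2 / q \<le> p" by simp
    then show ?thesis using False q0 by (simp add: divide_le_eq)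
  qed
  then show ?thesis unfolding p_def q_def b_def .
qed

end

locale pre_hilbert = psd_form "hcarrier H" "hinner H" for H :: "'x fun_space" +
  assumes zero_in: "(\<lambda>_. 0) \<in> hcarrier H"
    and definite: "f \<in> hcarrier H \<Longrightarrow> hinner H f f = 0 \<Longrightarrow> f = (\<lambda>_. 0)"
begin

lemma norm_sq: "f \<in> hcarrier H \<Longrightarrow> (hnorm H f)\<^sup>2 = Re (hinner H f f)"
  by (simp add: hnorm_def B_pos)

lemma norm_nonneg: "f \<in> hcarrier H \<Longrightarrow> 0 \<le> hnorm H f"
  by (simp add: hnorm_def B_pos)

lemma inner_self: "f \<in> hcarrier H \<Longrightarrow> hinner H f f = of_real ((hnorm H f)\<^sup>2)"
  using B_real norm_sq by metis

lemma norm_eq_0: "f \<in> hcarrier H \<Longrightarrow> hnorm H f = 0 \<Longrightarrow> f = (\<lambda>_. 0)"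
  using inner_self definite by simp

lemma inner_le_norm:
  assumes "f \<in> hcarrier H" "g \<in> hcarrier H"
  shows "cmod (hinner H f g) \<le> hnorm H f * hnorm H g"
proof (rule power2_le_imp_le)
  show "(cmod (hinner H f g))\<^sup>2 \<le> (hnorm H f * hnorm H g)\<^sup>2"
    using Cauchy_Schwarz[OF assms] assms by (simp add: power_mult_distrib norm_sq)
qed (simp add: assms norm_nonneg)

lemma inner_zero_left: "h \<in> hcarrier H \<Longrightarrow> hinner H (\<lambda>_. 0) h = 0"
  using B_scale[of "\<lambda>_. 0" h 0] zero_in by simp

lemma inner_zero_right: "h \<in> hcarrier H \<Longrightarrow> hinner H h (\<lambda>_. 0) = 0"
  using B_scale_right[of "\<lambda>_. 0" h 0] zero_in by simp

lemma norm_zero [simp]: "hnorm H (\<lambda>_. 0) = 0"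
  using inner_zero_left[OF zero_in] by (simp add: hnorm_def)

lemma norm_scale: "f \<in> hcarrier H \<Longrightarrow> hnorm H (\<lambda>x. c * f x) = cmod c * hnorm H f"
proof -
  assume f: "f \<in> hcarrier H"
  have "hinner H (\<lambda>x. c * f x) (\<lambda>x. c * f x) = (c * cnj c) * hinner H f f"
    using f by (simp add: form_simps)
  also have "\<dots> = of_real ((cmod c)\<^sup>2 * (hnorm H f)\<^sup>2)"
    using f by (simp add: inner_self complex_norm_square[symmetric])
  finally show ?thesis
    using f norm_nonneg[OF f] by (simp add: hnorm_def[of _ "\<lambda>x. c * f x"] real_sqrt_mult)
qed

lemma norm_triangle:
  assumes f: "f \<in> hcarrier H" and g: "g \<in> hcarrier H"
  shows "hnorm H (\<lambda>x. f x + g x) \<le> hnorm H f + hnorm H g"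
proof (rule power2_le_imp_le)
  have "hinner H g f = cnj (hinner H f g)" using B_sym[OF f g] .
  then have "(hnorm H (\<lambda>x. f x + g x))\<^sup>2 = (hnorm H f)\<^sup>2 + 2 * Re (hinner H f g) + (hnorm H g)\<^sup>2"
    using f g by (simp add: norm_sq form_simps)
  also have "Re (hinner H f g) \<le> hnorm H f * hnorm H g"
    using inner_le_norm[OF f g] complex_Re_le_cmod order_trans by blast
  finally show "(hnorm H (\<lambda>x. f x + g x))\<^sup>2 \<le> (hnorm H f + hnorm H g)\<^sup>2"
    by (simp add: power2_sum)
qed (simp add: f g norm_nonneg)

lemma norm_triangle_diff:
  assumes "f \<in> hcarrier H" "g \<in> hcarrier H" "h \<in> hcarrier H"
  shows "hnorm H (\<lambda>x. f x - h x) \<le> hnorm H (\<lambda>x. f x - g x) + hnorm H (\<lambda>x. g x - h x)"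
  using norm_triangle[of "\<lambda>x. f x - g x" "\<lambda>x. g x - h x"] assms by (simp add: C_diff)

lemma norm_minus_commute: "f \<in> hcarrier H \<Longrightarrow> g \<in> hcarrier H \<Longrightarrow>
    hnorm H (\<lambda>x. f x - g x) = hnorm H (\<lambda>x. g x - f x)"
  using norm_scale[of "\<lambda>x. f x - g x" "-1"] by (simp add: C_diff)

lemma inner_eqI:
  assumes f: "f \<in> hcarrier H" and g: "g \<in> hcarrier H"
    and eq: "\<And>h. h \<in> hcarrier H \<Longrightarrow> hinner H h f = hinner H h g"
  shows "f = g"
proof -
  have "hinner H (\<lambda>x. f x - g x) (\<lambda>x. f x - g x) = 0"
    using f g eq[of f] eq[of g] by (simp add: form_simps)
  then have "(\<lambda>x. f x - g x) = (\<lambda>_. 0)" using f g by (intro definite) (simp_all add: C_diff)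
  then show ?thesis by (auto simp: fun_eq_iff)
qed

section \<open>Uniqueness of positive square roots\<close>

text \<open>
  Unlike the operators of the theorem, these are not required to be extensional, so that sums and
  products of them can be written pointwise.
\<close>
definition symmetric_op :: "(('x \<Rightarrow> complex) \<Rightarrow> 'x \<Rightarrow> complex) \<Rightarrow> bool" where
  "symmetric_op T \<longleftrightarrow> (\<forall>f\<in>hcarrier H. T f \<in> hcarrier H) \<and> linear_on (hcarrier H) T \<and>
     (\<forall>f\<in>hcarrier H. \<forall>g\<in>hcarrier H. hinner H (T f) g = hinner H f (T g))"

lemma
  assumes "symmetric_op T"
  shows symmetric_op_in: "f \<in> hcarrier H \<Longrightarrow> T f \<in> hcarrier H"
    and symmetric_op_linear: "linear_on (hcarrier H) T"
    and symmetric_op_adj: "f \<in> hcarrier H \<Longrightarrow> g \<in> hcarrier H \<Longrightarrow> hinner H (T f) g = hinner H f (T g)"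
  using assms by (auto simp: symmetric_op_def)

text \<open>
  The operator inequality \<open>T\<^sup>2 \<le> K T\<close> for \<open>0 \<le> T \<le> K\<close>, from the Cauchy--Schwarz inequality of the form
  \<open>\<langle>T f, g\<rangle>\<close> applied to \<open>f\<close> and \<open>T f\<close>.
\<close>
lemma symmetric_op_sq_le:
  assumes T: "symmetric_op T" and pos: "\<And>f. f \<in> hcarrier H \<Longrightarrow> 0 \<le> Re (hinner H (T f) f)"
    and le: "\<And>f. f \<in> hcarrier H \<Longrightarrow> Re (hinner H (T f) f) \<le> K * (hnorm H f)\<^sup>2"
    and f: "f \<in> hcarrier H"
  shows "(hnorm H (T f))\<^sup>2 \<le> K * Re (hinner H (T f) f)"
proof -
  note Tin = symmetric_op_in[OF T]
  interpret E: psd_form "hcarrier H" "\<lambda>f g. hinner H (T f) g"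
  proof
    fix f g h c d assume "f \<in> hcarrier H" "g \<in> hcarrier H" "h \<in> hcarrier H"
    then show "hinner H (T (\<lambda>x. c * f x + d * g x)) h = c * hinner H (T f) h + d * hinner H (T g) h"
      by (simp add: linear_onD[OF symmetric_op_linear[OF T]] B_lin Tin)
  next
    fix f g assume "f \<in> hcarrier H" "g \<in> hcarrier H"
    then show "hinner H (T g) f = cnj (hinner H (T f) g)"
      by (simp add: symmetric_op_adj[OF T] B_sym[symmetric] Tin)
  qed (simp_all add: C_lin pos)
  let ?n = "(hnorm H (T f))\<^sup>2"
  have "?n\<^sup>2 \<le> Re (hinner H (T f) f) * Re (hinner H (T (T f)) (T f))"
    using E.Cauchy_Schwarz[OF f Tin[OF f]] by (simp add: inner_self Tin f norm_power)
  also have "\<dots> \<le> Re (hinner H (T f) f) * (K * ?n)"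
    by (intro mult_left_mono le pos Tin f)
  finally have *: "?n * ?n \<le> K * Re (hinner H (T f) f) * ?n"
    by (simp add: power2_eq_square algebra_simps)
  show ?thesis
  proof (cases "?n = 0")
    case True
    then have "T f = (\<lambda>_. 0)" using norm_eq_0 Tin f by simp
    then show ?thesis using f by (simp add: inner_zero_left)
  next
    case False
    then have "0 < ?n" by (simp add: less_le)
    then show ?thesis using mult_right_le_imp_le[OF *] by simp
  qed
qed

text \<open>
  On the spectrum this is \<open>x \<mapsto> x - x\<^sup>2 / K\<close>, which maps \<open>[0, K]\<close> to itself. Summing the decrements
  writes \<open>x\<close> as a series of squares of polynomials in \<open>x\<close>; this device of F. Riesz replaces the
  square root of \<open>E\<close>.
\<close>
primrec riesz_iter :: "real \<Rightarrow> (('x \<Rightarrow> complex) \<Rightarrow> 'x \<Rightarrow> complex) \<Rightarrow> nat \<Rightarrow> ('x \<Rightarrow> complex) \<Rightarrow> 'x \<Rightarrow> complex"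
  where
    "riesz_iter K E 0 = E"
  | "riesz_iter K E (Suc n) = (\<lambda>f x. riesz_iter K E n f x
       - of_real (inverse K) * riesz_iter K E n (riesz_iter K E n f) x)"

text \<open>
  The product of two commuting positive operators is positive. With \<open>E\<^sub>n\<close> the Riesz iterates,
  \<open>E = (\<Sum>k<n. E\<^sub>k\<^sup>2) / K + E\<^sub>n\<close>, and \<open>R E\<^sub>k\<^sup>2 = E\<^sub>k R E\<^sub>k \<ge> 0\<close> because the \<open>E\<^sub>k\<close> commute
  with \<open>R\<close>. The remainder disappears in the limit, since \<open>\<Sum>k. \<parallel>E\<^sub>k f\<parallel>\<^sup>2\<close> converges.
\<close>
lemma commuting_product_nonneg:
  assumes E: "symmetric_op E" and R: "symmetric_op R"
    and E_pos: "\<And>f. f \<in> hcarrier H \<Longrightarrow> 0 \<le> Re (hinner H (E f) f)"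
    and R_pos: "\<And>f. f \<in> hcarrier H \<Longrightarrow> 0 \<le> Re (hinner H (R f) f)"
    and E_le: "\<And>f. f \<in> hcarrier H \<Longrightarrow> Re (hinner H (E f) f) \<le> K * (hnorm H f)\<^sup>2" and K: "K > 0"
    and comm: "\<And>f. f \<in> hcarrier H \<Longrightarrow> E (R f) = R (E f)"
    and f: "f \<in> hcarrier H"
  shows "0 \<le> Re (hinner H (R (E f)) f)"
proof -
  \<comment> \<open>The iterates stay between \<open>0\<close> and \<open>K\<close> and commute with \<open>R\<close>.\<close>
  define e where "e n = riesz_iter K E n" for n
  have e0: "e 0 = E" and eS: "e (Suc n) = (\<lambda>f x. e n f x - of_real (inverse K) * e n (e n f) x)" for n
    by (simp_all add: e_def)
  note Rin = symmetric_op_in[OF R]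
  have inv: "symmetric_op (e n) \<and> (\<forall>g\<in>hcarrier H. 0 \<le> Re (hinner H (e n g) g) \<and>
      Re (hinner H (e n g) g) \<le> K * (hnorm H g)\<^sup>2 \<and> e n (R g) = R (e n g))" for n
  proof (induction n)
    case 0
    then show ?case using E E_pos E_le comm by (simp add: e0)
  next
    case (Suc n)
    then have s: "symmetric_op (e n)" by simp
    note i = symmetric_op_in[OF s] and l = symmetric_op_linear[OF s] and a = symmetric_op_adj[OF s]
    have sS: "symmetric_op (e (Suc n))"
      unfolding symmetric_op_def eS
    proof (intro conjI ballI)
      show "linear_on (hcarrier H) (\<lambda>f x. e n f x - of_real (inverse K) * e n (e n f) x)"
        unfolding linear_on_def
        by (auto simp: linear_onD[OF l] i fun_eq_iff algebra_simps)
    qed (simp_all add: form_simps i a)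
    have step: "hinner H (e (Suc n) g) g = hinner H (e n g) g - of_real ((hnorm H (e n g))\<^sup>2 / K)"
      if "g \<in> hcarrier H" for g
    proof -
      have "hinner H (e n (e n g)) g = of_real ((hnorm H (e n g))\<^sup>2)"
        using that by (simp add: a[of "e n g" g] i inner_self)
      then show ?thesis using that by (simp add: eS form_simps i divide_inverse mult.commute)
    qed
    have bounds: "0 \<le> Re (hinner H (e (Suc n) g) g)" "Re (hinner H (e (Suc n) g) g) \<le> K * (hnorm H g)\<^sup>2"
      if g: "g \<in> hcarrier H" for g
    proof -
      have "(hnorm H (e n g))\<^sup>2 \<le> K * Re (hinner H (e n g) g)"
        by (rule symmetric_op_sq_le[OF s _ _ g]) (use Suc in auto)
      then have "(hnorm H (e n g))\<^sup>2 / K \<le> Re (hinner H (e n g) g)"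
        using K by (simp add: field_simps)
      moreover have "0 \<le> (hnorm H (e n g))\<^sup>2 / K" using K by simp
      moreover have "Re (hinner H (e n g) g) \<le> K * (hnorm H g)\<^sup>2" using Suc g by simp
      ultimately show "0 \<le> Re (hinner H (e (Suc n) g) g)"
          "Re (hinner H (e (Suc n) g) g) \<le> K * (hnorm H g)\<^sup>2"
        unfolding step[OF g] by auto
    qed
    have "e (Suc n) (R g) = R (e (Suc n) g)" if g: "g \<in> hcarrier H" for g
      using Suc g unfolding eS
      by (simp add: linear_on_diff[OF symmetric_op_linear[OF R]]
          linear_on_scale[OF symmetric_op_linear[OF R]] i C_scale)
    then show ?case using sS bounds by simp
  qed
  have s: "symmetric_op (e n)" for n using inv by simp
  note i = symmetric_op_in[OF s] and a = symmetric_op_adj[OF s]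
  have sum_le: "(\<Sum>k<n. (hnorm H (e k f))\<^sup>2) / K + Re (hinner H (e n f) f) = Re (hinner H (E f) f)" for n
  proof (induction n)
    case 0 then show ?case by (simp add: e0)
  next
    case (Suc n)
    have "hinner H (e n (e n f)) f = of_real ((hnorm H (e n f))\<^sup>2)"
      using f by (simp add: a[of "e n f" f] i inner_self)
    then have "hinner H (e (Suc n) f) f = hinner H (e n f) f - of_real ((hnorm H (e n f))\<^sup>2 / K)"
      using f by (simp add: eS form_simps i divide_inverse mult.commute)
    then show ?case using Suc by (simp add: add_divide_distrib)
  qed
  have "summable (\<lambda>k. (hnorm H (e k f))\<^sup>2)"
  proof (rule summableI_nonneg_bounded)
    fix n
    have "(\<Sum>k<n. (hnorm H (e k f))\<^sup>2) / K \<le> Re (hinner H (E f) f)"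
      using sum_le[of n] inv f by (smt (verit))
    then show "(\<Sum>k<n. (hnorm H (e k f))\<^sup>2) \<le> K * Re (hinner H (E f) f)"
      using K by (simp add: field_simps)
  qed simp
  then have "(\<lambda>k. (hnorm H (e k f))\<^sup>2) \<longlonglongrightarrow> 0" by (rule summable_LIMSEQ_zero)
  then have "(\<lambda>k. sqrt ((hnorm H (e k f))\<^sup>2)) \<longlonglongrightarrow> sqrt 0" by (intro tendsto_real_sqrt)
  then have e_lim: "(\<lambda>k. hnorm H (e k f)) \<longlonglongrightarrow> 0"
    using norm_nonneg i f by simp
  have mono: "Re (hinner H (R (e n f)) f) \<le> Re (hinner H (R (E f)) f)" for n
  proof (induction n)
    case 0 then show ?case by (simp add: e0)
  next
    case (Suc n)
    have c: "R (e n (e n f)) = e n (R (e n f))" using inv f i by simp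
    have "hinner H (R (e n (e n f))) f = hinner H (R (e n f)) (e n f)"
      unfolding c by (rule a) (simp_all add: f i Rin)
    then have "hinner H (R (e (Suc n) f)) f = hinner H (R (e n f)) f
        - of_real (inverse K) * hinner H (R (e n f)) (e n f)"
      using f by (simp add: eS linear_on_diff[OF symmetric_op_linear[OF R]]
          linear_on_scale[OF symmetric_op_linear[OF R]] i form_simps Rin)
    then have "Re (hinner H (R (e (Suc n) f)) f) = Re (hinner H (R (e n f)) f) - Re (hinner H (R (e n f)) (e n f)) / K"
      by (simp only: minus_complex.sel Re_complex_of_real Im_complex_of_real times_complex.sel) (simp add: divide_inverse)
    moreover have "0 \<le> Re (hinner H (R (e n f)) (e n f)) / K"
      using R_pos i f K by simp
    ultimately show ?case using Suc by simp
  qed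
  have "(\<lambda>n. - (hnorm H (e n f) * hnorm H (R f))) \<longlonglongrightarrow> - (0 * hnorm H (R f))"
    by (intro tendsto_intros e_lim)
  moreover have "- (hnorm H (e n f) * hnorm H (R f)) \<le> Re (hinner H (R (E f)) f)" for n
  proof -
    have "cmod (hinner H (e n f) (R f)) \<le> hnorm H (e n f) * hnorm H (R f)"
      using inner_le_norm i f Rin by simp
    moreover have "Re (hinner H (R (e n f)) f) = Re (hinner H (e n f) (R f))"
      using symmetric_op_adj[OF R] i f by simp
    ultimately show ?thesis using mono[of n] abs_Re_le_cmod[of "hinner H (e n f) (R f)"] by linarith
  qed
  ultimately show ?thesis by (intro LIMSEQ_le_const2[where X = "\<lambda>n. - (hnorm H (e n f) * hnorm H (R f))"]) auto
qed

text \<open>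
  Polarization: the form \<open>\<langle>T h, h\<rangle>\<close> is real at \<open>h = f + g\<close> and at \<open>h = f + \<i> g\<close>.
\<close>
lemma positive_op_symmetric:
  assumes "positive_op H T" shows "symmetric_op T"
proof -
  have i: "\<And>f. f \<in> hcarrier H \<Longrightarrow> T f \<in> hcarrier H" and l: "linear_on (hcarrier H) T"
    and r: "\<And>f. f \<in> hcarrier H \<Longrightarrow> hinner H (T f) f \<in> \<real>"
    using assms by (auto simp: positive_op_def bounded_ops_def linear_on_def)
  have "hinner H (T f) g = hinner H f (T g)" if f: "f \<in> hcarrier H" and g: "g \<in> hcarrier H" for f g
  proof -
    have "Im (hinner H (T (\<lambda>x. f x + c * g x)) (\<lambda>x. f x + c * g x)) = 0" for c
      using r[of "\<lambda>x. f x + c * g x"] f g by (simp add: form_simps complex_is_Real_iff)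
    then have "Im (hinner H (T f) (\<lambda>x. c * g x) + c * hinner H (T g) f) = 0" for c
      using f g r[OF f] r[OF g] r[of "\<lambda>x. c * g x"]
      by (simp add: linear_on_add[OF l] linear_on_scale[OF l] form_simps i complex_is_Real_iff)
        (simp add: algebra_simps)
    from this[of 1] this[of \<i>] have "hinner H (T f) g = cnj (hinner H (T g) f)"
      using f g by (simp add: form_simps i complex_eq_iff)
    then show ?thesis using B_sym[of "T g" f] f g i by simp
  qed
  then show ?thesis using i l by (simp add: symmetric_op_def)
qed

lemma positive_op_bounded: "positive_op H S \<Longrightarrow> S \<in> bounded_ops H H"
  and positive_op_nonneg: "positive_op H S \<Longrightarrow> f \<in> hcarrier H \<Longrightarrow> 0 \<le> Re (hinner H (S f) f)"
  by (auto simp: positive_op_def)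

lemma positive_op_form_zero:
  assumes S: "positive_op H S" and f: "f \<in> hcarrier H" and zero: "Re (hinner H (S f) f) = 0"
  shows "S f = (\<lambda>_. 0)"
proof -
  note s = positive_op_symmetric[OF S] and Sb = positive_op_bounded[OF S]
  obtain K where K: "\<And>f. f \<in> hcarrier H \<Longrightarrow> hnorm H (S f) \<le> K * hnorm H f"
    using bounded_opsD(4)[OF Sb] by auto
  have "(hnorm H (S f))\<^sup>2 \<le> K * Re (hinner H (S f) f)"
  proof (rule symmetric_op_sq_le[OF s positive_op_nonneg[OF S] _ f])
    fix g assume g: "g \<in> hcarrier H"
    have "Re (hinner H (S g) g) \<le> hnorm H (S g) * hnorm H g"
      using inner_le_norm[OF symmetric_op_in[OF s g] g] complex_Re_le_cmod order_trans by blast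
    also have "\<dots> \<le> K * (hnorm H g)\<^sup>2"
      using mult_right_mono[OF K[OF g] norm_nonneg[OF g]] by (simp add: power2_eq_square mult.assoc)
    finally show "Re (hinner H (S g) g) \<le> K * (hnorm H g)\<^sup>2" .
  qed
  then show ?thesis using zero norm_eq_0[OF symmetric_op_in[OF s f]] by simp
qed

text \<open>
  Let \<open>D = S - R\<close>. From \<open>S\<^sup>2 = R\<^sup>2\<close> one gets \<open>S D = - D R\<close> and \<open>R D = - D S\<close>, so \<open>D\<^sup>2\<close> commutes with \<open>R\<close>
  and \<open>R D\<^sup>2\<close> is positive. But \<open>\<langle>S D f, D f\<rangle> = - \<langle>R D\<^sup>2 f, f\<rangle>\<close>, so both sides vanish
  by positivity, and a positive operator annihilates the vectors on which its form vanishes.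
\<close>
lemma sqrt_difference_annihilated:
  assumes S: "positive_op H S" and R: "positive_op H R"
    and SS: "\<And>f. f \<in> hcarrier H \<Longrightarrow> S (S f) = R (R f)" and f: "f \<in> hcarrier H"
  shows "S (\<lambda>x. S f x - R f x) = (\<lambda>_. 0)"
proof -
  note s = positive_op_symmetric[OF S] and r = positive_op_symmetric[OF R]
  note si = symmetric_op_in[OF s] and sl = symmetric_op_linear[OF s] and sa = symmetric_op_adj[OF s]
  note ri = symmetric_op_in[OF r] and rl = symmetric_op_linear[OF r] and ra = symmetric_op_adj[OF r]
  define D where "D f = (\<lambda>x. S f x - R f x)" for f
  have di: "D f \<in> hcarrier H" if "f \<in> hcarrier H" for f using that by (simp add: D_def form_simps si ri)
  have dl: "linear_on (hcarrier H) D"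
    unfolding linear_on_def D_def by (auto simp: linear_onD[OF sl] linear_onD[OF rl] fun_eq_iff algebra_simps)
  have da: "hinner H (D f) g = hinner H f (D g)" if "f \<in> hcarrier H" "g \<in> hcarrier H" for f g
    using that by (simp add: D_def form_simps si ri sa ra)
  have SD: "S (D f) = (\<lambda>x. - D (R f) x)" and RD: "R (D f) = (\<lambda>x. - D (S f) x)" if "f \<in> hcarrier H" for f
    unfolding D_def using that
    by (simp_all add: linear_on_diff[OF sl] linear_on_diff[OF rl] si ri SS)
  have comm: "D (D (R f)) = R (D (D f))" if f: "f \<in> hcarrier H" for f
    using f by (simp only: SD RD di linear_on_minus[OF dl] ri si) simp
  obtain K1 where K1: "\<And>f. f \<in> hcarrier H \<Longrightarrow> hnorm H (S f) \<le> K1 * hnorm H f"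
    using bounded_opsD(4)[OF positive_op_bounded[OF S]] by auto
  obtain K2 where K2: "\<And>f. f \<in> hcarrier H \<Longrightarrow> hnorm H (R f) \<le> K2 * hnorm H f"
    using bounded_opsD(4)[OF positive_op_bounded[OF R]] by auto
  \<comment> \<open>A strictly positive bound, as the Riesz iteration divides by it.\<close>
  define K where "K = (\<bar>K1\<bar> + \<bar>K2\<bar> + 1)"
  have K: "hnorm H (D f) \<le> K * hnorm H f" if f: "f \<in> hcarrier H" for f
  proof -
    have "hnorm H (D f) \<le> hnorm H (S f) + hnorm H (R f)"
      using norm_triangle[of "S f" "\<lambda>x. - R f x"] norm_scale[of "R f" "-1"] f
      by (simp add: si ri D_def form_simps)
    also have "\<dots> \<le> K1 * hnorm H f + K2 * hnorm H f"
      using K1 K2 f by (simp add: add_mono)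
    also have "\<dots> \<le> K * hnorm H f"
      unfolding K_def distrib_right[symmetric] using norm_nonneg[OF f] by (intro mult_right_mono) auto
    finally show ?thesis .
  qed
  have K0: "K > 0" by (simp add: K_def)
  have D2: "symmetric_op (\<lambda>f. D (D f))"
    unfolding symmetric_op_def
    by (auto simp: di da linear_on_def linear_onD[OF dl])
  have DDf: "hinner H (D (D f)) f = of_real ((hnorm H (D f))\<^sup>2)" if "f \<in> hcarrier H" for f
    using that by (simp add: da[of "D f" f] di inner_self)
  have DDle: "Re (hinner H (D (D f)) f) \<le> K\<^sup>2 * (hnorm H f)\<^sup>2" if f: "f \<in> hcarrier H" for f
    using power_mono[OF K[OF f], of 2] norm_nonneg di f by (simp add: DDf power_mult_distrib)
  have "0 \<le> Re (hinner H (R (D (D f))) f)"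
    by (rule commuting_product_nonneg[OF D2 r _ positive_op_nonneg[OF R] DDle]) (use f K0 comm DDf in auto)
  moreover have "hinner H (S (D f)) (D f) = - hinner H (R (D (D f))) f"
  proof -
    have "hinner H (S (D f)) (D f) = - hinner H (D (R f)) (D f)"
      using f by (simp add: SD form_simps di ri)
    also have "\<dots> = - hinner H (R (D (D f))) f"
      using f by (simp add: da[symmetric] di ri comm)
    finally show ?thesis .
  qed
  ultimately have "Re (hinner H (S (D f)) (D f)) = 0"
    using positive_op_nonneg[OF S di[OF f]] by simp
  from positive_op_form_zero[OF S di[OF f] this] show ?thesis by (simp only: D_def)
qed

text \<open>
  Exchanging the two roots in the previous lemma, \<open>d = S f - R f\<close> is annihilated by \<open>S\<close> and by \<open>R\<close>,
  hence orthogonal to \<open>S f\<close> and to \<open>R f\<close>, hence to itself.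
\<close>
lemma positive_sqrt_unique:
  assumes S: "positive_op H S" and R: "positive_op H R"
    and eq: "compose (hcarrier H) S S = compose (hcarrier H) R R"
  shows "S = R"
proof (rule extensionalityI[of _ "hcarrier H"])
  note s = positive_op_symmetric[OF S] and r = positive_op_symmetric[OF R]
  have SS: "S (S f) = R (R f)" if "f \<in> hcarrier H" for f
    using fun_cong[OF eq, of f] that by (simp add: compose_def)
  fix f assume f: "f \<in> hcarrier H"
  note i = symmetric_op_in[OF s f] symmetric_op_in[OF r f]
  define d where "d = (\<lambda>x. S f x - R f x)"
  have d: "d \<in> hcarrier H" unfolding d_def by (rule C_diff[OF i])
  have "S d = (\<lambda>_. 0)" unfolding d_def by (rule sqrt_difference_annihilated[OF S R SS f])
  moreover have "R (\<lambda>x. R f x - S f x) = (\<lambda>_. 0)"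
    by (rule sqrt_difference_annihilated[OF R S SS[symmetric] f])
  then have "R d = (\<lambda>_. 0)"
    using linear_on_minus[OF symmetric_op_linear[OF r] d] by (simp add: d_def fun_eq_iff)
  ultimately have "hinner H d (S f) = 0" "hinner H d (R f) = 0"
    using symmetric_op_adj[OF s d f] symmetric_op_adj[OF r d f] inner_zero_left[OF f] by simp_all
  moreover have "hinner H d d = hinner H d (S f) - hinner H d (R f)"
    using B_diff_right[OF i d] by (simp only: d_def)
  ultimately have "hinner H d d = 0" by simp
  then have "d = (\<lambda>_. 0)" by (rule definite[OF d])
  then show "S f = R f" by (simp add: d_def fun_eq_iff)
qed (use S R positive_op_bounded bounded_opsD(3) in auto)

lemma op_sqrt_eqI:
  assumes "positive_op H S" "compose (hcarrier H) S S = T"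
  shows "op_sqrt H T = S"
  unfolding op_sqrt_def
  by (rule the_equality) (use assms positive_sqrt_unique in auto)

section \<open>Polar decompositions and Aluthge transforms\<close>

lemma adjoint_op_eqI:
  assumes "\<And>g. g \<in> hcarrier K \<Longrightarrow> T' g \<in> hcarrier H" and "T' \<in> extensional (hcarrier K)"
    and "\<And>f g. f \<in> hcarrier H \<Longrightarrow> g \<in> hcarrier K \<Longrightarrow> hinner K (T f) g = hinner H f (T' g)"
  shows "adjoint_op H K T = T'"
proof (rule extensionalityI[of _ "hcarrier K"])
  fix g assume g: "g \<in> hcarrier K"
  have "(THE h. h \<in> hcarrier H \<and> (\<forall>f\<in>hcarrier H. hinner K (T f) g = hinner H f h)) = T' g"
  proof (rule the_equality)
    show "T' g \<in> hcarrier H \<and> (\<forall>f\<in>hcarrier H. hinner K (T f) g = hinner H f (T' g))"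
      using assms g by simp
  next
    fix h assume h: "h \<in> hcarrier H \<and> (\<forall>f\<in>hcarrier H. hinner K (T f) g = hinner H f h)"
    show "h = T' g"
    proof (rule inner_eqI)
      fix f assume "f \<in> hcarrier H"
      then show "hinner H f h = hinner H f (T' g)" using h assms(3)[of f g] g by simp
    qed (use h assms g in auto)
  qed
  then show "adjoint_op H K T g = T' g" using g by (simp add: adjoint_op_def)
qed (simp_all add: adjoint_op_def assms)

lemma op_abs_eqI:
  assumes "positive_op H R" and "compose (hcarrier H) T' T = compose (hcarrier H) R R"
    and "T' \<in> hcarrier H \<rightarrow>\<^sub>E hcarrier H"
    and "\<And>f g. f \<in> hcarrier H \<Longrightarrow> g \<in> hcarrier H \<Longrightarrow> hinner H (T f) g = hinner H f (T' g)"
  shows "op_abs H T = R"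
proof -
  have "T' \<in> extensional (hcarrier H)" "\<And>g. g \<in> hcarrier H \<Longrightarrow> T' g \<in> hcarrier H"
    using assms(3) by (auto simp: PiE_def)
  then have "adjoint_op H H T = T'" using assms(4) by (intro adjoint_op_eqI)
  then show ?thesis using assms by (simp add: op_abs_def op_sqrt_eqI)
qed

lemma bounded_op_eq_on_dense:
  assumes S: "S \<in> bounded_ops H H" and T: "T \<in> bounded_ops H H"
    and D: "D \<subseteq> hcarrier H" "\<And>g. g \<in> D \<Longrightarrow> S g = T g"
    and dense: "\<And>f e. f \<in> hcarrier H \<Longrightarrow> 0 < e \<Longrightarrow> \<exists>g\<in>D. hnorm H (\<lambda>x. f x - g x) < e"
  shows "S = T"
proof (rule extensionalityI[of _ "hcarrier H"])
  fix f assume f: "f \<in> hcarrier H"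
  note Si = bounded_opsD(1)[OF S] and Sl = bounded_opsD(2)[OF S]
  note Ti = bounded_opsD(1)[OF T] and Tl = bounded_opsD(2)[OF T]
  obtain c d where c: "\<And>f. f \<in> hcarrier H \<Longrightarrow> hnorm H (S f) \<le> c * hnorm H f"
    and d: "\<And>f. f \<in> hcarrier H \<Longrightarrow> hnorm H (T f) \<le> d * hnorm H f"
    using bounded_opsD(4)[OF S] bounded_opsD(4)[OF T] by blast
  define m where "m = \<bar>c\<bar> + \<bar>d\<bar> + 1"
  have "hnorm H (\<lambda>x. S f x - T f x) \<le> 0 + e" if e: "0 < e" for e
  proof -
    obtain g where gD: "g \<in> D" and g: "hnorm H (\<lambda>x. f x - g x) < e / m"
      using dense[OF f, of "e / m"] e by (auto simp: m_def)
    let ?h = "\<lambda>x. f x - g x"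
    have gC: "g \<in> hcarrier H" using gD D by auto
    then have h: "?h \<in> hcarrier H" using f C_diff by simp
    have "S f x - T f x = S ?h x - T ?h x" for x
      using f gC D(2)[OF gD] by (simp add: linear_on_diff[OF Sl] linear_on_diff[OF Tl])
    then have "hnorm H (\<lambda>x. S f x - T f x) = hnorm H (\<lambda>x. S ?h x + - T ?h x)" by simp
    also have "\<dots> \<le> hnorm H (S ?h) + hnorm H (T ?h)"
      using norm_triangle[of "S ?h" "\<lambda>x. - T ?h x"] norm_scale[of "T ?h" "-1"] h
      by (simp add: Si Ti C_minus)
    also have "hnorm H (S ?h) + hnorm H (T ?h) \<le> c * hnorm H ?h + d * hnorm H ?h"
      using c d h by (simp add: add_mono)
    also have "\<dots> \<le> m * hnorm H ?h"
      unfolding m_def distrib_right[symmetric] using norm_nonneg[OF h] by (intro mult_right_mono) auto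
    also have "\<dots> \<le> m * (e / m)" using g by (intro mult_left_mono) (auto simp: m_def)
    also have "\<dots> = e" by (simp add: m_def)
    finally show ?thesis by simp
  qed
  then have "hnorm H (\<lambda>x. S f x - T f x) \<le> 0" by (rule field_le_epsilon)
  moreover have "(\<lambda>x. S f x - T f x) \<in> hcarrier H" using f by (simp add: C_diff Si Ti)
  ultimately have "(\<lambda>x. S f x - T f x) = (\<lambda>_. 0)" using norm_eq_0 norm_nonneg by (simp add: order_antisym)
  then show "S f = T f" by (auto simp: fun_eq_iff)
qed (use S T bounded_opsD(3) in auto)

text \<open>
  As \<open>R = |T|\<close> is injective, the kernels required of a polar part are all trivial. Competing polar
  parts agree on the range of \<open>R\<close>; density of that range makes them equal.
\<close>
lemma polar_part_eqI:
  assumes U: "U \<in> bounded_ops H H" and iso: "\<And>f. f \<in> hcarrier H \<Longrightarrow> hnorm H (U f) = hnorm H f"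
    and R: "op_abs H T = R" "R \<in> bounded_ops H H" and T: "compose (hcarrier H) U R = T"
    and inj: "\<And>f. f \<in> hcarrier H \<Longrightarrow> R f = (\<lambda>_. 0) \<Longrightarrow> f = (\<lambda>_. 0)"
    and dense: "\<And>f e. f \<in> hcarrier H \<Longrightarrow> 0 < e \<Longrightarrow> \<exists>g\<in>hcarrier H. hnorm H (\<lambda>x. f x - R g x) < e"
  shows "polar_part H T = U"
  unfolding polar_part_def R(1)
proof (rule the_equality)
  have zero: "S (\<lambda>_. 0) = (\<lambda>_. 0)" if "S \<in> bounded_ops H H" for S
    using linear_on_scale[OF bounded_opsD(2)[OF that] zero_in, of 0] by simp
  have U0: "f = (\<lambda>_. 0)" if "f \<in> hcarrier H" "U f = (\<lambda>_. 0)" for f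
    using iso[OF that(1)] that norm_eq_0 by simp
  have ker0: "op_ker H S = {\<lambda>_. 0}" if "\<And>f. f \<in> hcarrier H \<Longrightarrow> S f = (\<lambda>_. 0) \<longleftrightarrow> f = (\<lambda>_. 0)" for S
    using that zero_in by (fastforce simp: op_ker_def)
  have TU: "T f = U (R f)" if "f \<in> hcarrier H" for f using T that by (auto simp: compose_def)
  have kU: "op_ker H U = {\<lambda>_. 0}" by (rule ker0) (use U0 zero[OF U] in blast)
  have kR: "op_ker H R = {\<lambda>_. 0}" by (rule ker0) (use inj zero[OF R(2)] in blast)
  have kT: "op_ker H T = {\<lambda>_. 0}"
  proof (rule ker0)
    fix f assume f: "f \<in> hcarrier H"
    show "T f = (\<lambda>_. 0) \<longleftrightarrow> f = (\<lambda>_. 0)"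
      unfolding TU[OF f] using U0[OF bounded_opsD(1)[OF R(2) f]] inj[OF f] zero[OF U] zero[OF R(2)] by metis
  qed
  show "partial_isometry H U \<and> compose (hcarrier H) U R = T \<and> op_ker H U = op_ker H T \<and> op_ker H T = op_ker H R"
    unfolding kU kR kT partial_isometry_def using U iso T by (simp add: orth_compl_def)
next
  fix U' assume "partial_isometry H U' \<and> compose (hcarrier H) U' R = T \<and> op_ker H U' = op_ker H T \<and> op_ker H T = op_ker H R"
  then have U': "U' \<in> bounded_ops H H" and U'T: "compose (hcarrier H) U' R = T"
    by (auto simp: partial_isometry_def)
  show "U' = U"
  proof (rule bounded_op_eq_on_dense[OF U' U, of "R ` hcarrier H"])
    show "R ` hcarrier H \<subseteq> hcarrier H" using bounded_opsD(1)[OF R(2)] by auto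
    show "U' g = U g" if g: "g \<in> R ` hcarrier H" for g
    proof -
      obtain f where f: "f \<in> hcarrier H" "g = R f" using g by auto
      have "compose (hcarrier H) U' R f = compose (hcarrier H) U R f" by (simp only: U'T T)
      then show ?thesis using f by (simp add: compose_def)
    qed
    show "\<exists>g\<in>R ` hcarrier H. hnorm H (\<lambda>x. f x - g x) < e" if "f \<in> hcarrier H" "0 < e" for f e
      using dense[OF that] by auto
  qed
qed

text \<open>
  Recognizes the Aluthge transform from a factorization: the adjoint \<open>T'\<close> certifies that \<open>R = |T|\<close>, and
  \<open>Q\<close> is the square root of \<open>R\<close>.
\<close>
lemma aluthge_eqI:
  assumes "U \<in> bounded_ops H H" and "\<And>f. f \<in> hcarrier H \<Longrightarrow> hnorm H (U f) = hnorm H f"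
    and R: "positive_op H R" and T: "compose (hcarrier H) U R = T"
    and T': "T' \<in> hcarrier H \<rightarrow>\<^sub>E hcarrier H" "compose (hcarrier H) T' T = compose (hcarrier H) R R"
    "\<And>f g. f \<in> hcarrier H \<Longrightarrow> g \<in> hcarrier H \<Longrightarrow> hinner H (T f) g = hinner H f (T' g)"
    and "\<And>f. f \<in> hcarrier H \<Longrightarrow> R f = (\<lambda>_. 0) \<Longrightarrow> f = (\<lambda>_. 0)"
    and "\<And>f e. f \<in> hcarrier H \<Longrightarrow> 0 < e \<Longrightarrow> \<exists>g\<in>hcarrier H. hnorm H (\<lambda>x. f x - R g x) < e"
    and Q: "positive_op H Q" "compose (hcarrier H) Q Q = R"
  shows "aluthge H T = compose (hcarrier H) Q (compose (hcarrier H) U Q)"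
proof -
  have abs: "op_abs H T = R" by (rule op_abs_eqI[OF R T'(2,1,3)])
  have "polar_part H T = U"
    by (rule polar_part_eqI[OF assms(1,2) abs _ T assms(8,9)]) (use R positive_op_def in auto)
  then show ?thesis by (simp add: aluthge_def Let_def abs op_sqrt_eqI[OF Q])
qed

section \<open>Closed subspaces and bounded operators\<close>

definition closed_subspace :: "('x \<Rightarrow> complex) set \<Rightarrow> bool" where
  "closed_subspace M \<longleftrightarrow> M \<subseteq> hcarrier H \<and>
     (\<forall>f\<in>M. \<forall>g\<in>M. \<forall>c d. (\<lambda>x. c * f x + d * g x) \<in> M) \<and>
     (\<forall>f\<in>hcarrier H. (\<forall>e>0. \<exists>g\<in>M. hnorm H (\<lambda>x. f x - g x) < e) \<longrightarrow> f \<in> M)"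

lemma approximating_sequence:
  assumes D: "D \<subseteq> hcarrier H" and f: "f \<in> hcarrier H"
    and e: "\<And>e. e > 0 \<Longrightarrow> \<exists>g\<in>D. hnorm H (\<lambda>x. f x - g x) < e"
  obtains X where "\<And>k::nat. X k \<in> D" "(\<lambda>k. hnorm H (\<lambda>x. X k x - f x)) \<longlonglongrightarrow> 0"
proof -
  have "\<forall>k. \<exists>g\<in>D. hnorm H (\<lambda>x. f x - g x) < inverse (real (Suc k))"
    using e by simp
  then obtain X where X: "\<And>k. X k \<in> D" "\<And>k. hnorm H (\<lambda>x. f x - X k x) < inverse (real (Suc k))"
    by metis
  have XH: "X k \<in> hcarrier H" for k using X(1) D by auto
  have "(\<lambda>k. hnorm H (\<lambda>x. X k x - f x)) \<longlonglongrightarrow> 0"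
  proof (rule tendsto_sandwich[OF _ _ tendsto_const LIMSEQ_inverse_real_of_nat])
    show "\<forall>\<^sub>F k in sequentially. 0 \<le> hnorm H (\<lambda>x. X k x - f x)"
      by (simp add: norm_nonneg C_diff XH f)
    show "\<forall>\<^sub>F k in sequentially. hnorm H (\<lambda>x. X k x - f x) \<le> inverse (real (Suc k))"
    proof (rule always_eventually, rule allI)
      fix k show "hnorm H (\<lambda>x. X k x - f x) \<le> inverse (real (Suc k))"
        unfolding norm_minus_commute[OF XH f] using X(2)[of k] by simp
    qed
  qed
  with X(1) show ?thesis by (rule that)
qed

text \<open>
  A subspace that is sequentially closed is closed. Statements about all vectors are proved below by
  showing that the vectors satisfying them form such a subspace containing enough kernels.
\<close>
lemma closed_subspaceI:
  assumes "M \<subseteq> hcarrier H"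
    and "\<And>f g c d. f \<in> M \<Longrightarrow> g \<in> M \<Longrightarrow> (\<lambda>x. c * f x + d * g x) \<in> M"
    and lim: "\<And>f X. f \<in> hcarrier H \<Longrightarrow> (\<And>k::nat. X k \<in> M) \<Longrightarrow>
      (\<lambda>k. hnorm H (\<lambda>x. X k x - f x)) \<longlonglongrightarrow> 0 \<Longrightarrow> f \<in> M"
  shows "closed_subspace M"
  unfolding closed_subspace_def
proof (intro conjI ballI impI allI)
  fix f assume f: "f \<in> hcarrier H" and e: "\<forall>e>0. \<exists>g\<in>M. hnorm H (\<lambda>x. f x - g x) < e"
  obtain X where "\<And>k::nat. X k \<in> M" "(\<lambda>k. hnorm H (\<lambda>x. X k x - f x)) \<longlonglongrightarrow> 0"
    using approximating_sequence[OF assms(1) f] e by blast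
  then show "f \<in> M" by (rule lim[OF f])
qed (use assms in auto)

lemma closure_closed_subspace:
  assumes D: "D \<subseteq> hcarrier H" and lin: "\<And>f g c d. f \<in> D \<Longrightarrow> g \<in> D \<Longrightarrow> (\<lambda>x. c * f x + d * g x) \<in> D"
  shows "closed_subspace {f \<in> hcarrier H. \<forall>e>0. \<exists>g\<in>D. hnorm H (\<lambda>x. f x - g x) < e}"
  unfolding closed_subspace_def
proof (intro conjI ballI impI allI)
  let ?M = "{f \<in> hcarrier H. \<forall>e>0. \<exists>g\<in>D. hnorm H (\<lambda>x. f x - g x) < e}"
  show "?M \<subseteq> hcarrier H" by auto
  fix f g c d assume f: "f \<in> ?M" and g: "g \<in> ?M"
  have "\<exists>h\<in>D. hnorm H (\<lambda>x. (c * f x + d * g x) - h x) < e" if e: "e > 0" for e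
  proof -
    define m where "m = cmod c + cmod d + 1"
    have m: "m > 0" unfolding m_def by (simp add: add_nonneg_pos)
    have em: "e / m > 0" using e m by simp
    obtain u where u: "u \<in> D" "hnorm H (\<lambda>x. f x - u x) < e / m" using f em by blast
    obtain v where v: "v \<in> D" "hnorm H (\<lambda>x. g x - v x) < e / m" using g em by blast
    have uv: "u \<in> hcarrier H" "v \<in> hcarrier H" "f \<in> hcarrier H" "g \<in> hcarrier H" using u v D f g by auto
    have "(\<lambda>x. (c * f x + d * g x) - (c * u x + d * v x)) = (\<lambda>x. c * (f x - u x) + d * (g x - v x))"
      by (simp add: algebra_simps)
    then have "hnorm H (\<lambda>x. (c * f x + d * g x) - (c * u x + d * v x)) \<le> cmod c * hnorm H (\<lambda>x. f x - u x) + cmod d * hnorm H (\<lambda>x. g x - v x)"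
      using norm_triangle[of "\<lambda>x. c * (f x - u x)" "\<lambda>x. d * (g x - v x)"] uv
      by (simp add: norm_scale C_diff C_scale)
    also have "\<dots> \<le> cmod c * (e / m) + cmod d * (e / m)"
      using u v by (intro add_mono mult_left_mono) auto
    also have "\<dots> = (cmod c + cmod d) * (e / m)" by (simp add: algebra_simps)
    also have "\<dots> < m * (e / m)" using e m by (intro mult_strict_right_mono) (auto simp: m_def)
    also have "\<dots> = e" using m by simp
    finally show ?thesis using lin[OF u(1) v(1), of c d] by (rule bexI[where x = "\<lambda>x. c * u x + d * v x"])
  qed
  then show "(\<lambda>x. c * f x + d * g x) \<in> ?M" using f g by (simp add: C_lin)
next
  let ?M = "{f \<in> hcarrier H. \<forall>e>0. \<exists>g\<in>D. hnorm H (\<lambda>x. f x - g x) < e}"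
  fix f assume f: "f \<in> hcarrier H" and *: "\<forall>e>0. \<exists>g\<in>?M. hnorm H (\<lambda>x. f x - g x) < e"
  have "\<exists>h\<in>D. hnorm H (\<lambda>x. f x - h x) < e" if e: "e > 0" for e
  proof -
    obtain g where g: "g \<in> ?M" "hnorm H (\<lambda>x. f x - g x) < e / 2" using * e half_gt_zero by blast
    then obtain h where h: "h \<in> D" "hnorm H (\<lambda>x. g x - h x) < e / 2" using e half_gt_zero by blast
    have "hnorm H (\<lambda>x. f x - h x) \<le> hnorm H (\<lambda>x. f x - g x) + hnorm H (\<lambda>x. g x - h x)"
      by (rule norm_triangle_diff) (use f g h D in auto)
    then show ?thesis using g h by (intro bexI[of _ h]) auto
  qed
  then show "f \<in> ?M" using f by simp
qed

lemma inner_tendsto: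
  assumes "\<And>k. X k \<in> hcarrier H" "f \<in> hcarrier H" "h \<in> hcarrier H"
    and lim: "(\<lambda>k. hnorm H (\<lambda>x. X k x - f x)) \<longlonglongrightarrow> 0"
  shows "(\<lambda>k. hinner H (X k) h) \<longlonglongrightarrow> hinner H f h"
proof -
  have "(\<lambda>k. hinner H (X k) h - hinner H f h) \<longlonglongrightarrow> 0"
  proof (rule Lim_null_comparison)
    show "\<forall>\<^sub>F k in sequentially. cmod (hinner H (X k) h - hinner H f h) \<le> hnorm H (\<lambda>x. X k x - f x) * hnorm H h"
      using inner_le_norm[of "\<lambda>x. X k x - f x" h for k] assms by (simp add: form_simps)
    show "(\<lambda>k. hnorm H (\<lambda>x. X k x - f x) * hnorm H h) \<longlonglongrightarrow> 0"
      using tendsto_mult_right[OF lim, of "hnorm H h"] by (simp add: mult.commute)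
  qed
  then show ?thesis by (simp add: LIM_zero_iff)
qed

definition bounded_linear_on :: "(('x \<Rightarrow> complex) \<Rightarrow> 'x \<Rightarrow> complex) \<Rightarrow> bool" where
  "bounded_linear_on S \<longleftrightarrow> (\<forall>f\<in>hcarrier H. S f \<in> hcarrier H) \<and> linear_on (hcarrier H) S \<and>
     (\<exists>c\<ge>0. \<forall>f\<in>hcarrier H. hnorm H (S f) \<le> c * hnorm H f)"

lemma bounded_linear_onI:
  assumes "\<And>f. f \<in> hcarrier H \<Longrightarrow> S f \<in> hcarrier H" "linear_on (hcarrier H) S" "c \<ge> 0"
    "\<And>f. f \<in> hcarrier H \<Longrightarrow> hnorm H (S f) \<le> c * hnorm H f"
  shows "bounded_linear_on S"
  using assms unfolding bounded_linear_on_def by blast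

lemma bounded_linear_on_in: "bounded_linear_on S \<Longrightarrow> f \<in> hcarrier H \<Longrightarrow> S f \<in> hcarrier H"
  and bounded_linear_on_linear: "bounded_linear_on S \<Longrightarrow> linear_on (hcarrier H) S"
  by (auto simp: bounded_linear_on_def)

lemma bounded_linear_on_bound:
  "bounded_linear_on S \<Longrightarrow> \<exists>c\<ge>0. \<forall>f\<in>hcarrier H. hnorm H (S f) \<le> c * hnorm H f"
  by (simp add: bounded_linear_on_def)

lemma bounded_linear_on_compose:
  assumes S: "bounded_linear_on S" and T: "bounded_linear_on T"
  shows "bounded_linear_on (\<lambda>f. S (T f))"
proof -
  obtain c where c: "c \<ge> 0" "\<And>f. f \<in> hcarrier H \<Longrightarrow> hnorm H (S f) \<le> c * hnorm H f"
    using bounded_linear_on_bound[OF S] by auto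
  obtain d where d: "d \<ge> 0" "\<And>f. f \<in> hcarrier H \<Longrightarrow> hnorm H (T f) \<le> d * hnorm H f"
    using bounded_linear_on_bound[OF T] by auto
  note i = bounded_linear_on_in[OF S] bounded_linear_on_in[OF T]
  show ?thesis
  proof (rule bounded_linear_onI[where c = "c * d"])
    show "linear_on (hcarrier H) (\<lambda>f. S (T f))"
      using linear_onD[OF bounded_linear_on_linear[OF S]] linear_onD[OF bounded_linear_on_linear[OF T]] i
      by (simp add: linear_on_def)
    show "hnorm H (S (T f)) \<le> c * d * hnorm H f" if f: "f \<in> hcarrier H" for f
      using c(2)[OF i(2)[OF f]] mult_left_mono[OF d(2)[OF f] c(1)] by (simp add: mult.assoc)
  qed (use i c d in auto)
qed

lemma bounded_linear_on_scale:
  assumes S: "bounded_linear_on S"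
  shows "bounded_linear_on (\<lambda>f x. k * S f x)"
proof -
  obtain c where c: "c \<ge> 0" "\<And>f. f \<in> hcarrier H \<Longrightarrow> hnorm H (S f) \<le> c * hnorm H f"
    using bounded_linear_on_bound[OF S] by auto
  note i = bounded_linear_on_in[OF S]
  show ?thesis
  proof (rule bounded_linear_onI[where c = "cmod k * c"])
    show "linear_on (hcarrier H) (\<lambda>f x. k * S f x)"
      using linear_onD[OF bounded_linear_on_linear[OF S]] by (simp add: linear_on_def algebra_simps)
    show "hnorm H (\<lambda>x. k * S f x) \<le> cmod k * c * hnorm H f" if f: "f \<in> hcarrier H" for f
      using mult_left_mono[OF c(2)[OF f], of "cmod k"] i[OF f] by (simp add: norm_scale mult.assoc)
  qed (use i c in \<open>auto simp: C_scale\<close>)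
qed

lemma bounded_linear_on_tendsto:
  assumes S: "bounded_linear_on S" and X: "\<And>k. X k \<in> hcarrier H" and f: "f \<in> hcarrier H"
    and lim: "(\<lambda>k. hnorm H (\<lambda>x. X k x - f x)) \<longlonglongrightarrow> 0"
  shows "(\<lambda>k. hnorm H (\<lambda>x. S (X k) x - S f x)) \<longlonglongrightarrow> 0"
proof -
  obtain c where c: "c \<ge> 0" "\<And>f. f \<in> hcarrier H \<Longrightarrow> hnorm H (S f) \<le> c * hnorm H f"
    using bounded_linear_on_bound[OF S] by auto
  have eq: "(\<lambda>x. S (X k) x - S f x) = S (\<lambda>x. X k x - f x)" for k
    using linear_on_diff[OF bounded_linear_on_linear[OF S] X f] by simp
  have d: "(\<lambda>x. X k x - f x) \<in> hcarrier H" for k using C_diff X f by simp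
  show ?thesis
  proof (rule tendsto_sandwich[OF _ _ tendsto_const])
    show "(\<lambda>k. c * hnorm H (\<lambda>x. X k x - f x)) \<longlonglongrightarrow> 0" using tendsto_mult_left[OF lim, of c] by simp
    show "\<forall>\<^sub>F k in sequentially. 0 \<le> hnorm H (\<lambda>x. S (X k) x - S f x)"
      by (simp add: eq norm_nonneg bounded_linear_on_in[OF S] d)
    show "\<forall>\<^sub>F k in sequentially. hnorm H (\<lambda>x. S (X k) x - S f x) \<le> c * hnorm H (\<lambda>x. X k x - f x)"
      unfolding eq using c d by simp
  qed
qed

lemma limit_unique:
  assumes X: "\<And>k. X k \<in> hcarrier H" and f: "f \<in> hcarrier H" and g: "g \<in> hcarrier H"
    and fl: "(\<lambda>k. hnorm H (\<lambda>x. X k x - f x)) \<longlonglongrightarrow> 0" and gl: "(\<lambda>k. hnorm H (\<lambda>x. X k x - g x)) \<longlonglongrightarrow> 0"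
  shows "f = g"
proof (rule inner_eqI[OF f g])
  fix h assume h: "h \<in> hcarrier H"
  have "hinner H f h = hinner H g h"
    using inner_tendsto[OF X f h fl] inner_tendsto[OF X g h gl] LIMSEQ_unique by blast
  then show "hinner H h f = hinner H h g" using B_sym f g h by metis
qed

lemma equalizer_closed_subspace:
  assumes S: "bounded_linear_on S" and T: "bounded_linear_on T"
  shows "closed_subspace {f \<in> hcarrier H. S f = T f}"
proof (rule closed_subspaceI)
  fix f X assume f: "f \<in> hcarrier H" and X: "\<And>k::nat. X k \<in> {f \<in> hcarrier H. S f = T f}"
    and lim: "(\<lambda>k. hnorm H (\<lambda>x. X k x - f x)) \<longlonglongrightarrow> 0"
  have "S f = T f"
  proof (rule limit_unique[where X = "\<lambda>k. S (X k)"])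
    show "(\<lambda>k. hnorm H (\<lambda>x. S (X k) x - S f x)) \<longlonglongrightarrow> 0"
      by (rule bounded_linear_on_tendsto[OF S _ f lim]) (use X in auto)
    have "(\<lambda>k. hnorm H (\<lambda>x. T (X k) x - T f x)) \<longlonglongrightarrow> 0"
      by (rule bounded_linear_on_tendsto[OF T _ f lim]) (use X in auto)
    moreover have "T (X k) = S (X k)" for k using X by simp
    ultimately show "(\<lambda>k. hnorm H (\<lambda>x. S (X k) x - T f x)) \<longlonglongrightarrow> 0" by simp
  qed (use X f bounded_linear_on_in[OF S] bounded_linear_on_in[OF T] in auto)
  then show "f \<in> {f \<in> hcarrier H. S f = T f}" using f by simp
qed (use linear_onD[OF bounded_linear_on_linear[OF S]] linear_onD[OF bounded_linear_on_linear[OF T]] in \<open>auto simp: C_lin\<close>)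

lemma inner_closed_subspace:
  assumes S: "bounded_linear_on S" and g: "g \<in> hcarrier H" "g' \<in> hcarrier H"
  shows "closed_subspace {f \<in> hcarrier H. hinner H (S f) g = hinner H f g'}"
proof (rule closed_subspaceI)
  fix f X assume f: "f \<in> hcarrier H" and X: "\<And>k::nat. X k \<in> {f \<in> hcarrier H. hinner H (S f) g = hinner H f g'}"
    and lim: "(\<lambda>k. hnorm H (\<lambda>x. X k x - f x)) \<longlonglongrightarrow> 0"
  have Xi: "X k \<in> hcarrier H" for k using X by simp
  have "(\<lambda>k. hinner H (S (X k)) g) \<longlonglongrightarrow> hinner H (S f) g"
    by (rule inner_tendsto[OF _ _ g(1) bounded_linear_on_tendsto[OF S Xi f lim]])
      (use Xi f bounded_linear_on_in[OF S] in auto)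
  moreover have "(\<lambda>k. hinner H (X k) g') \<longlonglongrightarrow> hinner H f g'" by (rule inner_tendsto[OF Xi f g(2) lim])
  moreover have "hinner H (X k) g' = hinner H (S (X k)) g" for k using X by simp
  ultimately have "hinner H (S f) g = hinner H f g'" using LIMSEQ_unique by simp blast
  then show "f \<in> {f \<in> hcarrier H. hinner H (S f) g = hinner H f g'}" using f by simp
qed (use g linear_onD[OF bounded_linear_on_linear[OF S]] bounded_linear_on_in[OF S] in \<open>auto simp: C_lin B_lin\<close>)

end

section \<open>Weighted Hardy spaces\<close>

definition power_fun :: "(nat \<Rightarrow> complex) \<Rightarrow> complex \<Rightarrow> complex" where
  "power_fun a = on_disk (\<lambda>z. \<Sum>n. a n * z ^ n)"

lemma taylor_coeff_unique:
  assumes "\<And>z. cmod z < 1 \<Longrightarrow> (\<lambda>n. a n * z ^ n) sums f z"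
  shows "f holomorphic_on ball 0 1" and "taylor_coeff f n = a n"
proof -
  show "f holomorphic_on ball 0 1"
    by (rule power_series_holomorphic[of 0 1 a]) (use assms in auto)
  have "f has_fps_expansion Abs_fps a"
  proof (rule has_fps_expansionI)
    have "\<forall>\<^sub>F u in nhds (0::complex). u \<in> ball 0 1" by (intro eventually_nhds_in_open) auto
    then show "\<forall>\<^sub>F u in nhds 0. (\<lambda>n. fps_nth (Abs_fps a) n * u ^ n) sums f u"
      by eventually_elim (use assms in auto)
  qed
  from fps_nth_fps_expansion[OF this, of n] show "taylor_coeff f n = a n"
    by (simp add: taylor_coeff_def)
qed

text \<open>
  Summability of \<open>r\<^sup>n / \<beta>(n)\<^sup>2\<close> says that the reproducing kernels have finite norm; it makes every
  coefficient sequence of finite weighted norm the Taylor sequence of a function on the disk.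
\<close>
locale hardy_weight =
  fixes \<beta> :: "nat \<Rightarrow> real"
  assumes weight_pos: "\<beta> n > 0"
    and kernel_summable: "0 \<le> r \<Longrightarrow> r < 1 \<Longrightarrow> summable (\<lambda>n. r ^ n / (\<beta> n)\<^sup>2)"
begin

abbreviation "HB \<equiv> H2 \<beta>"

lemma carrier_iff: "f \<in> hcarrier HB \<longleftrightarrow> f holomorphic_on ball 0 1 \<and> (\<forall>z. z \<notin> ball 0 1 \<longrightarrow> f z = 0) \<and>
     summable (\<lambda>n. (cmod (taylor_coeff f n))\<^sup>2 * (\<beta> n)\<^sup>2)"
  by (simp add: H2_def)

lemma inner_eq: "hinner HB f g = (\<Sum>n. taylor_coeff f n * cnj (taylor_coeff g n) * of_real ((\<beta> n)\<^sup>2))"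
  by (simp add: H2_def)

lemma taylor_sums:
  assumes "f \<in> hcarrier HB" "cmod z < 1"
  shows "(\<lambda>n. taylor_coeff f n * z ^ n) sums f z"
  using holomorphic_power_series[of f 0 1 z] assms by (simp add: carrier_iff taylor_coeff_def)

lemma outside_disk: "f \<in> hcarrier HB \<Longrightarrow> \<not> cmod z < 1 \<Longrightarrow> f z = 0"
  by (auto simp: carrier_iff)

lemma taylor_eqI:
  assumes "f \<in> hcarrier HB" "g \<in> hcarrier HB" "\<And>n. taylor_coeff f n = taylor_coeff g n"
  shows "f = g"
proof
  fix z show "f z = g z"
  proof (cases "cmod z < 1")
    case True
    then show ?thesis using taylor_sums[OF assms(1) True] taylor_sums[OF assms(2) True] assms(3)
      by (simp add: sums_unique2)
  qed (simp add: outside_disk assms)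
qed

text \<open>
  By the inequality \<open>2 x y \<le> x\<^sup>2 + y\<^sup>2\<close> with \<open>x = |a\<^sub>n| \<beta>(n)\<close> and \<open>y = |z|\<^sup>n / \<beta>(n)\<close>.
\<close>
lemma coeff_series_summable:
  assumes "summable (\<lambda>n. (cmod (a n))\<^sup>2 * (\<beta> n)\<^sup>2)" "cmod z < 1"
  shows "summable (\<lambda>n. a n * z ^ n)"
proof (rule summable_comparison_test')
  show "summable (\<lambda>n. (cmod (a n))\<^sup>2 * (\<beta> n)\<^sup>2 + ((cmod z)\<^sup>2) ^ n / (\<beta> n)\<^sup>2)"
    by (intro summable_add assms kernel_summable) (use assms in \<open>auto simp: power_less_one_iff\<close>)
  fix n :: nat
  have "2 * ((cmod (a n) * \<beta> n) * (cmod z ^ n / \<beta> n)) \<le> (cmod (a n) * \<beta> n)\<^sup>2 + (cmod z ^ n / \<beta> n)\<^sup>2"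
    using sum_squares_bound[of "cmod (a n) * \<beta> n" "cmod z ^ n / \<beta> n"] by (simp only: mult.assoc)
  moreover have "(cmod (a n) * \<beta> n) * (cmod z ^ n / \<beta> n) = cmod (a n) * cmod z ^ n"
    using weight_pos[of n] by simp
  moreover have "0 \<le> cmod (a n) * cmod z ^ n" by simp
  ultimately have "cmod (a n) * cmod z ^ n \<le> (cmod (a n) * \<beta> n)\<^sup>2 + (cmod z ^ n / \<beta> n)\<^sup>2" by linarith
  then show "norm (a n * z ^ n) \<le> (cmod (a n))\<^sup>2 * (\<beta> n)\<^sup>2 + ((cmod z)\<^sup>2) ^ n / (\<beta> n)\<^sup>2"
    by (simp add: norm_mult norm_power power_mult_distrib power_divide power_commutes flip: power_mult)
      (simp add: mult.commute)
qed

lemma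
  assumes a: "summable (\<lambda>n. (cmod (a n))\<^sup>2 * (\<beta> n)\<^sup>2)"
  shows taylor_power_fun: "taylor_coeff (power_fun a) n = a n"
    and power_fun_in: "power_fun a \<in> hcarrier HB"
    and power_fun_sums: "cmod z < 1 \<Longrightarrow> (\<lambda>n. a n * z ^ n) sums power_fun a z"
proof -
  have s: "(\<lambda>n. a n * z ^ n) sums power_fun a z" if "cmod z < 1" for z
    using coeff_series_summable[OF a that] that by (simp add: power_fun_def on_disk_def summable_sums)
  then show "cmod z < 1 \<Longrightarrow> (\<lambda>n. a n * z ^ n) sums power_fun a z" .
  have t: "taylor_coeff (power_fun a) n = a n" for n by (rule taylor_coeff_unique(2)[OF s])
  then show "taylor_coeff (power_fun a) n = a n" .
  have "power_fun a z = 0" if "z \<notin> ball 0 1" for z using that by (simp add: power_fun_def on_disk_def)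
  then show "power_fun a \<in> hcarrier HB"
    unfolding carrier_iff t using taylor_coeff_unique(1)[OF s] a by simp
qed

lemma carrierI:
  assumes "\<And>z. cmod z < 1 \<Longrightarrow> (\<lambda>n. a n * z ^ n) sums f z" and "\<And>z. \<not> cmod z < 1 \<Longrightarrow> f z = 0"
    and "summable (\<lambda>n. (cmod (a n))\<^sup>2 * (\<beta> n)\<^sup>2)"
  shows "f \<in> hcarrier HB"
proof -
  have "taylor_coeff f n = a n" for n by (rule taylor_coeff_unique(2)[OF assms(1)])
  then show ?thesis
    unfolding carrier_iff using taylor_coeff_unique(1)[OF assms(1)] assms(2,3) by simp
qed

lemma product_summable:
  assumes "summable (\<lambda>n. (cmod (a n))\<^sup>2 * (\<beta> n)\<^sup>2)" "summable (\<lambda>n. (cmod (b n))\<^sup>2 * (\<beta> n)\<^sup>2)"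
  shows "summable (\<lambda>n. a n * cnj (b n) * of_real ((\<beta> n)\<^sup>2))"
proof (rule summable_comparison_test')
  show "summable (\<lambda>n. (cmod (a n))\<^sup>2 * (\<beta> n)\<^sup>2 + (cmod (b n))\<^sup>2 * (\<beta> n)\<^sup>2)"
    by (intro summable_add assms)
  fix n :: nat
  have "2 * (cmod (a n) * cmod (b n)) \<le> (cmod (a n))\<^sup>2 + (cmod (b n))\<^sup>2"
    using sum_squares_bound[of "cmod (a n)" "cmod (b n)"] by simp
  moreover have "0 \<le> cmod (a n) * cmod (b n)" by simp
  ultimately have "cmod (a n) * cmod (b n) \<le> (cmod (a n))\<^sup>2 + (cmod (b n))\<^sup>2" by linarith
  from mult_right_mono[OF this, of "(\<beta> n)\<^sup>2"]
  show "norm (a n * cnj (b n) * of_real ((\<beta> n)\<^sup>2)) \<le> (cmod (a n))\<^sup>2 * (\<beta> n)\<^sup>2 + (cmod (b n))\<^sup>2 * (\<beta> n)\<^sup>2"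
    by (simp add: norm_mult norm_power algebra_simps)
qed

lemma inner_sums:
  assumes "f \<in> hcarrier HB" "g \<in> hcarrier HB"
  shows "(\<lambda>n. taylor_coeff f n * cnj (taylor_coeff g n) * of_real ((\<beta> n)\<^sup>2)) sums hinner HB f g"
  using product_summable assms unfolding inner_eq by (simp add: carrier_iff summable_sums)

lemma comb_summable:
  assumes "summable (\<lambda>n. (cmod (a n))\<^sup>2 * (\<beta> n)\<^sup>2)" "summable (\<lambda>n. (cmod (b n))\<^sup>2 * (\<beta> n)\<^sup>2)"
  shows "summable (\<lambda>n. (cmod (c * a n + d * b n))\<^sup>2 * (\<beta> n)\<^sup>2)"
proof (rule summable_comparison_test')
  show "summable (\<lambda>n. 2 * (cmod c)\<^sup>2 * ((cmod (a n))\<^sup>2 * (\<beta> n)\<^sup>2) + 2 * (cmod d)\<^sup>2 * ((cmod (b n))\<^sup>2 * (\<beta> n)\<^sup>2))"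
    by (intro summable_add summable_mult assms)
  fix n :: nat
  let ?x = "cmod c * cmod (a n)" and ?y = "cmod d * cmod (b n)"
  have "cmod (c * a n + d * b n) \<le> ?x + ?y" by (metis norm_mult norm_triangle_ineq)
  then have "(cmod (c * a n + d * b n))\<^sup>2 \<le> (?x + ?y)\<^sup>2" by (intro power_mono) auto
  also have "\<dots> \<le> 2 * ?x\<^sup>2 + 2 * ?y\<^sup>2" using sum_squares_bound[of ?x ?y] by (simp add: power2_sum)
  finally have "(cmod (c * a n + d * b n))\<^sup>2 * (\<beta> n)\<^sup>2 \<le> (2 * ?x\<^sup>2 + 2 * ?y\<^sup>2) * (\<beta> n)\<^sup>2"
    by (intro mult_right_mono) auto
  also have "\<dots> = 2 * (cmod c)\<^sup>2 * ((cmod (a n))\<^sup>2 * (\<beta> n)\<^sup>2) + 2 * (cmod d)\<^sup>2 * ((cmod (b n))\<^sup>2 * (\<beta> n)\<^sup>2)"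
    unfolding power_mult_distrib by (simp only: distrib_right mult.assoc)
  finally show "norm ((cmod (c * a n + d * b n))\<^sup>2 * (\<beta> n)\<^sup>2) \<le>
      2 * (cmod c)\<^sup>2 * ((cmod (a n))\<^sup>2 * (\<beta> n)\<^sup>2) + 2 * (cmod d)\<^sup>2 * ((cmod (b n))\<^sup>2 * (\<beta> n)\<^sup>2)"
    by (simp only: real_norm_def abs_of_nonneg mult_nonneg_nonneg zero_le_power2)
qed

lemma
  assumes f: "f \<in> hcarrier HB" and g: "g \<in> hcarrier HB"
  shows comb_in: "(\<lambda>x. c * f x + d * g x) \<in> hcarrier HB"
    and taylor_comb: "taylor_coeff (\<lambda>x. c * f x + d * g x) n = c * taylor_coeff f n + d * taylor_coeff g n"
proof -
  have s: "(\<lambda>n. (c * taylor_coeff f n + d * taylor_coeff g n) * z ^ n) sums (c * f z + d * g z)" if "cmod z < 1" for z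
    using sums_add[OF sums_mult[OF taylor_sums[OF f that], of c] sums_mult[OF taylor_sums[OF g that], of d]]
    by (simp add: algebra_simps)
  then show "taylor_coeff (\<lambda>x. c * f x + d * g x) n = c * taylor_coeff f n + d * taylor_coeff g n"
    by (rule taylor_coeff_unique(2)[of "\<lambda>n. c * taylor_coeff f n + d * taylor_coeff g n"])
  show "(\<lambda>x. c * f x + d * g x) \<in> hcarrier HB"
  proof (rule carrierI[OF s])
    show "c * f z + d * g z = 0" if "\<not> cmod z < 1" for z
      using outside_disk[OF f that] outside_disk[OF g that] by simp
    show "summable (\<lambda>n. (cmod (c * taylor_coeff f n + d * taylor_coeff g n))\<^sup>2 * (\<beta> n)\<^sup>2)"
      by (rule comb_summable) (use f g carrier_iff in blast)+
  qed
qed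

lemma norm_sums:
  assumes "f \<in> hcarrier HB"
  shows "(\<lambda>n. (cmod (taylor_coeff f n))\<^sup>2 * (\<beta> n)\<^sup>2) sums Re (hinner HB f f)"
proof -
  have "Re (taylor_coeff f n * cnj (taylor_coeff f n) * of_real ((\<beta> n)\<^sup>2)) = (cmod (taylor_coeff f n))\<^sup>2 * (\<beta> n)\<^sup>2" for n
    by (simp add: complex_norm_square[symmetric] del: of_real_power complex_mult_cnj)
  then show ?thesis using sums_Re[OF inner_sums[OF assms assms]] by (simp only:)
qed

sublocale pre_hilbert HB
proof
  show "(\<lambda>x. c * f x + d * g x) \<in> hcarrier HB" if "f \<in> hcarrier HB" "g \<in> hcarrier HB" for f g c d
    using comb_in that by simp
  show "hinner HB (\<lambda>x. c * f x + d * g x) h = c * hinner HB f h + d * hinner HB g h"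
    if "f \<in> hcarrier HB" "g \<in> hcarrier HB" "h \<in> hcarrier HB" for f g h c d
  proof (rule sums_unique2[OF inner_sums])
    show "(\<lambda>n. taylor_coeff (\<lambda>x. c * f x + d * g x) n * cnj (taylor_coeff h n) * of_real ((\<beta> n)\<^sup>2))
       sums (c * hinner HB f h + d * hinner HB g h)"
      using sums_add[OF sums_mult[OF inner_sums[of f h], of c] sums_mult[OF inner_sums[of g h], of d]] that
      by (simp add: taylor_comb algebra_simps)
  qed (use that comb_in in auto)
  show "hinner HB g f = cnj (hinner HB f g)" if "f \<in> hcarrier HB" "g \<in> hcarrier HB" for f g
  proof (rule sums_unique2[OF inner_sums])
    show "(\<lambda>n. taylor_coeff g n * cnj (taylor_coeff f n) * of_real ((\<beta> n)\<^sup>2)) sums cnj (hinner HB f g)"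
      using inner_sums[of f g] that by (subst sums_cnj[symmetric]) (simp add: mult_ac)
  qed (use that in auto)
  show "0 \<le> Re (hinner HB f f)" if "f \<in> hcarrier HB" for f
    by (rule sums_le[OF _ sums_zero norm_sums[OF that]]) simp
  show "(\<lambda>_. 0) \<in> hcarrier HB"
    by (rule carrierI[of "\<lambda>_. 0"]) auto
  then have z: "taylor_coeff (\<lambda>_. 0) n = 0" for n
    by (intro taylor_coeff_unique(2)) auto
  show "f = (\<lambda>_. 0)" if f: "f \<in> hcarrier HB" "hinner HB f f = 0" for f
  proof (rule taylor_eqI[OF f(1)])
    show "(\<lambda>_. 0) \<in> hcarrier HB" by fact
    fix n
    have s: "(\<lambda>n. (cmod (taylor_coeff f n))\<^sup>2 * (\<beta> n)\<^sup>2) sums 0" using norm_sums[OF f(1)] f(2) by simp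
    have "(cmod (taylor_coeff f n))\<^sup>2 * (\<beta> n)\<^sup>2 = 0"
      using s suminf_eq_zero_iff[of "\<lambda>n. (cmod (taylor_coeff f n))\<^sup>2 * (\<beta> n)\<^sup>2"] sums_summable[OF s] sums_unique[OF s] by auto
    then show "taylor_coeff f n = taylor_coeff (\<lambda>_. 0) n" using weight_pos[of n] z by auto
  qed
qed

lemma norm_sq_sums:
  "f \<in> hcarrier HB \<Longrightarrow> (\<lambda>n. (cmod (taylor_coeff f n))\<^sup>2 * (\<beta> n)\<^sup>2) sums (hnorm HB f)\<^sup>2"
  using norm_sums norm_sq by simp

lemma taylor_diff: "f \<in> hcarrier HB \<Longrightarrow> g \<in> hcarrier HB \<Longrightarrow>
    taylor_coeff (\<lambda>x. f x - g x) n = taylor_coeff f n - taylor_coeff g n"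
  using taylor_comb[of f g 1 "-1"] by simp

lemma partial_sum_le_norm:
  "f \<in> hcarrier HB \<Longrightarrow> (\<Sum>n<N. (cmod (taylor_coeff f n))\<^sup>2 * (\<beta> n)\<^sup>2) \<le> (hnorm HB f)\<^sup>2"
  using norm_sq_sums[of f] sum_le_suminf[of "\<lambda>n. (cmod (taylor_coeff f n))\<^sup>2 * (\<beta> n)\<^sup>2" "{..<N}"]
  by (simp add: sums_iff)

lemma coeff_le_norm:
  assumes f: "f \<in> hcarrier HB"
  shows "cmod (taylor_coeff f n) \<le> hnorm HB f / \<beta> n"
proof -
  have "(cmod (taylor_coeff f n))\<^sup>2 * (\<beta> n)\<^sup>2 \<le> (\<Sum>n<Suc n. (cmod (taylor_coeff f n))\<^sup>2 * (\<beta> n)\<^sup>2)"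
    by (rule member_le_sum) auto
  then have "(cmod (taylor_coeff f n) * \<beta> n)\<^sup>2 \<le> (hnorm HB f)\<^sup>2"
    using partial_sum_le_norm[OF f, of "Suc n"] by (simp add: power_mult_distrib)
  then have "cmod (taylor_coeff f n) * \<beta> n \<le> hnorm HB f"
    by (rule power2_le_imp_le) (rule norm_nonneg[OF f])
  then show ?thesis using weight_pos[of n] by (simp add: pos_le_divide_eq)
qed

text \<open>
  Bounded partial sums suffice for membership, which is how limits of functions are shown to belong
  to the space.
\<close>
lemma power_fun_bounded:
  assumes "\<And>N. (\<Sum>n<N. (cmod (a n))\<^sup>2 * (\<beta> n)\<^sup>2) \<le> c\<^sup>2" "0 \<le> c"
  shows "power_fun a \<in> hcarrier HB" "\<And>n. taylor_coeff (power_fun a) n = a n" "hnorm HB (power_fun a) \<le> c"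
proof -
  have s: "summable (\<lambda>n. (cmod (a n))\<^sup>2 * (\<beta> n)\<^sup>2)"
    by (rule summableI_nonneg_bounded[OF _ assms(1)]) simp
  then show i: "power_fun a \<in> hcarrier HB" and t: "\<And>n. taylor_coeff (power_fun a) n = a n"
    using power_fun_in[OF s] taylor_power_fun[OF s] by auto
  have "(hnorm HB (power_fun a))\<^sup>2 = (\<Sum>n. (cmod (a n))\<^sup>2 * (\<beta> n)\<^sup>2)"
    using sums_unique[OF norm_sq_sums[OF i]] t by simp
  also have "\<dots> \<le> c\<^sup>2" by (rule suminf_le_const[OF s assms(1)])
  finally show "hnorm HB (power_fun a) \<le> c" by (rule power2_le_imp_le) (rule assms(2))
qed

text \<open>
  The Taylor coefficients of a Cauchy sequence converge, and the norm bounds pass to the limit in each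
  partial sum.
\<close>
lemma complete:
  assumes X: "\<And>k. X k \<in> hcarrier HB"
    and Cauchy: "\<And>e. e > 0 \<Longrightarrow> \<exists>N. \<forall>m\<ge>N. \<forall>n\<ge>N. hnorm HB (\<lambda>x. X m x - X n x) < e"
  shows "\<exists>f\<in>hcarrier HB. (\<lambda>k. hnorm HB (\<lambda>x. X k x - f x)) \<longlonglongrightarrow> 0"
proof -
  have "\<exists>l. (\<lambda>k. taylor_coeff (X k) n) \<longlonglongrightarrow> l" for n
  proof -
    have "Cauchy (\<lambda>k. taylor_coeff (X k) n)"
    proof (rule CauchyI)
      fix e :: real assume e: "0 < e"
      then obtain N where N: "\<forall>m\<ge>N. \<forall>k\<ge>N. hnorm HB (\<lambda>x. X m x - X k x) < e * \<beta> n"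
        using Cauchy[of "e * \<beta> n"] weight_pos by auto
      have "norm (taylor_coeff (X m) n - taylor_coeff (X k) n) < e" if "m \<ge> N" "k \<ge> N" for m k
      proof -
        have "norm (taylor_coeff (X m) n - taylor_coeff (X k) n) \<le> hnorm HB (\<lambda>x. X m x - X k x) / \<beta> n"
          using coeff_le_norm[OF C_diff[OF X X], of m k n] by (simp add: taylor_diff X)
        also have "\<dots> < e" using N that weight_pos[of n] by (simp add: pos_divide_less_eq)
        finally show ?thesis .
      qed
      then show "\<exists>M. \<forall>m\<ge>M. \<forall>k\<ge>M. norm (taylor_coeff (X m) n - taylor_coeff (X k) n) < e" by blast
    qed
    then show ?thesis by (simp add: Cauchy_convergent convergent_def[symmetric])
  qed
  then obtain a where a: "\<And>n. (\<lambda>k. taylor_coeff (X k) n) \<longlonglongrightarrow> a n" by metis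
  have bound: "(\<Sum>n<M. (cmod (taylor_coeff (X m) n - a n))\<^sup>2 * (\<beta> n)\<^sup>2) \<le> e\<^sup>2"
    if N: "\<And>k. k \<ge> N \<Longrightarrow> hnorm HB (\<lambda>x. X m x - X k x) < e" for M m N e
  proof (rule LIMSEQ_le_const2)
    show "(\<lambda>k. \<Sum>n<M. (cmod (taylor_coeff (X m) n - taylor_coeff (X k) n))\<^sup>2 * (\<beta> n)\<^sup>2) \<longlonglongrightarrow>
       (\<Sum>n<M. (cmod (taylor_coeff (X m) n - a n))\<^sup>2 * (\<beta> n)\<^sup>2)"
      by (intro tendsto_intros a)
    have "(\<Sum>n<M. (cmod (taylor_coeff (X m) n - taylor_coeff (X k) n))\<^sup>2 * (\<beta> n)\<^sup>2) \<le> e\<^sup>2" if "k \<ge> N" for k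
    proof -
      have "(\<Sum>n<M. (cmod (taylor_coeff (X m) n - taylor_coeff (X k) n))\<^sup>2 * (\<beta> n)\<^sup>2) \<le> (hnorm HB (\<lambda>x. X m x - X k x))\<^sup>2"
        using partial_sum_le_norm[OF C_diff[OF X X], of m k M] by (simp add: taylor_diff X)
      also have "\<dots> \<le> e\<^sup>2" using N[OF that] norm_nonneg[OF C_diff[OF X X]] by (intro power_mono) auto
      finally show ?thesis .
    qed
    then show "\<exists>N. \<forall>k\<ge>N. (\<Sum>n<M. (cmod (taylor_coeff (X m) n - taylor_coeff (X k) n))\<^sup>2 * (\<beta> n)\<^sup>2) \<le> e\<^sup>2" by blast
  qed
  have main: "(\<lambda>x. X m x - power_fun a x) \<in> hcarrier HB \<and> hnorm HB (\<lambda>x. X m x - power_fun a x) \<le> e \<and> power_fun a \<in> hcarrier HB"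
    if N: "\<And>k. k \<ge> N \<Longrightarrow> hnorm HB (\<lambda>x. X m x - X k x) < e" "e > 0" for m N e
  proof -
    let ?d = "power_fun (\<lambda>n. taylor_coeff (X m) n - a n)"
    have d: "?d \<in> hcarrier HB" "taylor_coeff ?d n = taylor_coeff (X m) n - a n" "hnorm HB ?d \<le> e" for n
      using power_fun_bounded[of "\<lambda>n. taylor_coeff (X m) n - a n" e, OF bound[OF N(1)]] N(2) by auto
    let ?g = "\<lambda>x. X m x - ?d x"
    have g: "?g \<in> hcarrier HB" using X d by (simp add: C_diff)
    have "taylor_coeff ?g = a" using X d by (auto simp: taylor_diff fun_eq_iff)
    then have "summable (\<lambda>n. (cmod (a n))\<^sup>2 * (\<beta> n)\<^sup>2)" using g by (simp add: carrier_iff)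
    then have pa: "power_fun a \<in> hcarrier HB" "\<And>n. taylor_coeff (power_fun a) n = a n"
      using power_fun_in taylor_power_fun by auto
    moreover have "?g = power_fun a"
      by (rule taylor_eqI[OF g pa(1)]) (simp add: pa \<open>taylor_coeff ?g = a\<close>)
    moreover from this have "?d = (\<lambda>x. X m x - power_fun a x)" by (simp add: fun_eq_iff algebra_simps)
    ultimately show ?thesis using d by simp
  qed
  obtain N0 where "\<forall>m\<ge>N0. \<forall>n\<ge>N0. hnorm HB (\<lambda>x. X m x - X n x) < 1" using Cauchy[of 1] by auto
  then have fin: "power_fun a \<in> hcarrier HB" using main[of N0 N0 1] by auto
  have "(\<lambda>k. hnorm HB (\<lambda>x. X k x - power_fun a x)) \<longlonglongrightarrow> 0"
  proof (rule LIMSEQ_I)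
    fix e :: real assume e: "0 < e"
    obtain N where N: "\<forall>m\<ge>N. \<forall>n\<ge>N. hnorm HB (\<lambda>x. X m x - X n x) < e / 2" using Cauchy[of "e/2"] e by auto
    have "norm (hnorm HB (\<lambda>x. X k x - power_fun a x) - 0) < e" if "k \<ge> N" for k
      using main[of N k "e/2"] N that e norm_nonneg[OF C_diff[OF X fin]] by auto
    then show "\<exists>N. \<forall>k\<ge>N. norm (hnorm HB (\<lambda>x. X k x - power_fun a x) - 0) < e" by blast
  qed
  with fin show ?thesis by blast
qed

definition kern :: "complex \<Rightarrow> complex \<Rightarrow> complex" where
  "kern \<omega> = power_fun (\<lambda>n. cnj \<omega> ^ n / of_real ((\<beta> n)\<^sup>2))"

lemma kern_summable:
  assumes "cmod \<omega> < 1" shows "summable (\<lambda>n. (cmod (cnj \<omega> ^ n / of_real ((\<beta> n)\<^sup>2)))\<^sup>2 * (\<beta> n)\<^sup>2)"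
proof -
  have "(cmod (cnj \<omega> ^ n / of_real ((\<beta> n)\<^sup>2)))\<^sup>2 * (\<beta> n)\<^sup>2 = ((cmod \<omega>)\<^sup>2) ^ n / (\<beta> n)\<^sup>2" for n
  proof -
    have "cmod (cnj \<omega> ^ n / of_real ((\<beta> n)\<^sup>2)) = cmod \<omega> ^ n / (\<beta> n)\<^sup>2"
      by (simp add: norm_divide norm_power)
    then show ?thesis using weight_pos[of n]
      by (simp add: power_divide power_mult[symmetric] mult.commute) (simp add: power2_eq_square power4_eq_xxxx field_simps)
  qed
  then show ?thesis using kernel_summable[of "(cmod \<omega>)\<^sup>2"] assms by (simp add: power_less_one_iff)
qed

lemma kern_in: "cmod \<omega> < 1 \<Longrightarrow> kern \<omega> \<in> hcarrier HB"
  unfolding kern_def by (rule power_fun_in[OF kern_summable])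

lemma taylor_kern: "cmod \<omega> < 1 \<Longrightarrow> taylor_coeff (kern \<omega>) n = cnj \<omega> ^ n / of_real ((\<beta> n)\<^sup>2)"
  unfolding kern_def by (rule taylor_power_fun[OF kern_summable])

lemma H2_kernel_eq: "H2_kernel \<beta> \<omega> = kern \<omega>"
  by (simp add: H2_kernel_def kern_def power_fun_def power_mult_distrib)

lemma reproducing:
  assumes f: "f \<in> hcarrier HB" and w: "cmod \<omega> < 1"
  shows "hinner HB f (kern \<omega>) = f \<omega>"
proof (rule sums_unique2[OF inner_sums[OF f kern_in[OF w]]])
  have "taylor_coeff f n * cnj (taylor_coeff (kern \<omega>) n) * of_real ((\<beta> n)\<^sup>2) = taylor_coeff f n * \<omega> ^ n" for n
    using weight_pos[of n] w by (simp add: taylor_kern)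
  then show "(\<lambda>n. taylor_coeff f n * cnj (taylor_coeff (kern \<omega>) n) * of_real ((\<beta> n)\<^sup>2)) sums f \<omega>"
    using taylor_sums[OF f w] by (simp only:)
qed

lemma eval_tendsto:
  assumes "\<And>k. X k \<in> hcarrier HB" "f \<in> hcarrier HB" "(\<lambda>k. hnorm HB (\<lambda>x. X k x - f x)) \<longlonglongrightarrow> 0"
    and "cmod z < 1"
  shows "(\<lambda>k. X k z) \<longlonglongrightarrow> f z"
  using inner_tendsto[OF assms(1,2) kern_in[OF assms(4)] assms(3)] assms by (simp add: reproducing)

definition monom_fun :: "nat \<Rightarrow> complex \<Rightarrow> complex" where "monom_fun n = on_disk (\<lambda>z. z ^ n)"

lemma monom_sums: "cmod z < 1 \<Longrightarrow> (\<lambda>k. (if k = n then 1 else 0) * z ^ k) sums monom_fun n z"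
proof -
  assume "cmod z < 1"
  moreover have "(\<lambda>k. (if k = n then 1 else 0) * z ^ k) = (\<lambda>k. if k = n then z ^ k else 0)" by auto
  ultimately show ?thesis
    using sums_single[of n "\<lambda>k. z ^ k"] by (simp add: monom_fun_def on_disk_def)
qed

lemma taylor_monom: "taylor_coeff (monom_fun n) k = (if k = n then 1 else 0)"
  by (rule taylor_coeff_unique(2)[OF monom_sums])

lemma monom_in: "monom_fun n \<in> hcarrier HB"
proof (rule carrierI[OF monom_sums])
  show "monom_fun n z = 0" if "\<not> cmod z < 1" for z using that by (simp add: monom_fun_def on_disk_def)
  show "summable (\<lambda>k. (cmod (if k = n then 1 else 0))\<^sup>2 * (\<beta> k)\<^sup>2)"
    by (rule summable_finite[of "{n}"]) auto
qed

lemma closed_subspace_comb: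
  "closed_subspace M \<Longrightarrow> f \<in> M \<Longrightarrow> g \<in> M \<Longrightarrow> (\<lambda>x. c * f x + d * g x) \<in> M"
  by (simp add: closed_subspace_def)

lemma closed_subspace_limit:
  "closed_subspace M \<Longrightarrow> f \<in> hcarrier HB \<Longrightarrow> (\<And>e. e > 0 \<Longrightarrow> \<exists>g\<in>M. hnorm HB (\<lambda>x. f x - g x) < e) \<Longrightarrow> f \<in> M"
  by (simp add: closed_subspace_def)

lemma partial_sums_in:
  assumes M: "closed_subspace M" and m: "\<And>n. n < N \<Longrightarrow> monom_fun n \<in> M" and z: "(\<lambda>_. 0) \<in> M"
  shows "(\<lambda>x. \<Sum>n<N. a n * monom_fun n x) \<in> M"
    and "taylor_coeff (\<lambda>x. \<Sum>n<N. a n * monom_fun n x) k = (if k < N then a k else 0)"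
proof -
  have MH: "M \<subseteq> hcarrier HB" using M by (simp add: closed_subspace_def)
  have "(\<lambda>x. \<Sum>n<N. a n * monom_fun n x) \<in> M \<and>
      (\<forall>k. taylor_coeff (\<lambda>x. \<Sum>n<N. a n * monom_fun n x) k = (if k < N then a k else 0))"
    using m
  proof (induction N)
    case 0
    have "taylor_coeff (\<lambda>_. 0) k = 0" for k by (intro taylor_coeff_unique(2)) auto
    then show ?case using z by simp
  next
    case (Suc N)
    then have IH: "(\<lambda>x. \<Sum>n<N. a n * monom_fun n x) \<in> M"
      "\<And>k. taylor_coeff (\<lambda>x. \<Sum>n<N. a n * monom_fun n x) k = (if k < N then a k else 0)" by auto
    have "(\<lambda>x. \<Sum>n<Suc N. a n * monom_fun n x) = (\<lambda>x. 1 * (\<Sum>n<N. a n * monom_fun n x) + a N * monom_fun N x)" by simp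
    moreover have "(\<lambda>x. 1 * (\<Sum>n<N. a n * monom_fun n x) + a N * monom_fun N x) \<in> M"
      by (rule closed_subspace_comb[OF M IH(1) Suc.prems]) simp
    moreover have "taylor_coeff (\<lambda>x. 1 * (\<Sum>n<N. a n * monom_fun n x) + a N * monom_fun N x) k = (if k < Suc N then a k else 0)" for k
      using IH(1) MH by (subst taylor_comb) (auto simp: monom_in IH(2) taylor_monom less_Suc_eq)
    ultimately show ?case by simp
  qed
  then show "(\<lambda>x. \<Sum>n<N. a n * monom_fun n x) \<in> M"
    and "taylor_coeff (\<lambda>x. \<Sum>n<N. a n * monom_fun n x) k = (if k < N then a k else 0)" by auto
qed

lemma zero_in_closed_subspace: "closed_subspace M \<Longrightarrow> f \<in> M \<Longrightarrow> (\<lambda>_. 0) \<in> M"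
  using closed_subspace_comb[of M f f 0 0] by simp

text \<open>
  Taylor polynomials converge to the function in norm.
\<close>
lemma monomials_dense:
  assumes M: "closed_subspace M" and m: "\<And>n. monom_fun n \<in> M"
  shows "M = hcarrier HB"
proof
  show MH: "M \<subseteq> hcarrier HB" using M by (simp add: closed_subspace_def)
  show "hcarrier HB \<subseteq> M"
  proof
    fix f assume f: "f \<in> hcarrier HB"
    show "f \<in> M"
    proof (rule closed_subspace_limit[OF M f])
      fix e :: real assume e: "e > 0"
      let ?t = "\<lambda>n. (cmod (taylor_coeff f n))\<^sup>2 * (\<beta> n)\<^sup>2"
      have s: "summable ?t" using f by (simp add: carrier_iff)
      obtain N where N: "norm (\<Sum>n. ?t (n + N)) < e\<^sup>2"
        using suminf_exist_split[OF zero_less_power[OF e] s] by blast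
      define p where "p x = (\<Sum>n<N. taylor_coeff f n * monom_fun n x)" for x
      have p: "p \<in> M" and pt: "taylor_coeff p k = (if k < N then taylor_coeff f k else 0)" for k
        unfolding p_def using partial_sums_in[OF M m zero_in_closed_subspace[OF M m]] by auto
      have ph: "p \<in> hcarrier HB" using p MH by auto
      have d: "(\<lambda>x. f x - p x) \<in> hcarrier HB" using f ph by (simp add: C_diff)
      have t: "(cmod (taylor_coeff (\<lambda>x. f x - p x) k))\<^sup>2 * (\<beta> k)\<^sup>2 = (if k < N then 0 else ?t k)" for k
        using f ph pt by (simp add: taylor_diff)
      have "(hnorm HB (\<lambda>x. f x - p x))\<^sup>2 = (\<Sum>n. if n < N then 0 else ?t n)"
        using sums_unique[OF norm_sq_sums[OF d]] unfolding t by simp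
      also have "\<dots> = (\<Sum>n. ?t (n + N))"
      proof -
        have s': "summable (\<lambda>n. if n < N then 0 else ?t n)"
          using norm_sq_sums[OF d] unfolding t by (rule sums_summable)
        show ?thesis using suminf_split_initial_segment[OF s', of N] by simp
      qed
      also have "\<dots> < e\<^sup>2" using N by (simp add: abs_less_iff)
      finally have "hnorm HB (\<lambda>x. f x - p x) < e" using e by (simp add: power2_less_imp_less)
      then show "\<exists>g\<in>M. hnorm HB (\<lambda>x. f x - g x) < e" using p by blast
    qed
  qed
qed

text \<open>
  Kernels at small positive real points already span a dense subspace. By induction on \<open>n\<close>, the monomial
  \<open>z\<^sup>n\<close> is obtained by removing from \<open>K\<^sub>r\<close> its terms of degree below \<open>n\<close>, dividing by
  \<open>r\<^sup>n / \<beta>(n)\<^sup>2\<close>, and letting \<open>r\<close> tend to \<open>0\<close>.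
\<close>
lemma kernels_dense:
  assumes M: "closed_subspace M" and k: "\<And>r. 0 < r \<Longrightarrow> r < 1 \<Longrightarrow> kern (of_real r) \<in> M"
  shows "M = hcarrier HB"
proof (rule monomials_dense[OF M])
  have MH: "M \<subseteq> hcarrier HB" using M by (simp add: closed_subspace_def)
  have z: "(\<lambda>_. 0) \<in> M" by (rule zero_in_closed_subspace[OF M k[of "1/2"]]) auto
  fix n show "monom_fun n \<in> M"
  proof (induction n rule: less_induct)
    case (less n)
    define C where "C = (\<Sum>m. (1/2) ^ m / (\<beta> (m + Suc n))\<^sup>2)"
    have Cs: "summable (\<lambda>m. (1/2) ^ m / (\<beta> (m + Suc n))\<^sup>2)"
    proof -
      have "summable (\<lambda>m. 2 ^ Suc n * ((1/2) ^ (m + Suc n) / (\<beta> (m + Suc n))\<^sup>2))"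
        by (intro summable_mult summable_ignore_initial_segment[of "\<lambda>m. (1/2) ^ m / (\<beta> m)\<^sup>2"] kernel_summable) auto
      then show ?thesis by (simp add: power_add field_simps)
    qed
    have C0: "0 \<le> C" unfolding C_def by (intro suminf_nonneg Cs) simp
    define b where "b = (\<beta> n)\<^sup>2"
    have b0: "b > 0" using weight_pos[of n] by (simp add: b_def)
    show ?case
    proof (rule closed_subspace_limit[OF M monom_in])
      fix e :: real assume e: "e > 0"
      \<comment> \<open>For \<open>r \<le> 1/2\<close> the distance from \<open>z\<^sup>n\<close> will be at most \<open>r b C\<^bsup>1/2\<^esup>\<close>; adding \<open>1\<close> keeps the denominator positive.\<close>
      define r where "r = min (1/2) (e / (2 * (b * sqrt C + 1)))"
      have den: "0 < b * sqrt C + 1" using b0 C0 by (simp add: add_nonneg_pos)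
      have r: "0 < r" "r \<le> 1/2" using e den unfolding r_def by (simp_all only: min.cobounded1) simp
      define p where "p x = (\<Sum>m<n. of_real (r ^ m / (\<beta> m)\<^sup>2) * monom_fun m x)" for x
      have p: "p \<in> M" and pt: "taylor_coeff p k = (if k < n then of_real (r ^ k / (\<beta> k)\<^sup>2) else 0)" for k
        unfolding p_def using partial_sums_in[OF M less.IH z, of n "\<lambda>m. of_real (r ^ m / (\<beta> m)\<^sup>2)"] by auto
      define g where "g x = of_real (b / r ^ n) * kern (of_real r) x + - of_real (b / r ^ n) * p x" for x
      have kM: "kern (of_real r) \<in> M" using k r by simp
      have gM: "g \<in> M" unfolding g_def using closed_subspace_comb[OF M kM p] .
      then have gH: "g \<in> hcarrier HB" using MH by auto
      have gt: "taylor_coeff g j = (if j < n then 0 else of_real (b * r ^ (j - n) / (\<beta> j)\<^sup>2))" for j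
      proof -
        have "taylor_coeff g j = of_real (b / r ^ n) * taylor_coeff (kern (of_real r)) j + - of_real (b / r ^ n) * taylor_coeff p j"
          unfolding g_def by (rule taylor_comb) (use kM p MH in auto)
        also have "taylor_coeff (kern (of_real r)) j = of_real (r ^ j / (\<beta> j)\<^sup>2)" using r by (simp add: taylor_kern)
        finally have "taylor_coeff g j = (if j < n then 0 else of_real (b / r ^ n * (r ^ j / (\<beta> j)\<^sup>2)))" by (simp add: pt)
        also have "b / r ^ n * (r ^ j / (\<beta> j)\<^sup>2) = b * r ^ (j - n) / (\<beta> j)\<^sup>2" if "\<not> j < n"
          using that r by (simp add: power_diff)
        ultimately show ?thesis by simp
      qed
      have d: "(\<lambda>x. monom_fun n x - g x) \<in> hcarrier HB" using gH monom_in by (simp add: C_diff)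
      have dt: "(cmod (taylor_coeff (\<lambda>x. monom_fun n x - g x) j))\<^sup>2 * (\<beta> j)\<^sup>2 =
          (if j \<le> n then 0 else b\<^sup>2 * (r\<^sup>2) ^ (j - n) / (\<beta> j)\<^sup>2)" for j
      proof (cases "j < n \<or> j > n")
        case True
        then show ?thesis using weight_pos[of j] gH r
          by (auto simp: taylor_diff monom_in taylor_monom gt norm_divide norm_mult norm_power power_mult_distrib power_divide)
            (simp add: power2_eq_square power4_eq_xxxx power_mult_distrib)
      next
        case False
        then have "j = n" by simp
        then show ?thesis using weight_pos[of n] gH
          by (simp add: taylor_diff monom_in taylor_monom gt b_def)
      qed
      have "(\<lambda>j. if j \<le> n then 0 else b\<^sup>2 * (r\<^sup>2) ^ (j - n) / (\<beta> j)\<^sup>2) sums (hnorm HB (\<lambda>x. monom_fun n x - g x))\<^sup>2"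
        using norm_sq_sums[OF d] unfolding dt .
      then have "(\<lambda>j. if j + Suc n \<le> n then 0 else b\<^sup>2 * (r\<^sup>2) ^ (j + Suc n - n) / (\<beta> (j + Suc n))\<^sup>2)
          sums ((hnorm HB (\<lambda>x. monom_fun n x - g x))\<^sup>2 - (\<Sum>j<Suc n. if j \<le> n then 0 else b\<^sup>2 * (r\<^sup>2) ^ (j - n) / (\<beta> j)\<^sup>2))"
        by (rule sums_split_initial_segment)
      moreover have "(\<Sum>j<Suc n. if j \<le> n then 0 else b\<^sup>2 * (r\<^sup>2) ^ (j - n) / (\<beta> j)\<^sup>2) = 0"
        by (intro sum.neutral) auto
      ultimately have ns: "(\<lambda>j. b\<^sup>2 * r\<^sup>2 * ((r\<^sup>2) ^ j / (\<beta> (j + Suc n))\<^sup>2)) sums (hnorm HB (\<lambda>x. monom_fun n x - g x))\<^sup>2"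
        by (simp add: mult.assoc)
      have "(hnorm HB (\<lambda>x. monom_fun n x - g x))\<^sup>2 \<le> b\<^sup>2 * r\<^sup>2 * C"
      proof (rule sums_le[OF _ ns])
        show "(\<lambda>j. b\<^sup>2 * r\<^sup>2 * ((1/2) ^ j / (\<beta> (j + Suc n))\<^sup>2)) sums (b\<^sup>2 * r\<^sup>2 * C)"
          unfolding C_def by (intro sums_mult summable_sums Cs)
        have r2: "r\<^sup>2 \<le> 1/2" using power_mono[OF r(2), of 2] r(1) by (simp add: power2_eq_square)
        fix j
        show "b\<^sup>2 * r\<^sup>2 * ((r\<^sup>2) ^ j / (\<beta> (j + Suc n))\<^sup>2) \<le> b\<^sup>2 * r\<^sup>2 * ((1/2) ^ j / (\<beta> (j + Suc n))\<^sup>2)"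
          by (intro mult_left_mono divide_right_mono power_mono r2) auto
      qed
      also have "\<dots> = (r * (b * sqrt C))\<^sup>2" using C0 by (simp add: power_mult_distrib)
      finally have "hnorm HB (\<lambda>x. monom_fun n x - g x) \<le> r * (b * sqrt C)"
        by (rule power2_le_imp_le) (use r b0 C0 in auto)
      also have "\<dots> \<le> r * (b * sqrt C + 1)" using r by (intro mult_left_mono) auto
      also have "\<dots> \<le> e / (2 * (b * sqrt C + 1)) * (b * sqrt C + 1)"
        using den by (intro mult_right_mono) (auto simp: r_def)
      also have "\<dots> = e / 2" using den by (simp add: field_simps)
      also have "\<dots> < e" using e by simp
      finally show "\<exists>g\<in>M. hnorm HB (\<lambda>x. monom_fun n x - g x) < e" using gM by blast
    qed
  qed
qed

lemma mult_z_in: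
  assumes grow: "\<And>n. (\<beta> (Suc n))\<^sup>2 \<le> c\<^sup>2 * (\<beta> n)\<^sup>2" and c: "c \<ge> 0" and f: "f \<in> hcarrier HB"
  shows "(\<lambda>z. z * f z) \<in> hcarrier HB" and "hnorm HB (\<lambda>z. z * f z) \<le> c * hnorm HB f"
proof -
  let ?a = "\<lambda>n. case n of 0 \<Rightarrow> 0 | Suc j \<Rightarrow> taylor_coeff f j"
  let ?t = "\<lambda>n. (cmod (taylor_coeff f n))\<^sup>2 * (\<beta> n)\<^sup>2"
  have s: "(\<lambda>n. ?a n * z ^ n) sums (z * f z)" if "cmod z < 1" for z
  proof -
    have "(\<lambda>n. ?a (Suc n) * z ^ Suc n) sums (z * f z)"
      using sums_mult[OF taylor_sums[OF f that], of z] by (simp add: mult_ac)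
    then show ?thesis by (subst (asm) sums_Suc_iff) simp
  qed
  have le: "(cmod (?a (Suc n)))\<^sup>2 * (\<beta> (Suc n))\<^sup>2 \<le> c\<^sup>2 * ?t n" for n
    using mult_left_mono[OF grow[of n], of "(cmod (taylor_coeff f n))\<^sup>2"] by (simp add: mult_ac)
  have sm: "summable (\<lambda>n. c\<^sup>2 * ?t n)" using f by (intro summable_mult) (simp add: carrier_iff)
  have s1: "summable (\<lambda>n. (cmod (?a (Suc n)))\<^sup>2 * (\<beta> (Suc n))\<^sup>2)"
    by (rule summable_comparison_test'[OF sm]) (use le in simp)
  then have s0: "summable (\<lambda>n. (cmod (?a n))\<^sup>2 * (\<beta> n)\<^sup>2)"
    by (subst (asm) summable_Suc_iff[of "\<lambda>n. (cmod (?a n))\<^sup>2 * (\<beta> n)\<^sup>2"])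
  show i: "(\<lambda>z. z * f z) \<in> hcarrier HB"
    by (rule carrierI[OF s _ s0]) (use outside_disk[OF f] in simp_all)
  have t: "taylor_coeff (\<lambda>z. z * f z) n = ?a n" for n by (rule taylor_coeff_unique(2)[OF s])
  have "(hnorm HB (\<lambda>z. z * f z))\<^sup>2 = (\<Sum>n. (cmod (?a n))\<^sup>2 * (\<beta> n)\<^sup>2)"
    using sums_unique[OF norm_sq_sums[OF i]] unfolding t .
  also have "\<dots> = (\<Sum>n. (cmod (?a (Suc n)))\<^sup>2 * (\<beta> (Suc n))\<^sup>2)"
    using suminf_split_head[OF s0] by simp
  also have "\<dots> \<le> (\<Sum>n. c\<^sup>2 * ?t n)" by (rule suminf_le[OF le s1 sm])
  also have "\<dots> = (c * hnorm HB f)\<^sup>2"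
    using sums_unique[OF sums_mult[OF norm_sq_sums[OF f], of "c\<^sup>2"]] by (simp add: power_mult_distrib)
  finally show "hnorm HB (\<lambda>z. z * f z) \<le> c * hnorm HB f"
    by (rule power2_le_imp_le) (use c norm_nonneg[OF f] in simp)
qed

lemma mult_z_power_in:
  assumes dec: "\<And>n. \<beta> (Suc n) \<le> \<beta> n" and f: "f \<in> hcarrier HB"
  shows "(\<lambda>z. z ^ n * f z) \<in> hcarrier HB" and "hnorm HB (\<lambda>z. z ^ n * f z) \<le> hnorm HB f"
proof -
  have "(\<beta> (Suc n))\<^sup>2 \<le> 1\<^sup>2 * (\<beta> n)\<^sup>2" for n
    using power_mono[OF dec[of n], of 2] weight_pos[of "Suc n"] by simp
  note step = mult_z_in[OF this zero_le_one]
  have "(\<lambda>z. z ^ n * f z) \<in> hcarrier HB \<and> hnorm HB (\<lambda>z. z ^ n * f z) \<le> hnorm HB f"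
  proof (induction n)
    case (Suc n)
    then show ?case using step[of "\<lambda>z. z ^ n * f z"] by (auto simp: mult.assoc)
  qed (use f in auto)
  then show "(\<lambda>z. z ^ n * f z) \<in> hcarrier HB" and "hnorm HB (\<lambda>z. z ^ n * f z) \<le> hnorm HB f" by auto
qed

text \<open>
  For decreasing weights multiplication by \<open>z\<close> is a contraction, so the series of the operators
  \<open>a\<^sub>n z\<^sup>n\<close> converges absolutely. This serves to remove the weight of a weighted composition operator.
\<close>
lemma multiplier_in:
  assumes dec: "\<And>n. \<beta> (Suc n) \<le> \<beta> n" and f: "f \<in> hcarrier HB"
    and a: "summable (\<lambda>n. cmod (a n))" and g: "\<And>z. cmod z < 1 \<Longrightarrow> (\<lambda>n. a n * z ^ n) sums g z"
  shows "on_disk (\<lambda>z. g z * f z) \<in> hcarrier HB"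
proof -
  define X where "X N = (\<lambda>z. \<Sum>n<N. a n * (z ^ n * f z))" for N
  have XS: "X (Suc N) = (\<lambda>z. X N z + a N * (z ^ N * f z))" for N by (simp add: X_def)
  have Xi: "X N \<in> hcarrier HB" for N
    by (induction N) (simp_all add: XS C_add C_scale mult_z_power_in[OF dec f], simp add: X_def zero_in)
  have Xd: "hnorm HB (\<lambda>z. X (M + k) z - X M z) \<le> (\<Sum>n\<in>{M..<M + k}. cmod (a n)) * hnorm HB f" for M k
  proof (induction k)
    case (Suc k)
    have "(\<lambda>z. X (M + Suc k) z - X M z) = (\<lambda>z. (X (M + k) z - X M z) + a (M + k) * (z ^ (M + k) * f z))"
      by (simp add: XS algebra_simps)
    then have "hnorm HB (\<lambda>z. X (M + Suc k) z - X M z) \<le> hnorm HB (\<lambda>z. X (M + k) z - X M z) + hnorm HB (\<lambda>z. a (M + k) * (z ^ (M + k) * f z))"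
      using norm_triangle[OF C_diff[OF Xi Xi] C_scale[OF mult_z_power_in(1)[OF dec f]]] by simp
    also have "hnorm HB (\<lambda>z. a (M + k) * (z ^ (M + k) * f z)) \<le> cmod (a (M + k)) * hnorm HB f"
      using mult_z_power_in[OF dec f] by (simp add: norm_scale mult_left_mono)
    finally show ?case using Suc by (simp add: distrib_right)
  qed simp
  have "\<exists>F\<in>hcarrier HB. (\<lambda>k. hnorm HB (\<lambda>x. X k x - F x)) \<longlonglongrightarrow> 0"
  proof (rule complete[OF Xi])
    fix e :: real assume e: "e > 0"
    have n1: "hnorm HB f + 1 > 0" using norm_nonneg[OF f] by simp
    then obtain N where N: "\<And>m n. m \<ge> N \<Longrightarrow> norm (\<Sum>k\<in>{m..<n}. cmod (a k)) < e / (hnorm HB f + 1)"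
      using a[unfolded summable_Cauchy] e by (meson divide_pos_pos)
    have le: "hnorm HB (\<lambda>x. X n x - X m x) < e" if mn: "N \<le> m" "m \<le> n" for m n
    proof -
      have "hnorm HB (\<lambda>x. X n x - X m x) \<le> (\<Sum>k\<in>{m..<n}. cmod (a k)) * hnorm HB f"
        using Xd[of m "n - m"] mn by simp
      also have "\<dots> \<le> e / (hnorm HB f + 1) * hnorm HB f"
        using N[OF mn(1), of n] norm_nonneg[OF f] by (intro mult_right_mono) auto
      also have "\<dots> < e" using n1 e by (simp add: pos_divide_less_eq distrib_left mult.commute)
      finally show ?thesis .
    qed
    have "hnorm HB (\<lambda>x. X m x - X n x) < e" if "m \<ge> N" "n \<ge> N" for m n
    proof (cases "m \<le> n")
      case True
      then show ?thesis unfolding norm_minus_commute[OF Xi Xi, of m n] using le that by simp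
    next
      case False
      then show ?thesis using le[of n m] that by simp
    qed
    then show "\<exists>N. \<forall>m\<ge>N. \<forall>n\<ge>N. hnorm HB (\<lambda>x. X m x - X n x) < e" by blast
  qed
  then obtain F where F: "F \<in> hcarrier HB" "(\<lambda>k. hnorm HB (\<lambda>x. X k x - F x)) \<longlonglongrightarrow> 0" by auto
  have "F = on_disk (\<lambda>z. g z * f z)"
  proof
    fix z show "F z = on_disk (\<lambda>z. g z * f z) z"
    proof (cases "cmod z < 1")
      case True
      have "(\<lambda>n. a n * (z ^ n * f z)) sums (g z * f z)"
        using sums_mult2[OF g[OF True], of "f z"] by (simp add: mult.assoc)
      then have "(\<lambda>k. X k z) \<longlonglongrightarrow> g z * f z" by (simp add: sums_def X_def)
      then show ?thesis using eval_tendsto[OF Xi F True] LIMSEQ_unique True by (simp add: on_disk_def)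
    qed (simp add: on_disk_def outside_disk F)
  qed
  then show ?thesis using F by simp
qed

end

section \<open>The Bergman space and its half-plane kernels\<close>

lemma norm_mult_less_1: "cmod u < 1 \<Longrightarrow> cmod z < 1 \<Longrightarrow> cmod (u * z) < 1"
  using mult_strict_mono'[of "cmod u" 1 "cmod z" 1] by (simp add: norm_mult)

text \<open>
  The arguments of \<open>u\<close> and \<open>v\<close> lie strictly between \<open>- \<pi> / 2\<close> and \<open>\<pi> / 2\<close>, so their sum does not cross the
  branch cut.
\<close>
lemma powr_mult_right_half_plane:
  fixes u v a :: complex
  assumes "Re u > 0" "Re v > 0"
  shows "(u * v) powr a = u powr a * v powr a"
proof -
  have nz: "u \<noteq> 0" "v \<noteq> 0" using assms by auto
  have "\<bar>Im (Ln u)\<bar> < pi / 2" "\<bar>Im (Ln v)\<bar> < pi / 2"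
    using assms nz Re_Ln_pos_lt by blast+
  then have "Ln (u * v) = Ln u + Ln v" by (intro Ln_times_simple nz) (auto simp: abs_less_iff)
  then show ?thesis using nz by (simp add: powr_def exp_add distrib_left)
qed

lemma binomial_series_complex:
  assumes "cmod z < 1"
  shows "(\<lambda>n. of_real (pochhammer s n / fact n) * z ^ n) sums (1 - z) powr (- of_real s)"
proof -
  have "(\<lambda>n. (- of_real s gchoose n) * (- z) ^ n) sums (1 + - z) powr (- of_real s)"
    by (rule gen_binomial_complex) (use assms in auto)
  moreover have "(- of_real s gchoose n) * (- z) ^ n = of_real (pochhammer s n / fact n) * z ^ n" for n
  proof -
    have "(- of_real s gchoose n) * (- z) ^ n = ((-1) ^ n * (-1) ^ n) * (pochhammer (of_real s) n / fact n * z ^ n)"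
      unfolding gbinomial_pochhammer power_minus[of z] by (simp add: mult_ac)
    also have "(-1) ^ n * (-1) ^ n = (1 :: complex)" by (simp flip: power_mult_distrib)
    finally show ?thesis by (simp add: pochhammer_of_real)
  qed
  ultimately show ?thesis by simp
qed

locale bergman =
  fixes \<alpha> :: real
  assumes alpha: "\<alpha> > -1"
begin

text \<open>
  The exponent of the reproducing kernel \<open>(1 - \<omega>\<^sup>* z)\<^bsup>-s\<^esup>\<close>.
\<close>
definition s :: real where "s = \<alpha> + 2"

lemma s_gt_1: "s > 1" using alpha by (simp add: s_def)

lemma Gamma_pos: "Gamma (real j + \<alpha> + 2) > 0"
  using alpha by (intro Gamma_real_pos) auto

lemma Gamma_quot: "Gamma (real j + \<alpha> + 2) / Gamma (\<alpha> + 2) = pochhammer s j"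
proof -
  have "s \<notin> \<int>\<^sub>\<le>\<^sub>0" using s_gt_1 by (auto elim!: nonpos_Ints_cases)
  then have "pochhammer s j = Gamma (s + of_nat j) / Gamma s" by (rule pochhammer_Gamma)
  moreover have "s + of_nat j = real j + \<alpha> + 2" by (simp add: s_def)
  ultimately show ?thesis unfolding s_def by (simp only:)
qed

lemma poch_pos: "pochhammer s j > 0"
  using s_gt_1 by (intro pochhammer_pos) auto

text \<open>
  In this form \<open>1 / \<gamma>(j)\<^sup>2\<close> is visibly a coefficient of the binomial series of \<open>(1 - z)\<^bsup>-s\<^esup>\<close>.
\<close>
lemma gamma_sq: "(\<gamma>\<^sub>w \<alpha> j)\<^sup>2 = fact j / pochhammer s j"
proof -
  define G G0 where "G = Gamma (real j + \<alpha> + 2)" and "G0 = Gamma (\<alpha> + 2)"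
  have "G > 0" "G0 > 0" using Gamma_pos[of j] Gamma_pos[of 0] by (simp_all add: G_def G0_def)
  then show ?thesis
    unfolding \<gamma>\<^sub>w_def Gamma_quot[symmetric] G_def[symmetric] G0_def[symmetric] by simp
qed

lemma gamma_pos: "\<gamma>\<^sub>w \<alpha> j > 0"
  using Gamma_pos[of j] Gamma_pos[of 0] by (simp add: \<gamma>\<^sub>w_def)

lemma beta_0: "\<beta>\<^sub>w \<alpha> 0 = 1" by (simp add: \<beta>\<^sub>w_def)

lemma beta_Suc: "\<beta>\<^sub>w \<alpha> (Suc j) = 1 / \<gamma>\<^sub>w \<alpha> j"
proof -
  have "real (Suc j) + \<alpha> + 1 = real j + \<alpha> + 2" by simp
  then have "\<beta>\<^sub>w \<alpha> (Suc j) = sqrt (Gamma (real j + \<alpha> + 2) / (fact j * Gamma (\<alpha> + 2)))"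
    by (simp only: \<beta>\<^sub>w_def nat.distinct if_False diff_Suc_1)
  also have "\<dots> = 1 / sqrt (fact j * Gamma (\<alpha> + 2) / Gamma (real j + \<alpha> + 2))"
    by (simp add: real_sqrt_divide)
  finally show ?thesis by (simp add: \<gamma>\<^sub>w_def)
qed

lemma beta_pos: "\<beta>\<^sub>w \<alpha> n > 0"
  by (cases n) (simp_all add: beta_0 beta_Suc gamma_pos)

lemma gamma_le_1: "(\<gamma>\<^sub>w \<alpha> j)\<^sup>2 \<le> 1"
proof -
  have "(fact j :: real) \<le> pochhammer s j"
    unfolding pochhammer_fact pochhammer_prod by (intro prod_mono) (use s_gt_1 in auto)
  then show ?thesis using poch_pos[of j] by (simp add: gamma_sq)
qed

sublocale A: hardy_weight "\<gamma>\<^sub>w \<alpha>"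
proof
  show "\<gamma>\<^sub>w \<alpha> n > 0" for n by (rule gamma_pos)
  fix r :: real assume r: "0 \<le> r" "r < 1"
  have "summable (\<lambda>n. complex_of_real (pochhammer s n / fact n) * of_real r ^ n)"
    using binomial_series_complex[of "of_real r" s] r by (auto simp: sums_iff)
  also have "(\<lambda>n. complex_of_real (pochhammer s n / fact n) * of_real r ^ n) =
      (\<lambda>n. of_real (r ^ n / (\<gamma>\<^sub>w \<alpha> n)\<^sup>2))"
    by (simp add: gamma_sq mult.commute fun_eq_iff)
  finally show "summable (\<lambda>n. r ^ n / (\<gamma>\<^sub>w \<alpha> n)\<^sup>2)" by (simp only: summable_of_real_iff)
qed

sublocale B: hardy_weight "\<beta>\<^sub>w \<alpha>"
proof
  show "\<beta>\<^sub>w \<alpha> n > 0" for n by (rule beta_pos)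
  fix r :: real assume r: "0 \<le> r" "r < 1"
  have "summable (\<lambda>n. r ^ Suc n / (\<beta>\<^sub>w \<alpha> (Suc n))\<^sup>2)"
  proof (rule summable_comparison_test')
    show "summable (\<lambda>n. r ^ n)" using r by (simp add: summable_geometric)
    fix n :: nat
    have "r * (\<gamma>\<^sub>w \<alpha> n)\<^sup>2 \<le> 1 * 1" using gamma_le_1[of n] r by (intro mult_mono) auto
    then have "r ^ n * (r * (\<gamma>\<^sub>w \<alpha> n)\<^sup>2) \<le> r ^ n * 1" using r by (intro mult_left_mono) auto
    then show "norm (r ^ Suc n / (\<beta>\<^sub>w \<alpha> (Suc n))\<^sup>2) \<le> r ^ n"
      using r by (simp add: beta_Suc power_divide mult_ac)
  qed
  then show "summable (\<lambda>n. r ^ n / (\<beta>\<^sub>w \<alpha> n)\<^sup>2)" by (subst (asm) summable_Suc_iff)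
qed

abbreviation "HA \<equiv> H2 (\<gamma>\<^sub>w \<alpha>)"

lemma bergman_kernel:
  assumes "cmod \<omega> < 1" "cmod z < 1"
  shows "A.kern \<omega> z = (1 - cnj \<omega> * z) powr (- of_real s)"
proof (rule sums_unique2[OF A.taylor_sums[OF A.kern_in[OF assms(1)] assms(2)]])
  have "cmod (cnj \<omega> * z) < 1"
    by (rule norm_mult_less_1) (use assms in simp_all)
  from binomial_series_complex[OF this, of s]
  show "(\<lambda>n. taylor_coeff (A.kern \<omega>) n * z ^ n) sums (1 - cnj \<omega> * z) powr (- of_real s)"
    using assms by (simp add: A.taylor_kern gamma_sq power_mult_distrib mult_ac flip: of_real_power)
qed

text \<open>
  Up to a constant factor, the reproducing kernel at the point \<open>(x - 1) / (x + 1)\<close>, which corresponds to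
  the point \<open>x\<close> of the half-plane (\<open>hk_eq_kern\<close>). In this normalization the inner products depend
  on \<open>x + y\<close> only.
\<close>
definition hk :: "real \<Rightarrow> complex \<Rightarrow> complex" where
  "hk x = on_disk (\<lambda>z. (of_real x * (1 - z) + (1 + z)) powr (- of_real s))"

lemma disk_Re: "cmod z < 1 \<Longrightarrow> Re (1 - z) > 0 \<and> Re (1 + z) > 0"
  using abs_Re_le_cmod[of z] by auto

lemma hk_base_Re: "x > 0 \<Longrightarrow> cmod z < 1 \<Longrightarrow> Re (of_real x * (1 - z) + (1 + z)) > 0"
  using disk_Re[of z] by (simp add: add_pos_pos)

lemma hk_outside: "\<not> cmod z < 1 \<Longrightarrow> hk x z = 0"
  by (simp add: hk_def on_disk_def)

definition disk_pt :: "real \<Rightarrow> real" where "disk_pt x = (x - 1) / (x + 1)"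

lemma disk_pt: "x > 0 \<Longrightarrow> cmod (of_real (disk_pt x)) < 1"
  unfolding norm_of_real disk_pt_def by (simp add: abs_less_iff field_simps)

lemma disk_pt_mult: "x > 0 \<Longrightarrow> of_real (x + 1) * complex_of_real (disk_pt x) = of_real (x - 1)"
  unfolding of_real_mult[symmetric] by (simp add: disk_pt_def)

lemma hk_eq_kern:
  assumes x: "x > 0"
  shows "hk x = (\<lambda>z. of_real ((x + 1) powr (- s)) * A.kern (of_real (disk_pt x)) z)"
proof
  fix z
  show "hk x z = of_real ((x + 1) powr (- s)) * A.kern (of_real (disk_pt x)) z"
  proof (cases "cmod z < 1")
    case True
    let ?w = "1 - cnj (of_real (disk_pt x)) * z"
    have "of_real (x + 1) * ?w = of_real (x + 1) - of_real (x + 1) * of_real (disk_pt x) * z"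
      by (simp add: algebra_simps)
    also have "\<dots> = of_real x * (1 - z) + (1 + z)"
      unfolding disk_pt_mult[OF x] by (simp add: algebra_simps)
    finally have "of_real x * (1 - z) + (1 + z) = of_real (x + 1) * ?w" ..
    moreover have "Re ?w > 0"
    proof -
      have "cmod (cnj (of_real (disk_pt x)) * z) < 1"
        by (rule norm_mult_less_1[OF _ True]) (simp only: complex_mod_cnj disk_pt[OF x])
      then show ?thesis using disk_Re by blast
    qed
    moreover have "Re (of_real (x + 1)) > 0" using x by simp
    ultimately have "hk x z = of_real (x + 1) powr (- of_real s) * ?w powr (- of_real s)"
      using True by (simp only: hk_def on_disk_def powr_mult_right_half_plane mem_ball_0 if_True)
    also have "of_real (x + 1) powr (- of_real s) = complex_of_real ((x + 1) powr (- s))"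
      using powr_of_real[of "x + 1" "- s"] x by simp
    finally show ?thesis using bergman_kernel[OF disk_pt[OF x] True] by simp
  qed (simp add: hk_outside A.outside_disk[OF A.kern_in[OF disk_pt[OF x]]])
qed

lemma hk_in: "x > 0 \<Longrightarrow> hk x \<in> hcarrier HA"
  by (subst hk_eq_kern) (auto intro!: A.C_scale A.kern_in disk_pt)

lemma kern_eq_hk:
  assumes "0 < r" "r < 1"
  shows "A.kern (of_real r) = (\<lambda>z. of_real (((1 + r) / (1 - r) + 1) powr s) * hk ((1 + r) / (1 - r)) z)"
proof -
  let ?x = "(1 + r) / (1 - r)"
  have x: "?x > 0" using assms by simp
  have "disk_pt ?x = r" using assms by (simp add: disk_pt_def field_simps)
  moreover have "(?x + 1) powr s * (?x + 1) powr (- s) = 1"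
    using x by (simp flip: powr_add)
  ultimately show ?thesis unfolding hk_eq_kern[OF x]
    by (simp add: mult.assoc[symmetric] flip: of_real_mult)
qed

lemma inner_hk:
  assumes "f \<in> hcarrier HA" "x > 0"
  shows "hinner HA f (hk x) = of_real ((x + 1) powr (- s)) * f (of_real (disk_pt x))"
  unfolding hk_eq_kern[OF assms(2)]
  using assms A.kern_in[OF disk_pt, of x] disk_pt[of x]
  by (simp only: A.B_scale_right A.reproducing complex_cnj_complex_of_real)

lemma inner_hk_hk:
  assumes x: "x > 0" and y: "y > 0"
  shows "hinner HA (hk y) (hk x) = of_real ((2 * (x + y)) powr (- s))"
proof -
  have "of_real y * (1 - of_real (disk_pt x)) + (1 + of_real (disk_pt x)) = complex_of_real (2 * (x + y) / (x + 1))"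
  proof -
    have "y * (1 - disk_pt x) + (1 + disk_pt x) = 2 * (x + y) / (x + 1)"
    proof -
      have "1 - disk_pt x = 2 / (x + 1)" "1 + disk_pt x = 2 * x / (x + 1)"
        using x by (simp_all add: disk_pt_def field_simps)
      then have "y * (1 - disk_pt x) + (1 + disk_pt x) = y * (2 / (x + 1)) + 2 * x / (x + 1)" by (simp only:)
      also have "\<dots> = 2 * (x + y) / (x + 1)" by (simp add: add_divide_distrib[symmetric] algebra_simps)
      finally show ?thesis .
    qed
    from arg_cong[OF this, of complex_of_real] show ?thesis by simp
  qed
  then have "hk y (of_real (disk_pt x)) = complex_of_real (2 * (x + y) / (x + 1)) powr (- of_real s)"
    using disk_pt[OF x] by (simp add: hk_def on_disk_def del: of_real_divide)
  also have "\<dots> = of_real ((2 * (x + y) / (x + 1)) powr (- s))"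
    using powr_of_real[of "2 * (x + y) / (x + 1)" "- s"] x y by simp
  also have "(2 * (x + y) / (x + 1)) powr (- s) = (2 * (x + y)) powr (- s) / (x + 1) powr (- s)"
    using x y by (simp add: powr_divide)
  finally have e: "hk y (of_real (disk_pt x)) = of_real ((2 * (x + y)) powr (- s) / (x + 1) powr (- s))" .
  show ?thesis unfolding inner_hk[OF hk_in[OF y] x] e of_real_mult[symmetric] using x by simp
qed

text \<open>
  Linear combinations of kernels, as an inductive set so that bilinear identities extend from kernels
  by induction.
\<close>
inductive_set hspan :: "(complex \<Rightarrow> complex) set" where
  zero: "(\<lambda>_. 0) \<in> hspan"
| add: "g \<in> hspan \<Longrightarrow> x > 0 \<Longrightarrow> (\<lambda>z. c * hk x z + g z) \<in> hspan"

lemma hspan_in: "g \<in> hspan \<Longrightarrow> g \<in> hcarrier HA"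
  by (induction rule: hspan.induct) (auto intro!: A.zero_in A.C_add A.C_scale hk_in)

lemma hspan_scale: "g \<in> hspan \<Longrightarrow> (\<lambda>z. c * g z) \<in> hspan"
proof (induction rule: hspan.induct)
  case (add g x d)
  then show ?case using hspan.add[OF add(3,2), of "c * d"] by (simp add: algebra_simps)
qed (simp add: hspan.zero)

lemma hspan_add: "g \<in> hspan \<Longrightarrow> h \<in> hspan \<Longrightarrow> (\<lambda>z. g z + h z) \<in> hspan"
proof (induction rule: hspan.induct)
  case (add g x d)
  then show ?case using hspan.add[OF add(3)[OF add(4)] add(2), of d] by (simp add: algebra_simps)
qed simp

lemma hspan_comb: "g \<in> hspan \<Longrightarrow> h \<in> hspan \<Longrightarrow> (\<lambda>z. c * g z + d * h z) \<in> hspan"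
  by (intro hspan_add hspan_scale)

lemma hk_in_hspan: "x > 0 \<Longrightarrow> hk x \<in> hspan"
  using hspan.add[OF hspan.zero, of x 1] by simp

text \<open>
  The kernels at \<open>r \<in> (0, 1)\<close> are those at \<open>x > 1\<close> in the half-plane.
\<close>
lemma hk_dense:
  assumes M: "A.closed_subspace M" and k: "\<And>x. x > 1 \<Longrightarrow> hk x \<in> M"
  shows "M = hcarrier HA"
proof (rule A.kernels_dense[OF M])
  fix r :: real assume r: "0 < r" "r < 1"
  then have "(1 + r) / (1 - r) > 1" by simp
  then show "A.kern (of_real r) \<in> M"
    unfolding kern_eq_hk[OF r]
    using A.closed_subspace_comb[OF M k k, of _ _ _ 0] by simp
qed

lemma hspan_dense:
  assumes "f \<in> hcarrier HA" "e > 0"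
  shows "\<exists>g\<in>hspan. hnorm HA (\<lambda>x. f x - g x) < e"
proof -
  let ?M = "{f \<in> hcarrier HA. \<forall>e>0. \<exists>g\<in>hspan. hnorm HA (\<lambda>x. f x - g x) < e}"
  have "?M = hcarrier HA"
  proof (rule hk_dense)
    show "A.closed_subspace ?M" by (rule A.closure_closed_subspace) (auto intro: hspan_in hspan_comb)
    fix x :: real assume "x > 1"
    then have "hk x \<in> hspan" "hk x \<in> hcarrier HA" using hk_in_hspan hk_in by auto
    then show "hk x \<in> ?M" by (auto intro!: bexI[of _ "hk x"])
  qed
  then show ?thesis using assms by blast
qed

section \<open>Affine maps of the half-plane as operators\<close>

text \<open>
  For \<open>p > 0\<close> and \<open>q \<ge> 0\<close> the map \<open>w \<mapsto> p w + q\<close> of the half-plane becomes on the disk the self-map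
  \<open>affine_mob p q\<close>, with denominator \<open>affine_den p q\<close>. The operator \<open>F \<mapsto> p\<^bsup>s/2\<^esup> F(p w + q)\<close> becomes
  \<open>affine_op p q\<close>; thus \<open>affine_op a 0\<close> is a dilation and \<open>affine_op 1 t\<close> a translation.
\<close>
definition affine_den :: "real \<Rightarrow> real \<Rightarrow> complex \<Rightarrow> complex" where
  "affine_den p q z = of_real p * (1 + z) + of_real (q + 1) * (1 - z)"

definition affine_mob :: "real \<Rightarrow> real \<Rightarrow> complex \<Rightarrow> complex" where
  "affine_mob p q z = (of_real p * (1 + z) + of_real (q - 1) * (1 - z)) / affine_den p q z"

definition affine_op :: "real \<Rightarrow> real \<Rightarrow> (complex \<Rightarrow> complex) \<Rightarrow> complex \<Rightarrow> complex" where
  "affine_op p q f = on_disk (\<lambda>z. of_real (p powr (s / 2)) * (2 / affine_den p q z) powr of_real s * f (affine_mob p q z))"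

lemma affine_den_Re: "p > 0 \<Longrightarrow> q \<ge> 0 \<Longrightarrow> cmod z < 1 \<Longrightarrow> Re (affine_den p q z) > 0"
  using disk_Re[of z] by (simp add: affine_den_def add_pos_pos)

lemma affine_den_nz: "p > 0 \<Longrightarrow> q \<ge> 0 \<Longrightarrow> cmod z < 1 \<Longrightarrow> affine_den p q z \<noteq> 0"
  using affine_den_Re[of p q z] by auto

text \<open>
  With \<open>n\<close> and \<open>d\<close> the numerator and the denominator, \<open>d - n\<close> and \<open>d + n\<close> are \<open>2 (1 - z)\<close> and
  \<open>2 p (1 + z) + 2 q (1 - z)\<close>, and \<open>|d|\<^sup>2 - |n|\<^sup>2\<close> is the real part of \<open>(d - n) (d + n)\<^sup>*\<close>.
\<close>
lemma affine_mob_disk: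
  assumes p: "p > 0" and q: "q \<ge> 0" and z: "cmod z < 1"
  shows "cmod (affine_mob p q z) < 1"
proof -
  let ?n = "of_real p * (1 + z) + of_real (q - 1) * (1 - z)"
  have "(cmod (affine_den p q z))\<^sup>2 - (cmod ?n)\<^sup>2 = 4 * p * (1 - (cmod z)\<^sup>2) + 4 * q * (cmod (1 - z))\<^sup>2"
    unfolding affine_den_def cmod_power2 by (simp add: power2_eq_square algebra_simps)
  also have "\<dots> > 0"
    using p q z by (intro add_pos_nonneg) (auto simp: power_less_one_iff)
  finally have "cmod ?n < cmod (affine_den p q z)" by (simp add: power2_less_imp_less)
  then show ?thesis using affine_den_nz[OF assms] by (simp add: affine_mob_def norm_divide)
qed

lemma affine_op_comb: "affine_op p q (\<lambda>z. c * f z + d * g z) = (\<lambda>z. c * affine_op p q f z + d * affine_op p q g z)"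
  by (auto simp: affine_op_def on_disk_def algebra_simps)

lemma affine_op_linear: "linear_on C (affine_op p q)"
  by (simp add: linear_on_def affine_op_comb)

lemma affine_op_zero: "affine_op p q (\<lambda>_. 0) = (\<lambda>_. 0)"
  by (auto simp: affine_op_def on_disk_def)

text \<open>
  The base of \<open>hk x\<close> at the image point is \<open>2 / den\<close> times \<open>p\<close> times the base of \<open>hk ((x + q) / p)\<close>;
  the weight \<open>(2 / den)\<^sup>s\<close> cancels the first factor.
\<close>
lemma affine_op_hk:
  assumes p: "p > 0" and q: "q \<ge> 0" and x: "x > 0"
  shows "affine_op p q (hk x) = (\<lambda>z. of_real (p powr (- s / 2)) * hk ((x + q) / p) z)"
proof
  fix z
  show "affine_op p q (hk x) z = of_real (p powr (- s / 2)) * hk ((x + q) / p) z"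
  proof (cases "cmod z < 1")
    case True
    note d = affine_den_nz[OF p q True] affine_den_Re[OF p q True]
    define u where "u = 2 / affine_den p q z"
    define y where "y = (x + q) / p"
    have y: "y > 0" using p q x by (simp add: y_def)
    define v where "v = of_real y * (1 - z) + (1 + z)"
    have v: "Re v > 0" unfolding v_def by (rule hk_base_Re[OF y True])
    have u: "Re u > 0"
    proof -
      have "Re u = 2 * Re (affine_den p q z) / (cmod (affine_den p q z))\<^sup>2"
        unfolding u_def by (simp add: Re_divide cmod_power2)
      then show ?thesis using d by simp
    qed
    have pv: "Re (of_real p * v) > 0" using v p by simp
    have "of_real x * (1 - affine_mob p q z) + (1 + affine_mob p q z) = u * (of_real p * v)"
    proof -
      have m: "affine_mob p q z * affine_den p q z = of_real p * (1 + z) + of_real (q - 1) * (1 - z)"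
        using d(1) by (simp add: affine_mob_def)
      have pv: "of_real p * v = (of_real x + of_real q) * (1 - z) + of_real p * (1 + z)"
        using p by (simp add: v_def y_def distrib_left)
      have "(of_real x * (1 - affine_mob p q z) + (1 + affine_mob p q z)) * affine_den p q z
          = of_real x * (affine_den p q z - affine_mob p q z * affine_den p q z) + (affine_den p q z + affine_mob p q z * affine_den p q z)"
        by (simp add: algebra_simps)
      also have "\<dots> = 2 * (of_real p * v)"
        unfolding m pv by (simp add: affine_den_def algebra_simps)
      finally show ?thesis using d(1) by (simp add: u_def field_simps)
    qed
    then have "hk x (affine_mob p q z) = (u * (of_real p * v)) powr (- of_real s)"
      using affine_mob_disk[OF p q True] by (simp add: hk_def on_disk_def)
    also have "\<dots> = u powr (- of_real s) * (of_real p powr (- of_real s) * v powr (- of_real s))"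
      using u v p pv by (simp add: powr_mult_right_half_plane[OF u pv] powr_mult_right_half_plane)
    also have "v powr (- of_real s) = hk y z" using True by (simp add: v_def hk_def on_disk_def)
    also have "of_real p powr (- of_real s) = complex_of_real (p powr (- s))"
      using powr_of_real[of p "- s"] p by simp
    finally have "affine_op p q (hk x) z = of_real (p powr (s / 2) * p powr (- s)) * (u powr of_real s * u powr (- of_real s)) * hk y z"
      using True by (simp add: affine_op_def on_disk_def u_def)
    also have "p powr (s / 2) * p powr (- s) = p powr (- s / 2)" by (simp flip: powr_add)
    also have "u powr of_real s * u powr (- of_real s) = 1"
    proof -
      have "u \<noteq> 0" using u by auto
      then show ?thesis by (simp add: powr_minus)
    qed
    finally show ?thesis by (simp add: y_def)
  qed (simp add: affine_op_def on_disk_def hk_outside)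
qed

lemma affine_op_hk_in: "p > 0 \<Longrightarrow> q \<ge> 0 \<Longrightarrow> x > 0 \<Longrightarrow> affine_op p q (hk x) \<in> hspan"
  unfolding affine_op_hk by (intro hspan_scale hk_in_hspan) (simp add: add_pos_nonneg)

lemma affine_op_hspan: "g \<in> hspan \<Longrightarrow> p > 0 \<Longrightarrow> q \<ge> 0 \<Longrightarrow> affine_op p q g \<in> hspan"
proof (induction rule: hspan.induct)
  case (add g x c)
  then show ?case using affine_op_comb[of p q c "hk x" 1 g] hspan_comb[OF affine_op_hk_in add(3), of p q x c 1] by simp
qed (simp add: affine_op_zero hspan.zero)

lemma inner_affine_op_hk:
  assumes "p > 0" "q \<ge> 0" "p' > 0" "q' \<ge> 0" "x > 0" "y > 0"
  shows "hinner HA (affine_op p q (hk x)) (affine_op p' q' (hk y)) =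
     of_real (p powr (- s / 2) * p' powr (- s / 2) * (2 * ((x + q) / p + (y + q') / p')) powr (- s))"
proof -
  have "(x + q) / p > 0" "(y + q') / p' > 0" using assms by (auto simp: add_pos_nonneg)
  then show ?thesis using assms by (simp add: affine_op_hk A.form_simps hk_in inner_hk_hk add.commute)
qed

text \<open>
  An identity between two sesquilinear forms passes from kernels to their span.
\<close>
lemma inner_hspan_eqI:
  assumes g: "g \<in> hspan" and h: "h \<in> hspan"
    and pos: "p1 > 0" "q1 \<ge> 0" "p2 > 0" "q2 \<ge> 0" "p3 > 0" "q3 \<ge> 0" "p4 > 0" "q4 \<ge> 0"
    and eq: "\<And>x y. x > 0 \<Longrightarrow> y > 0 \<Longrightarrow> hinner HA (affine_op p1 q1 (hk x)) (affine_op p2 q2 (hk y)) =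
       hinner HA (affine_op p3 q3 (hk x)) (affine_op p4 q4 (hk y))"
  shows "hinner HA (affine_op p1 q1 g) (affine_op p2 q2 h) = hinner HA (affine_op p3 q3 g) (affine_op p4 q4 h)"
proof -
  have i: "\<And>p q g. p > 0 \<Longrightarrow> q \<ge> 0 \<Longrightarrow> g \<in> hspan \<Longrightarrow> affine_op p q g \<in> hcarrier HA"
    using affine_op_hspan hspan_in by blast
  have affine_op_add: "affine_op p q (\<lambda>z. c * f z + g z) = (\<lambda>z. c * affine_op p q f z + 1 * affine_op p q g z)" for p q c f g
    using affine_op_comb[of p q c f 1 g] by simp
  have 1: "hinner HA (affine_op p1 q1 (hk x)) (affine_op p2 q2 h) = hinner HA (affine_op p3 q3 (hk x)) (affine_op p4 q4 h)" if x: "x > 0" for x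
    using h
  proof (induction rule: hspan.induct)
    case zero
    then show ?case using pos x by (simp add: affine_op_zero A.inner_zero_right i hk_in_hspan)
  next
    case (add g y c)
    then show ?case unfolding affine_op_add
      using pos x by (subst (1 2) A.B_lin_right) (auto simp: i hk_in_hspan eq)
  qed
  show ?thesis
    using g
  proof (induction rule: hspan.induct)
    case zero
    then show ?case using pos h by (simp add: affine_op_zero A.inner_zero_left i)
  next
    case (add g y c)
    then show ?case unfolding affine_op_add
      using pos h by (subst (1 2) A.B_lin) (auto simp: i hk_in_hspan 1)
  qed
qed

lemma affine_op_id: "f \<in> hcarrier HA \<Longrightarrow> affine_op 1 0 f = f"
  by (auto simp: affine_op_def on_disk_def affine_den_def affine_mob_def A.outside_disk fun_eq_iff)

lemma affine_op_isometric_hspan: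
  assumes p: "p > 0" and g: "g \<in> hspan"
  shows "hnorm HA (affine_op p 0 g) = hnorm HA g"
proof -
  have "hinner HA (affine_op p 0 g) (affine_op p 0 g) = hinner HA (affine_op 1 0 g) (affine_op 1 0 g)"
  proof (rule inner_hspan_eqI[OF g g])
    fix x y :: real assume xy: "x > 0" "y > 0"
    have "(2 * (x / p + y / p)) powr (- s) = (2 * (x + y)) powr (- s) / p powr (- s)"
      using powr_divide[of "2 * (x + y)" p "- s"] xy p by (simp add: add_divide_distrib)
    moreover have "p powr (- s / 2) * p powr (- s / 2) = p powr (- s)" by (simp flip: powr_add)
    ultimately show "hinner HA (affine_op p 0 (hk x)) (affine_op p 0 (hk y)) = hinner HA (affine_op 1 0 (hk x)) (affine_op 1 0 (hk y))"
      using p xy by (simp add: inner_affine_op_hk)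
  qed (use p in auto)
  then show ?thesis using affine_op_id[OF hspan_in[OF g]] by (simp add: hnorm_def)
qed

text \<open>
  \<open>P\<^sub>t\<close> moves kernels away from the imaginary axis, where their norms decrease.
\<close>
lemma translation_bounded_hspan:
  assumes "g \<in> hspan" shows "\<exists>c. \<forall>t\<ge>0. hnorm HA (affine_op 1 t g) \<le> c"
  using assms
proof (induction rule: hspan.induct)
  case zero
  then show ?case by (auto simp: affine_op_zero)
next
  case (add g x c)
  then obtain C where C: "\<forall>t\<ge>0. hnorm HA (affine_op 1 t g) \<le> C" by auto
  have "hnorm HA (affine_op 1 t (\<lambda>z. c * hk x z + g z)) \<le> cmod c * sqrt ((4 * x) powr (- s)) + C" if t: "t \<ge> 0" for t
  proof -
    have i: "affine_op 1 t (hk x) \<in> hcarrier HA" "affine_op 1 t g \<in> hcarrier HA"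
      using affine_op_hspan hk_in_hspan hspan_in add t by auto
    have "affine_op 1 t (\<lambda>z. c * hk x z + g z) = (\<lambda>z. c * affine_op 1 t (hk x) z + affine_op 1 t g z)"
      using affine_op_comb[of 1 t c "hk x" 1 g] by simp
    then have "hnorm HA (affine_op 1 t (\<lambda>z. c * hk x z + g z)) \<le> cmod c * hnorm HA (affine_op 1 t (hk x)) + hnorm HA (affine_op 1 t g)"
      using A.norm_triangle[of "\<lambda>z. c * affine_op 1 t (hk x) z" "affine_op 1 t g"] i by (simp add: A.norm_scale A.C_scale)
    moreover have "hnorm HA (affine_op 1 t (hk x)) \<le> sqrt ((4 * x) powr (- s))"
    proof -
      have "(2 * (x + t + (x + t))) powr (- s) \<le> (4 * x) powr (- s)"
        by (rule powr_mono2') (use s_gt_1 add t in auto)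
      then show ?thesis using add t by (simp add: hnorm_def inner_affine_op_hk)
    qed
    ultimately show ?thesis using C t by (smt (verit) mult_left_mono norm_ge_zero)
  qed
  then show ?case by blast
qed

text \<open>
  Since \<open>\<parallel>P\<^sub>u g\<parallel>\<^sup>2 = \<langle>P\<^bsub>2u\<^esub> g, g\<rangle>\<close>, the quotient \<open>q(u) = \<parallel>P\<^sub>u g\<parallel> / \<parallel>g\<parallel>\<close> satisfies \<open>q(u)\<^sup>2 \<le> q(2 u)\<close>. If \<open>q(t)\<close>
  exceeded \<open>1\<close>, then \<open>q(2\<^sup>n t)\<close> would be unbounded, contrary to the previous lemma.
\<close>
lemma translation_contractive_hspan:
  assumes g: "g \<in> hspan" and t: "t \<ge> 0"
  shows "hnorm HA (affine_op 1 t g) \<le> hnorm HA g"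
proof (rule ccontr)
  assume "\<not> ?thesis"
  then have gt: "hnorm HA g < hnorm HA (affine_op 1 t g)" by simp
  have gi: "g \<in> hcarrier HA" and i: "u \<ge> 0 \<Longrightarrow> affine_op 1 u g \<in> hcarrier HA" for u
    using g affine_op_hspan hspan_in by auto
  have step: "(hnorm HA (affine_op 1 u g))\<^sup>2 \<le> hnorm HA (affine_op 1 (2 * u) g) * hnorm HA g" if u: "u \<ge> 0" for u
  proof -
    have "hinner HA (affine_op 1 u g) (affine_op 1 u g) = hinner HA (affine_op 1 (2 * u) g) (affine_op 1 0 g)"
      by (rule inner_hspan_eqI[OF g g]) (use u in \<open>auto simp: inner_affine_op_hk algebra_simps\<close>)
    then have "of_real ((hnorm HA (affine_op 1 u g))\<^sup>2) = hinner HA (affine_op 1 (2 * u) g) g"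
      using u by (simp add: A.inner_self i affine_op_id gi)
    then have "(hnorm HA (affine_op 1 u g))\<^sup>2 = cmod (hinner HA (affine_op 1 (2 * u) g) g)"
      by (metis abs_of_nonneg norm_of_real zero_le_power2)
    also have "\<dots> \<le> hnorm HA (affine_op 1 (2 * u) g) * hnorm HA g" using A.inner_le_norm i gi u by simp
    finally show ?thesis .
  qed
  have g0: "hnorm HA g > 0"
  proof (rule ccontr)
    assume "\<not> hnorm HA g > 0"
    then have "hnorm HA g = 0" using A.norm_nonneg[OF gi] by simp
    then show False using step[OF t] gt by simp
  qed
  define q where "q u = hnorm HA (affine_op 1 u g) / hnorm HA g" for u
  have q0: "q u \<ge> 0" if "u \<ge> 0" for u using A.norm_nonneg[OF i[OF that]] g0 by (simp add: q_def)
  have qs: "(q u)\<^sup>2 \<le> q (2 * u)" if "u \<ge> 0" for u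
    using step[OF that] g0 by (simp add: q_def power_divide power2_eq_square field_simps)
  have qp: "q t ^ (2 ^ n) \<le> q (2 ^ n * t)" for n
  proof (induction n)
    case (Suc n)
    have "q t ^ (2 ^ Suc n) = (q t ^ (2 ^ n))\<^sup>2" by (simp add: power_mult[symmetric] mult.commute)
    also have "\<dots> \<le> (q (2 ^ n * t))\<^sup>2" using Suc q0 t by (intro power_mono) auto
    also have "\<dots> \<le> q (2 ^ Suc n * t)" using qs[of "2 ^ n * t"] t by (simp add: mult.assoc)
    finally show ?case .
  qed simp
  obtain C where C: "\<And>u. u \<ge> 0 \<Longrightarrow> hnorm HA (affine_op 1 u g) \<le> C" using translation_bounded_hspan[OF g] by blast
  have q1: "q t > 1" using gt g0 by (simp add: q_def)
  obtain n where n: "C / hnorm HA g < q t ^ n" using real_arch_pow[OF q1] by blast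
  have "q t ^ n \<le> q t ^ (2 ^ n)" using q1 by (intro power_increasing) (auto simp: less_imp_le)
  also have "\<dots> \<le> q (2 ^ n * t)" by (rule qp)
  also have "\<dots> \<le> C / hnorm HA g" unfolding q_def using C[of "2 ^ n * t"] t g0 by (intro divide_right_mono) auto
  finally show False using n by simp
qed

text \<open>
  The images of approximating combinations of kernels form a Cauchy sequence. Its limit is the
  weighted composition itself because norm convergence implies pointwise convergence; this shows
  that \<open>affine_op p q f\<close> lies in the space at all.
\<close>
lemma affine_op_extend:
  assumes p: "p > 0" and q: "q \<ge> 0" and c: "c \<ge> 0"
    and bound: "\<And>g. g \<in> hspan \<Longrightarrow> hnorm HA (affine_op p q g) \<le> c * hnorm HA g"
    and f: "f \<in> hcarrier HA"
  shows "affine_op p q f \<in> hcarrier HA" "hnorm HA (affine_op p q f) \<le> c * hnorm HA f"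
proof -
  obtain g where gs: "\<And>k::nat. g k \<in> hspan" and glim: "(\<lambda>k. hnorm HA (\<lambda>x. g k x - f x)) \<longlonglongrightarrow> 0"
    using A.approximating_sequence[OF _ f hspan_dense[OF f]] hspan_in by blast
  have gi: "g k \<in> hcarrier HA" for k using gs hspan_in by auto
  have hi: "affine_op p q (g k) \<in> hcarrier HA" for k using gs p q affine_op_hspan hspan_in by auto
  have diff: "hnorm HA (\<lambda>x. affine_op p q (g m) x - affine_op p q (g n) x) \<le> c * hnorm HA (\<lambda>x. g m x - g n x)" for m n
  proof -
    have "(\<lambda>x. g m x - g n x) \<in> hspan" using hspan_comb[OF gs gs, of 1 m "-1" n] by simp
    from bound[OF this] show ?thesis by (simp add: linear_on_diff[OF affine_op_linear[of UNIV]])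
  qed
  have "\<exists>F\<in>hcarrier HA. (\<lambda>k. hnorm HA (\<lambda>x. affine_op p q (g k) x - F x)) \<longlonglongrightarrow> 0"
  proof (rule A.complete[OF hi])
    fix e :: real assume e: "e > 0"
    \<comment> \<open>The summand \<open>1\<close> covers the case \<open>c = 0\<close>.\<close>
    have "e / (2 * (c + 1)) > 0" using e c by simp
    then obtain N where N: "\<And>k. k \<ge> N \<Longrightarrow> norm (hnorm HA (\<lambda>x. g k x - f x) - 0) < e / (2 * (c + 1))"
      using LIMSEQ_D[OF glim] by blast
    have "hnorm HA (\<lambda>x. affine_op p q (g m) x - affine_op p q (g n) x) < e" if mn: "m \<ge> N" "n \<ge> N" for m n
    proof -
      have small: "hnorm HA (\<lambda>x. g k x - f x) < e / (2 * (c + 1))" if "k \<ge> N" for k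
        using N[OF that] by simp
      have "hnorm HA (\<lambda>x. g m x - g n x) \<le> hnorm HA (\<lambda>x. g m x - f x) + hnorm HA (\<lambda>x. f x - g n x)"
        by (rule A.norm_triangle_diff) (use gi f in auto)
      also have "hnorm HA (\<lambda>x. f x - g n x) = hnorm HA (\<lambda>x. g n x - f x)" by (rule A.norm_minus_commute[OF f gi])
      also have "hnorm HA (\<lambda>x. g m x - f x) + hnorm HA (\<lambda>x. g n x - f x) < e / (2 * (c + 1)) + e / (2 * (c + 1))"
        using small mn by (intro add_strict_mono) auto
      also have "\<dots> = e / (c + 1)" by (simp only: mult.commute[of 2] divide_divide_eq_left[symmetric] field_sum_of_halves)
      finally have *: "hnorm HA (\<lambda>x. g m x - g n x) < e / (c + 1)" .
      have "hnorm HA (\<lambda>x. affine_op p q (g m) x - affine_op p q (g n) x) \<le> c * hnorm HA (\<lambda>x. g m x - g n x)" by (rule diff)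
      also have "\<dots> \<le> c * (e / (c + 1))" using * c by (intro mult_left_mono) auto
      also have "\<dots> < e" using e c by (simp add: pos_divide_less_eq distrib_left mult.commute)
      finally show ?thesis .
    qed
    then show "\<exists>N. \<forall>m\<ge>N. \<forall>n\<ge>N. hnorm HA (\<lambda>x. affine_op p q (g m) x - affine_op p q (g n) x) < e" by blast
  qed
  then obtain F where F: "F \<in> hcarrier HA" "(\<lambda>k. hnorm HA (\<lambda>x. affine_op p q (g k) x - F x)) \<longlonglongrightarrow> 0" by auto
  have "F = affine_op p q f"
  proof
    fix z show "F z = affine_op p q f z"
    proof (cases "cmod z < 1")
      case True
      have "(\<lambda>k. of_real (p powr (s / 2)) * (2 / affine_den p q z) powr of_real s * g k (affine_mob p q z)) \<longlonglongrightarrow>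
          of_real (p powr (s / 2)) * (2 / affine_den p q z) powr of_real s * f (affine_mob p q z)"
        by (intro tendsto_intros A.eval_tendsto[OF gi f glim affine_mob_disk[OF p q True]])
      then have "(\<lambda>k. affine_op p q (g k) z) \<longlonglongrightarrow> affine_op p q f z" using True by (simp add: affine_op_def on_disk_def)
      then show ?thesis using A.eval_tendsto[OF hi F True] LIMSEQ_unique by blast
    qed (simp add: affine_op_def on_disk_def A.outside_disk F)
  qed
  then show i: "affine_op p q f \<in> hcarrier HA" using F by simp
  show "hnorm HA (affine_op p q f) \<le> c * hnorm HA f"
  proof (rule LIMSEQ_le_const)
    show "(\<lambda>k. hnorm HA (\<lambda>x. affine_op p q (g k) x - F x) + c * (hnorm HA (\<lambda>x. g k x - f x) + hnorm HA f)) \<longlonglongrightarrow> c * hnorm HA f"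
      using tendsto_add[OF F(2) tendsto_mult_left[OF tendsto_add[OF glim tendsto_const]]] by simp
    have "hnorm HA (affine_op p q f) \<le> hnorm HA (\<lambda>x. affine_op p q (g k) x - F x) + c * (hnorm HA (\<lambda>x. g k x - f x) + hnorm HA f)" for k
    proof -
      have "hnorm HA F \<le> hnorm HA (\<lambda>x. F x - affine_op p q (g k) x) + hnorm HA (affine_op p q (g k))"
        using A.norm_triangle[OF A.C_diff[OF F(1) hi] hi, of k k] by simp
      also have "hnorm HA (\<lambda>x. F x - affine_op p q (g k) x) = hnorm HA (\<lambda>x. affine_op p q (g k) x - F x)"
        by (rule A.norm_minus_commute[OF F(1) hi])
      also have "hnorm HA (affine_op p q (g k)) \<le> c * hnorm HA (g k)" by (rule bound[OF gs])
      also have "hnorm HA (g k) \<le> hnorm HA (\<lambda>x. g k x - f x) + hnorm HA f"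
        using A.norm_triangle[OF A.C_diff[OF gi f] f] by simp
      finally show ?thesis using \<open>F = affine_op p q f\<close> c by (simp add: mult_left_mono)
    qed
    then show "\<exists>N. \<forall>k\<ge>N. hnorm HA (affine_op p q f) \<le> hnorm HA (\<lambda>x. affine_op p q (g k) x - F x) + c * (hnorm HA (\<lambda>x. g k x - f x) + hnorm HA f)"
      by blast
  qed
qed

lemma eq_on_hk:
  assumes "A.bounded_linear_on S" "A.bounded_linear_on T" "\<And>x. x > 1 \<Longrightarrow> S (hk x) = T (hk x)"
    and "f \<in> hcarrier HA"
  shows "S f = T f"
proof -
  have "{f \<in> hcarrier HA. S f = T f} = hcarrier HA"
    by (rule hk_dense[OF A.equalizer_closed_subspace[OF assms(1,2)]]) (use assms(3) hk_in in auto)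
  then show ?thesis using assms(4) by blast
qed

text \<open>
  First \<open>g\<close> is a kernel and \<open>f\<close> is arbitrary; then \<open>f\<close> is fixed and the roles are exchanged.
\<close>
lemma adjoint_on_hk:
  assumes S: "A.bounded_linear_on S" and T: "A.bounded_linear_on T"
    and eq: "\<And>x y. x > 1 \<Longrightarrow> y > 1 \<Longrightarrow> hinner HA (S (hk x)) (hk y) = hinner HA (hk x) (T (hk y))"
    and f: "f \<in> hcarrier HA" and g: "g \<in> hcarrier HA"
  shows "hinner HA (S f) g = hinner HA f (T g)"
proof -
  note Ti = A.bounded_linear_on_in[OF T] and Si = A.bounded_linear_on_in[OF S]
  have 1: "hinner HA (S f) (hk y) = hinner HA f (T (hk y))" if f: "f \<in> hcarrier HA" and y: "y > 1" for f y
  proof -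
    have "{f \<in> hcarrier HA. hinner HA (S f) (hk y) = hinner HA f (T (hk y))} = hcarrier HA"
      by (rule hk_dense[OF A.inner_closed_subspace[OF S]]) (use eq y hk_in Ti in auto)
    then show ?thesis using f by blast
  qed
  have "{g \<in> hcarrier HA. hinner HA (T g) f = hinner HA g (S f)} = hcarrier HA"
  proof (rule hk_dense[OF A.inner_closed_subspace[OF T f Si[OF f]]])
    fix y :: real assume y: "y > 1"
    have "hinner HA (T (hk y)) f = cnj (hinner HA f (T (hk y)))"
      by (rule A.B_sym) (use f y hk_in Ti in auto)
    also have "\<dots> = cnj (hinner HA (S f) (hk y))" using 1[OF f y] by simp
    also have "\<dots> = hinner HA (hk y) (S f)"
      by (rule A.B_sym[symmetric]) (use f y hk_in Si in auto)
    finally show "hk y \<in> {g \<in> hcarrier HA. hinner HA (T g) f = hinner HA g (S f)}" using hk_in y by auto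
  qed
  then have "hinner HA (T g) f = hinner HA g (S f)" using g by blast
  then show ?thesis using A.B_sym[OF Ti[OF g] f] A.B_sym[OF g Si[OF f]] by simp
qed

section \<open>Unitary dilations and the semigroup of translations\<close>

lemma dilation_in: "p > 0 \<Longrightarrow> f \<in> hcarrier HA \<Longrightarrow> affine_op p 0 f \<in> hcarrier HA"
  and dilation_norm_le: "p > 0 \<Longrightarrow> f \<in> hcarrier HA \<Longrightarrow> hnorm HA (affine_op p 0 f) \<le> hnorm HA f"
  using affine_op_extend[of p 0 1 f] affine_op_isometric_hspan by auto

lemma translation_in: "t \<ge> 0 \<Longrightarrow> f \<in> hcarrier HA \<Longrightarrow> affine_op 1 t f \<in> hcarrier HA"
  and translation_norm_le: "t \<ge> 0 \<Longrightarrow> f \<in> hcarrier HA \<Longrightarrow> hnorm HA (affine_op 1 t f) \<le> hnorm HA f"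
  using affine_op_extend[of 1 t 1 f] translation_contractive_hspan by auto

lemma dilation_bounded: "p > 0 \<Longrightarrow> A.bounded_linear_on (affine_op p 0)"
  by (rule A.bounded_linear_onI[where c = 1]) (simp_all add: dilation_in dilation_norm_le affine_op_linear)

lemma translation_bounded: "t \<ge> 0 \<Longrightarrow> A.bounded_linear_on (affine_op 1 t)"
  by (rule A.bounded_linear_onI[where c = 1]) (simp_all add: translation_in translation_norm_le affine_op_linear)

lemma id_bounded: "A.bounded_linear_on (\<lambda>f. f)"
  by (rule A.bounded_linear_onI[where c = 1]) (simp_all add: linear_on_def)

lemma affine_op_scale: "affine_op p q (\<lambda>x. c * f x) = (\<lambda>x. c * affine_op p q f x)"
  using affine_op_comb[of p q c f 0 f] by simp

lemma affine_op_diff: "affine_op p q (\<lambda>x. f x - g x) = (\<lambda>x. affine_op p q f x - affine_op p q g x)"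
  using affine_op_comb[of p q 1 f "-1" g] by simp

lemma dilation_adjoint:
  assumes "p > 0" "f \<in> hcarrier HA" "g \<in> hcarrier HA"
  shows "hinner HA (affine_op p 0 f) g = hinner HA f (affine_op (1 / p) 0 g)"
proof (rule adjoint_on_hk[OF dilation_bounded dilation_bounded _ assms(2,3)])
  fix x y :: real assume xy: "x > 1" "y > 1"
  have "x / p + y = (x + p * y) / p" using assms by (simp add: field_simps)
  then have a: "(2 * (x / p + y)) powr (- s) = (2 * (x + p * y)) powr (- s) / p powr (- s)"
    using powr_divide[of "2 * (x + p * y)" p "- s"] xy assms by simp
  have b: "p powr (- s / 2) / p powr (- s) = p powr (s / 2)"
    using assms by (simp flip: powr_diff)
  have c: "(1 / p) powr (- s / 2) = p powr (s / 2)"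
    using assms by (simp add: powr_divide powr_minus_divide)
  have e: "p powr (- s / 2) * (2 * (x / p + y)) powr (- s) = (1 / p) powr (- s / 2) * (2 * (x + p * y)) powr (- s)"
    unfolding a c b[symmetric] by simp
  have "hinner HA (affine_op p 0 (hk x)) (affine_op 1 0 (hk y)) = of_real (p powr (- s / 2) * (2 * (x / p + y)) powr (- s))"
    using inner_affine_op_hk[of p 0 1 0 x y] assms xy by simp
  moreover have "hinner HA (affine_op 1 0 (hk x)) (affine_op (1 / p) 0 (hk y)) = of_real ((1 / p) powr (- s / 2) * (2 * (x + p * y)) powr (- s))"
    using inner_affine_op_hk[of 1 0 "1 / p" 0 x y] assms xy by (simp add: mult.commute[of y p])
  ultimately have "hinner HA (affine_op p 0 (hk x)) (affine_op 1 0 (hk y)) = hinner HA (affine_op 1 0 (hk x)) (affine_op (1 / p) 0 (hk y))"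
    by (simp only: e)
  then show "hinner HA (affine_op p 0 (hk x)) (hk y) = hinner HA (hk x) (affine_op (1 / p) 0 (hk y))"
    using xy by (simp add: affine_op_id hk_in)
qed (use assms in auto)

lemma dilation_inverse:
  assumes p: "p > 0" and "f \<in> hcarrier HA"
  shows "affine_op (1 / p) 0 (affine_op p 0 f) = f"
proof (rule eq_on_hk[where S = "\<lambda>f. affine_op (1 / p) 0 (affine_op p 0 f)" and T = "\<lambda>f. f",
    OF A.bounded_linear_on_compose[OF dilation_bounded dilation_bounded] id_bounded])
  fix x :: real assume x: "x > 1"
  have "p powr (- s / 2) * (1 / p) powr (- s / 2) = 1"
    using assms by (simp add: powr_divide)
  then have e: "of_real (p powr (- s / 2)) * (of_real ((1 / p) powr (- s / 2)) * w) = w" for w :: complex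
    by (simp only: mult.assoc[symmetric] of_real_mult[symmetric]) simp
  have h1: "affine_op p 0 (hk x) = (\<lambda>z. of_real (p powr (- s / 2)) * hk (x / p) z)"
    using affine_op_hk[of p 0 x] p x by simp
  have h2: "affine_op (1 / p) 0 (hk (x / p)) = (\<lambda>z. of_real ((1 / p) powr (- s / 2)) * hk x z)"
    using affine_op_hk[of "1 / p" 0 "x / p"] p x by simp
  show "affine_op (1 / p) 0 (affine_op p 0 (hk x)) = hk x"
    unfolding h1 affine_op_scale h2 e ..
qed (use assms in auto)

lemma dilation_isometric:
  assumes "p > 0" "f \<in> hcarrier HA"
  shows "hnorm HA (affine_op p 0 f) = hnorm HA f"
  using dilation_adjoint[OF assms dilation_in[OF assms]] dilation_inverse[OF assms] by (simp add: hnorm_def)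

lemma translation_hk: "t \<ge> 0 \<Longrightarrow> x > 0 \<Longrightarrow> affine_op 1 t (hk x) = hk (x + t)"
  using affine_op_hk[of 1 t x] by simp

lemma translation_symmetric:
  assumes "t \<ge> 0" "f \<in> hcarrier HA" "g \<in> hcarrier HA"
  shows "hinner HA (affine_op 1 t f) g = hinner HA f (affine_op 1 t g)"
proof (rule adjoint_on_hk[OF translation_bounded translation_bounded _ assms(2,3)])
  fix x y :: real assume xy: "x > 1" "y > 1"
  then have "hinner HA (affine_op 1 t (hk x)) (hk y) = of_real ((2 * (y + (x + t))) powr (- s))"
    "hinner HA (hk x) (affine_op 1 t (hk y)) = of_real ((2 * ((y + t) + x)) powr (- s))"
    using assms by (simp_all add: translation_hk inner_hk_hk)
  then show "hinner HA (affine_op 1 t (hk x)) (hk y) = hinner HA (hk x) (affine_op 1 t (hk y))"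
    by (simp add: algebra_simps)
qed (use assms in auto)

lemma translation_add:
  assumes "t \<ge> 0" "u \<ge> 0" "f \<in> hcarrier HA"
  shows "affine_op 1 t (affine_op 1 u f) = affine_op 1 (t + u) f"
proof (rule eq_on_hk[where S = "\<lambda>f. affine_op 1 t (affine_op 1 u f)" and T = "affine_op 1 (t + u)",
    OF A.bounded_linear_on_compose[OF translation_bounded translation_bounded] translation_bounded])
  fix x :: real assume x: "x > 1"
  then show "affine_op 1 t (affine_op 1 u (hk x)) = affine_op 1 (t + u) (hk x)"
    using assms translation_hk[of u x] translation_hk[of t "x + u"] translation_hk[of "t + u" x]
    by (simp add: add_ac)
qed (use assms in auto)

text \<open>
  The affine maps \<open>w \<mapsto> p (w + t)\<close> and \<open>w \<mapsto> p w + p t\<close> coincide. This relation shortens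
  the translation at each Aluthge step.
\<close>
lemma translation_dilation:
  assumes p: "p > 0" and t: "t \<ge> 0" and "f \<in> hcarrier HA"
  shows "affine_op 1 t (affine_op p 0 f) = affine_op p 0 (affine_op 1 (p * t) f)"
proof (rule eq_on_hk[where S = "\<lambda>f. affine_op 1 t (affine_op p 0 f)" and T = "\<lambda>f. affine_op p 0 (affine_op 1 (p * t) f)",
    OF A.bounded_linear_on_compose[OF translation_bounded dilation_bounded]
      A.bounded_linear_on_compose[OF dilation_bounded translation_bounded]])
  fix x :: real assume x: "x > 1"
  have e: "x / p + t = (x + p * t) / p" using assms by (simp add: field_simps)
  have h1: "affine_op p 0 (hk y) = (\<lambda>z. of_real (p powr (- s / 2)) * hk (y / p) z)" if "y > 0" for y
    using affine_op_hk[of p 0 y] p that by simp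
  have h2: "affine_op 1 t (hk (x / p)) = hk (x / p + t)" "affine_op 1 (p * t) (hk x) = hk (x + p * t)"
    using p t x by (intro translation_hk; simp)+
  show "affine_op 1 t (affine_op p 0 (hk x)) = affine_op p 0 (affine_op 1 (p * t) (hk x))"
    using x p t by (simp add: h1 h2 affine_op_scale e add_pos_nonneg)
qed (use assms in auto)

text \<open>
  On a kernel the norm is explicit and continuous in the translation length; contractivity of the
  translations makes the set of vectors with this property closed.
\<close>
lemma translation_tendsto:
  assumes c: "\<And>n::nat. c n \<ge> 0" "c \<longlonglongrightarrow> 0" and f: "f \<in> hcarrier HA"
  shows "(\<lambda>n. hnorm HA (\<lambda>x. affine_op 1 (c n) f x - f x)) \<longlonglongrightarrow> 0"
proof -
  let ?M = "{f \<in> hcarrier HA. (\<lambda>n. hnorm HA (\<lambda>x. affine_op 1 (c n) f x - f x)) \<longlonglongrightarrow> 0}"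
  note i = translation_in[OF c(1)]
  have "?M = hcarrier HA"
  proof (rule hk_dense)
    show "A.closed_subspace ?M"
    proof (rule A.closed_subspaceI)
      fix f g d e assume f: "f \<in> ?M" and g: "g \<in> ?M"
      have "(\<lambda>n. hnorm HA (\<lambda>x. affine_op 1 (c n) (\<lambda>x. d * f x + e * g x) x - (d * f x + e * g x))) \<longlonglongrightarrow> 0"
      proof (rule tendsto_sandwich[OF _ _ tendsto_const])
        show "(\<lambda>n. cmod d * hnorm HA (\<lambda>x. affine_op 1 (c n) f x - f x) + cmod e * hnorm HA (\<lambda>x. affine_op 1 (c n) g x - g x)) \<longlonglongrightarrow> 0"
          using f g by (auto intro!: tendsto_eq_intros)
        have eq: "(\<lambda>x. affine_op 1 (c n) (\<lambda>x. d * f x + e * g x) x - (d * f x + e * g x)) =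
            (\<lambda>x. d * (affine_op 1 (c n) f x - f x) + e * (affine_op 1 (c n) g x - g x))" for n
          by (simp add: affine_op_comb algebra_simps)
        have "hnorm HA (\<lambda>x. d * (affine_op 1 (c n) f x - f x) + e * (affine_op 1 (c n) g x - g x)) \<le>
            cmod d * hnorm HA (\<lambda>x. affine_op 1 (c n) f x - f x) + cmod e * hnorm HA (\<lambda>x. affine_op 1 (c n) g x - g x)" for n
          using A.norm_triangle[of "\<lambda>x. d * (affine_op 1 (c n) f x - f x)" "\<lambda>x. e * (affine_op 1 (c n) g x - g x)"] f g
          by (simp add: A.norm_scale A.C_scale A.C_diff i)
        then show "\<forall>\<^sub>F n in sequentially. hnorm HA (\<lambda>x. affine_op 1 (c n) (\<lambda>x. d * f x + e * g x) x - (d * f x + e * g x)) \<le>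
            cmod d * hnorm HA (\<lambda>x. affine_op 1 (c n) f x - f x) + cmod e * hnorm HA (\<lambda>x. affine_op 1 (c n) g x - g x)"
          unfolding eq by simp
        show "\<forall>\<^sub>F n in sequentially. 0 \<le> hnorm HA (\<lambda>x. affine_op 1 (c n) (\<lambda>x. d * f x + e * g x) x - (d * f x + e * g x))"
          unfolding eq using f g by (intro always_eventually allI A.norm_nonneg A.C_lin A.C_diff i) auto
      qed
      then show "(\<lambda>x. d * f x + e * g x) \<in> ?M" using f g by (simp add: A.C_lin)
    next
      fix f X assume f: "f \<in> hcarrier HA" and X: "\<And>k::nat. X k \<in> ?M"
        and lim: "(\<lambda>k. hnorm HA (\<lambda>x. X k x - f x)) \<longlonglongrightarrow> 0"
      have "(\<lambda>n. hnorm HA (\<lambda>x. affine_op 1 (c n) f x - f x)) \<longlonglongrightarrow> 0"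
      proof (rule LIMSEQ_I)
        fix e :: real assume e: "e > 0"
        obtain k where "norm (hnorm HA (\<lambda>x. X k x - f x) - 0) < e / 3" using LIMSEQ_D[OF lim, of "e / 3"] e by auto
        then have k: "hnorm HA (\<lambda>x. X k x - f x) < e / 3" by simp
        have "(\<lambda>n. hnorm HA (\<lambda>x. affine_op 1 (c n) (X k) x - X k x)) \<longlonglongrightarrow> 0" using X by simp
        then obtain N where N: "\<And>n. n \<ge> N \<Longrightarrow> norm (hnorm HA (\<lambda>x. affine_op 1 (c n) (X k) x - X k x) - 0) < e / 3"
          using LIMSEQ_D[of "\<lambda>n. hnorm HA (\<lambda>x. affine_op 1 (c n) (X k) x - X k x)" 0 "e / 3"] e by auto
        have Xk: "X k \<in> hcarrier HA" using X by simp
        have "norm (hnorm HA (\<lambda>x. affine_op 1 (c n) f x - f x) - 0) < e" if n: "n \<ge> N" for n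
        proof -
          have "hnorm HA (\<lambda>x. affine_op 1 (c n) f x - f x) \<le> hnorm HA (\<lambda>x. affine_op 1 (c n) f x - affine_op 1 (c n) (X k) x)
              + hnorm HA (\<lambda>x. affine_op 1 (c n) (X k) x - f x)"
            by (rule A.norm_triangle_diff) (use f i Xk in auto)
          also have "hnorm HA (\<lambda>x. affine_op 1 (c n) (X k) x - f x) \<le> hnorm HA (\<lambda>x. affine_op 1 (c n) (X k) x - X k x) + hnorm HA (\<lambda>x. X k x - f x)"
            by (rule A.norm_triangle_diff) (use f i Xk in auto)
          also have "hnorm HA (\<lambda>x. affine_op 1 (c n) f x - affine_op 1 (c n) (X k) x) \<le> hnorm HA (\<lambda>x. f x - X k x)"
            using translation_norm_le[OF c(1) A.C_diff[OF f Xk], of n] by (simp add: affine_op_diff)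
          also have "hnorm HA (\<lambda>x. f x - X k x) = hnorm HA (\<lambda>x. X k x - f x)" by (rule A.norm_minus_commute[OF f Xk])
          finally show ?thesis using k N[OF n] A.norm_nonneg[OF A.C_diff[OF i[OF f] f], of n] by simp
        qed
        then show "\<exists>N. \<forall>n\<ge>N. norm (hnorm HA (\<lambda>x. affine_op 1 (c n) f x - f x) - 0) < e" by blast
      qed
      then show "f \<in> ?M" using f by simp
    qed auto
    fix x :: real assume "x > 1"
    then have x: "x > 0" "\<And>n. x + c n > 0" using c(1) by (auto simp: add_pos_nonneg)
    have "(\<lambda>n. sqrt ((2 * (2 * (x + c n))) powr (- s) - 2 * (2 * (2 * x + c n)) powr (- s) + (4 * x) powr (- s))) \<longlonglongrightarrow>
       sqrt ((2 * (2 * (x + 0))) powr (- s) - 2 * (2 * (2 * x + 0)) powr (- s) + (4 * x) powr (- s))"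
      using x by (intro tendsto_intros c) auto
    moreover have "hnorm HA (\<lambda>z. affine_op 1 (c n) (hk x) z - hk x z) =
        sqrt ((2 * (2 * (x + c n))) powr (- s) - 2 * (2 * (2 * x + c n)) powr (- s) + (4 * x) powr (- s))" for n
      using x c(1)[of n] by (simp add: hnorm_def affine_op_hk A.form_simps hk_in inner_hk_hk algebra_simps)
    ultimately show "hk x \<in> ?M" using x hk_in by (simp add: mult.assoc[symmetric])
  qed
  then show ?thesis using f by blast
qed

lemma translation_pos:
  assumes "t \<ge> 0" "f \<in> hcarrier HA"
  shows "hinner HA (affine_op 1 t f) f = of_real ((hnorm HA (affine_op 1 (t / 2) f))\<^sup>2)"
proof -
  have t: "t / 2 \<ge> 0" using assms by simp
  have "affine_op 1 t f = affine_op 1 (t / 2) (affine_op 1 (t / 2) f)" using translation_add[OF t t assms(2)] by simp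
  then show ?thesis
    using translation_symmetric[OF t translation_in[OF t assms(2)] assms(2)]
    by (simp add: A.inner_self translation_in[OF t assms(2)])
qed

text \<open>
  If \<open>P\<^sub>t f = 0\<close> then \<open>\<parallel>P\<^bsub>t/2\<^esub> f\<parallel>\<^sup>2 = \<langle>P\<^sub>t f, f\<rangle> = 0\<close>; halving repeatedly and letting the length tend to \<open>0\<close>
  gives \<open>f = 0\<close>.
\<close>
lemma translation_inj:
  assumes t: "t \<ge> 0" and f: "f \<in> hcarrier HA" and 0: "affine_op 1 t f = (\<lambda>_. 0)"
  shows "f = (\<lambda>_. 0)"
proof -
  have z: "affine_op 1 (t / 2 ^ n) f = (\<lambda>_. 0)" for n
  proof (induction n)
    case (Suc n)
    have p: "t / 2 ^ n \<ge> 0" "t / 2 ^ n / 2 \<ge> 0" using t by auto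
    have "of_real ((hnorm HA (affine_op 1 (t / 2 ^ n / 2) f))\<^sup>2) = (0 :: complex)"
      using translation_pos[OF p(1) f] Suc A.inner_zero_left[OF f] by simp
    then have "affine_op 1 (t / 2 ^ n / 2) f = (\<lambda>_. 0)"
      by (intro A.norm_eq_0 translation_in p f) simp
    then show ?case by (simp add: mult.commute)
  qed (use 0 in simp)
  have "(\<lambda>n. t * (1 / 2) ^ n) \<longlonglongrightarrow> t * 0" by (intro tendsto_intros LIMSEQ_power_zero) auto
  then have "(\<lambda>n. t / 2 ^ n) \<longlonglongrightarrow> 0" by (simp add: power_divide)
  from translation_tendsto[OF _ this f] have "(\<lambda>n::nat. hnorm HA (\<lambda>x. 0 - f x)) \<longlonglongrightarrow> 0"
    using t by (simp add: z)
  then have "hnorm HA (\<lambda>x. 0 - f x) = 0" by (simp add: LIMSEQ_const_iff)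
  then have "(\<lambda>x. 0 - f x) = (\<lambda>_. 0)" by (intro A.norm_eq_0 A.C_diff A.zero_in f)
  then show ?thesis by (simp add: fun_eq_iff)
qed

text \<open>
  The range contains the kernels \<open>hk x\<close> with \<open>x > t\<close>, in particular those with \<open>x > 1\<close>.
\<close>
lemma translation_dense:
  assumes t: "0 \<le> t" "t < 1" and f: "f \<in> hcarrier HA" and e: "e > 0"
  shows "\<exists>g\<in>hcarrier HA. hnorm HA (\<lambda>x. f x - affine_op 1 t g x) < e"
proof -
  let ?D = "affine_op 1 t ` hcarrier HA"
  let ?M = "{f \<in> hcarrier HA. \<forall>e>0. \<exists>g\<in>?D. hnorm HA (\<lambda>x. f x - g x) < e}"
  have "?M = hcarrier HA"
  proof (rule hk_dense)
    show "A.closed_subspace ?M"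
    proof (rule A.closure_closed_subspace)
      fix f g c d assume "f \<in> ?D" "g \<in> ?D"
      then obtain u v where uv: "u \<in> hcarrier HA" "v \<in> hcarrier HA" "f = affine_op 1 t u" "g = affine_op 1 t v" by auto
      have "(\<lambda>x. c * f x + d * g x) = affine_op 1 t (\<lambda>x. c * u x + d * v x)" by (simp add: affine_op_comb uv)
      then show "(\<lambda>x. c * f x + d * g x) \<in> ?D" using uv A.C_lin by blast
    qed (use translation_in t in auto)
    fix x :: real assume x: "x > 1"
    have "hk x = affine_op 1 t (hk (x - t))" using x t by (simp add: affine_op_hk)
    moreover have "hk (x - t) \<in> hcarrier HA" using x t by (intro hk_in) auto
    ultimately have "hk x \<in> ?D" by blast
    then have "\<exists>g\<in>?D. hnorm HA (\<lambda>z. hk x z - g z) < e" if "e > 0" for e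
      using that by (intro bexI[of _ "hk x"]) simp_all
    then show "hk x \<in> ?M" using hk_in x by simp
  qed
  then show ?thesis using f e by blast
qed

section \<open>Splitting off the constants\<close>

abbreviation "HK \<equiv> H2 (\<beta>\<^sub>w \<alpha>)"

lemma gamma_sq_Suc: "(\<gamma>\<^sub>w \<alpha> (Suc j))\<^sup>2 = (\<gamma>\<^sub>w \<alpha> j)\<^sup>2 * ((1 + real j) / (s + real j))"
  unfolding gamma_sq pochhammer_Suc fact_Suc times_divide_times_eq by (simp only: of_nat_Suc mult.commute)

lemma gamma_dec: "\<gamma>\<^sub>w \<alpha> (Suc j) \<le> \<gamma>\<^sub>w \<alpha> j"
proof (rule power2_le_imp_le)
  have "(1 + real j) / (s + real j) \<le> 1" using s_gt_1 by simp
  then show "(\<gamma>\<^sub>w \<alpha> (Suc j))\<^sup>2 \<le> (\<gamma>\<^sub>w \<alpha> j)\<^sup>2"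
    unfolding gamma_sq_Suc by (rule mult_left_le) simp
qed (use gamma_pos[of j] in simp)

lemma gamma_0: "\<gamma>\<^sub>w \<alpha> 0 = 1"
proof -
  have "(\<gamma>\<^sub>w \<alpha> 0)\<^sup>2 = 1" by (simp add: gamma_sq)
  then show ?thesis using gamma_pos[of 0] by (simp add: power2_eq_1_iff)
qed

lemma beta_mono: "\<beta>\<^sub>w \<alpha> n \<le> \<beta>\<^sub>w \<alpha> (Suc n)"
proof (cases n)
  case (Suc j)
  then show ?thesis using gamma_dec[of j] gamma_pos[of "Suc j"] by (simp only: beta_Suc frac_le)
qed (simp add: beta_0 beta_Suc gamma_0)

text \<open>
  Together with \<open>beta_mono\<close>, this makes multiplication by \<open>z\<close> an isomorphism onto the functions that vanish
  at \<open>0\<close>.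
\<close>
lemma beta_Suc_le: "(\<beta>\<^sub>w \<alpha> (Suc n))\<^sup>2 \<le> s * (\<beta>\<^sub>w \<alpha> n)\<^sup>2"
proof (cases n)
  case 0
  then show ?thesis using s_gt_1 by (simp add: beta_0 beta_Suc gamma_0)
next
  case (Suc j)
  define g where "g = (\<gamma>\<^sub>w \<alpha> j)\<^sup>2"
  have g: "g > 0" using gamma_pos[of j] by (simp add: g_def)
  have "1 * real j \<le> s * real j" using s_gt_1 by (intro mult_right_mono) auto
  then have "(s + real j) / (1 + real j) \<le> s" by (simp add: divide_le_eq distrib_left)
  then have "(s + real j) / (1 + real j) / g \<le> s / g" using g by (intro divide_right_mono) auto
  moreover have "(\<beta>\<^sub>w \<alpha> (Suc n))\<^sup>2 = (s + real j) / (1 + real j) / g"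
    unfolding Suc beta_Suc power_divide gamma_sq_Suc g_def[symmetric] by (simp add: mult.commute)
  moreover have "(\<beta>\<^sub>w \<alpha> n)\<^sup>2 = 1 / g"
    unfolding Suc beta_Suc power_divide g_def[symmetric] by simp
  ultimately show ?thesis by simp
qed

text \<open>
  The unitary of the theorem on Taylor coefficients; \<open>\<gamma>(j) / \<beta>(j + 1) = \<gamma>(j)\<^sup>2\<close>.
\<close>
definition V :: "(complex \<Rightarrow> complex) \<Rightarrow> complex \<Rightarrow> complex" where
  "V f = power_fun (\<lambda>n. case n of 0 \<Rightarrow> 0 | Suc j \<Rightarrow> of_real ((\<gamma>\<^sub>w \<alpha> j)\<^sup>2) * taylor_coeff f j)"

text \<open>
  The adjoint of \<open>V\<close>, extended by \<open>0\<close> to the constants.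
\<close>
definition V_inv :: "(complex \<Rightarrow> complex) \<Rightarrow> complex \<Rightarrow> complex" where
  "V_inv g = power_fun (\<lambda>j. taylor_coeff g (Suc j) / of_real ((\<gamma>\<^sub>w \<alpha> j)\<^sup>2))"

lemma
  assumes f: "f \<in> hcarrier HA"
  shows V_in: "V f \<in> hcarrier HK"
    and taylor_V: "taylor_coeff (V f) n = (case n of 0 \<Rightarrow> 0 | Suc j \<Rightarrow> of_real ((\<gamma>\<^sub>w \<alpha> j)\<^sup>2) * taylor_coeff f j)"
proof -
  let ?a = "\<lambda>n. case n of 0 \<Rightarrow> 0 | Suc j \<Rightarrow> of_real ((\<gamma>\<^sub>w \<alpha> j)\<^sup>2) * taylor_coeff f j"
  have "(cmod (?a (Suc n)))\<^sup>2 * (\<beta>\<^sub>w \<alpha> (Suc n))\<^sup>2 = (cmod (taylor_coeff f n))\<^sup>2 * (\<gamma>\<^sub>w \<alpha> n)\<^sup>2" for n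
    using gamma_pos[of n] by (simp add: beta_Suc norm_mult power_mult_distrib power_divide norm_power)
      (simp add: power2_eq_square power4_eq_xxxx)
  moreover have "summable (\<lambda>n. (cmod (taylor_coeff f n))\<^sup>2 * (\<gamma>\<^sub>w \<alpha> n)\<^sup>2)" using f by (simp add: A.carrier_iff)
  ultimately have "summable (\<lambda>n. (cmod (?a (Suc n)))\<^sup>2 * (\<beta>\<^sub>w \<alpha> (Suc n))\<^sup>2)" by (simp only:)
  then have "summable (\<lambda>n. (cmod (?a n))\<^sup>2 * (\<beta>\<^sub>w \<alpha> n)\<^sup>2)"
    by (subst (asm) summable_Suc_iff[of "\<lambda>n. (cmod (?a n))\<^sup>2 * (\<beta>\<^sub>w \<alpha> n)\<^sup>2"])
  then show "V f \<in> hcarrier HK" "taylor_coeff (V f) n = ?a n"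
    unfolding V_def by (rule B.power_fun_in, rule B.taylor_power_fun)
qed

lemma
  assumes f: "f \<in> hcarrier HK"
  shows V_inv_in: "V_inv f \<in> hcarrier HA"
    and taylor_V_inv: "taylor_coeff (V_inv f) j = taylor_coeff f (Suc j) / of_real ((\<gamma>\<^sub>w \<alpha> j)\<^sup>2)"
proof -
  let ?a = "\<lambda>j. taylor_coeff f (Suc j) / of_real ((\<gamma>\<^sub>w \<alpha> j)\<^sup>2)"
  have "(cmod (?a n))\<^sup>2 * (\<gamma>\<^sub>w \<alpha> n)\<^sup>2 = (cmod (taylor_coeff f (Suc n)))\<^sup>2 * (\<beta>\<^sub>w \<alpha> (Suc n))\<^sup>2" for n
    using gamma_pos[of n] by (simp add: beta_Suc norm_divide power_divide norm_power)
      (simp add: power2_eq_square power4_eq_xxxx)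
  moreover have "summable (\<lambda>n. (cmod (taylor_coeff f (Suc n)))\<^sup>2 * (\<beta>\<^sub>w \<alpha> (Suc n))\<^sup>2)"
    using f by (subst summable_Suc_iff[of "\<lambda>n. (cmod (taylor_coeff f n))\<^sup>2 * (\<beta>\<^sub>w \<alpha> n)\<^sup>2"]) (simp add: B.carrier_iff)
  ultimately have "summable (\<lambda>n. (cmod (?a n))\<^sup>2 * (\<gamma>\<^sub>w \<alpha> n)\<^sup>2)" by (simp only:)
  then show "V_inv f \<in> hcarrier HA" "taylor_coeff (V_inv f) j = ?a j"
    unfolding V_inv_def by (rule A.power_fun_in, rule A.taylor_power_fun)
qed

lemma taylor_coeff_0: "taylor_coeff f 0 = f 0"
  by (simp add: taylor_coeff_def)

lemma V_at_0: "f \<in> hcarrier HA \<Longrightarrow> V f 0 = 0"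
  using taylor_V[of f 0] by (simp add: taylor_coeff_0)

lemma V_comb:
  assumes "f \<in> hcarrier HA" "g \<in> hcarrier HA"
  shows "V (\<lambda>x. c * f x + d * g x) = (\<lambda>x. c * V f x + d * V g x)"
proof (rule B.taylor_eqI)
  fix n show "taylor_coeff (V (\<lambda>x. c * f x + d * g x)) n = taylor_coeff (\<lambda>x. c * V f x + d * V g x) n"
    using assms by (simp add: taylor_V A.C_lin B.taylor_comb V_in A.taylor_comb algebra_simps split: nat.split)
qed (use assms in \<open>auto intro!: V_in A.C_lin B.C_lin\<close>)

lemma V_inv_comb:
  assumes "f \<in> hcarrier HK" "g \<in> hcarrier HK"
  shows "V_inv (\<lambda>x. c * f x + d * g x) = (\<lambda>x. c * V_inv f x + d * V_inv g x)"
proof (rule A.taylor_eqI)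
  fix n show "taylor_coeff (V_inv (\<lambda>x. c * f x + d * g x)) n = taylor_coeff (\<lambda>x. c * V_inv f x + d * V_inv g x) n"
    using assms by (simp add: taylor_V_inv B.C_lin A.taylor_comb V_inv_in B.taylor_comb add_divide_distrib)
qed (use assms in \<open>auto intro!: V_inv_in A.C_lin B.C_lin\<close>)

lemma V_inv_V: "f \<in> hcarrier HA \<Longrightarrow> V_inv (V f) = f"
  using gamma_pos by (intro A.taylor_eqI[OF V_inv_in[OF V_in]]) (simp_all add: taylor_V_inv taylor_V V_in less_imp_neq[symmetric])

lemma HK_eqI:
  assumes f: "f \<in> hcarrier HK" and g: "g \<in> hcarrier HK" and "f 0 = g 0" "V_inv f = V_inv g"
  shows "f = g"
proof (rule B.taylor_eqI[OF f g])
  fix n show "taylor_coeff f n = taylor_coeff g n"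
  proof (cases n)
    case (Suc j)
    have "taylor_coeff (V_inv f) j = taylor_coeff (V_inv g) j" using assms by simp
    then show ?thesis using gamma_pos[of j] by (simp add: taylor_V_inv f g Suc)
  qed (simp add: taylor_coeff_0 assms)
qed

lemma inner_HK:
  assumes f: "f \<in> hcarrier HK" and g: "g \<in> hcarrier HK"
  shows "hinner HK f g = f 0 * cnj (g 0) + hinner HA (V_inv f) (V_inv g)"
proof (rule sums_unique2[OF B.inner_sums[OF f g]])
  let ?t = "\<lambda>n. taylor_coeff f n * cnj (taylor_coeff g n) * of_real ((\<beta>\<^sub>w \<alpha> n)\<^sup>2)"
  have "?t (Suc n) = taylor_coeff (V_inv f) n * cnj (taylor_coeff (V_inv g) n) * of_real ((\<gamma>\<^sub>w \<alpha> n)\<^sup>2)" for n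
    using gamma_pos[of n] by (simp add: taylor_V_inv f g beta_Suc power_divide)
      (simp add: power2_eq_square power4_eq_xxxx)
  then have "(\<lambda>n. ?t (Suc n)) sums hinner HA (V_inv f) (V_inv g)"
    using A.inner_sums[OF V_inv_in[OF f] V_inv_in[OF g]] by (simp only:)
  then have "?t sums (hinner HA (V_inv f) (V_inv g) + ?t 0)" by (subst (asm) sums_Suc_iff) simp
  then show "?t sums (f 0 * cnj (g 0) + hinner HA (V_inv f) (V_inv g))"
    by (simp add: taylor_coeff_0 beta_0 add.commute)
qed

abbreviation one :: "complex \<Rightarrow> complex" where "one \<equiv> B.monom_fun 0"

text \<open>
  By \<open>inner_HK\<close> the map \<open>(c, h) \<mapsto> glue c h\<close> is unitary from the orthogonal sum of the complex numbers and the
  Bergman space onto the weighted Hardy space; its inverse is \<open>f \<mapsto> (f 0, V_inv f)\<close>.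
\<close>
definition glue :: "complex \<Rightarrow> (complex \<Rightarrow> complex) \<Rightarrow> complex \<Rightarrow> complex" where
  "glue c h = (\<lambda>z. c * one z + V h z)"

lemma one_at_0: "one 0 = 1" by (simp add: B.monom_fun_def on_disk_def)

lemma V_inv_one: "V_inv one = (\<lambda>_. 0)"
proof (rule A.taylor_eqI)
  fix n show "taylor_coeff (V_inv one) n = taylor_coeff (\<lambda>_. 0) n"
    using taylor_coeff_unique(2)[of "\<lambda>_. 0" "\<lambda>_. 0" n] by (simp add: taylor_V_inv B.monom_in B.taylor_monom)
qed (simp_all add: V_inv_in B.monom_in A.zero_in)

lemma glue_in: "h \<in> hcarrier HA \<Longrightarrow> glue c h \<in> hcarrier HK"
  unfolding glue_def by (intro B.C_add B.C_scale B.monom_in V_in)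

lemma glue_at_0: "h \<in> hcarrier HA \<Longrightarrow> glue c h 0 = c"
  by (simp add: glue_def one_at_0 V_at_0)

lemma V_inv_glue: "h \<in> hcarrier HA \<Longrightarrow> V_inv (glue c h) = h"
  using V_inv_comb[OF B.monom_in V_in, of h c 0 1] by (simp add: glue_def V_inv_one V_inv_V)

lemma glue_decomp: "f \<in> hcarrier HK \<Longrightarrow> glue (f 0) (V_inv f) = f"
  by (rule HK_eqI) (simp_all add: glue_in V_inv_in glue_at_0 V_inv_glue)

text \<open>
  The orthogonal sum of the identity on the constants and \<open>V S V\<^sup>*\<close>.
\<close>
definition lift :: "((complex \<Rightarrow> complex) \<Rightarrow> complex \<Rightarrow> complex) \<Rightarrow> (complex, complex) fun_op" where
  "lift S = (\<lambda>f\<in>hcarrier HK. glue (f 0) (S (V_inv f)))"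

lemma lift_in: "A.bounded_linear_on S \<Longrightarrow> f \<in> hcarrier HK \<Longrightarrow> lift S f \<in> hcarrier HK"
  by (simp add: lift_def glue_in V_inv_in A.bounded_linear_on_in)

lemma lift_at_0: "A.bounded_linear_on S \<Longrightarrow> f \<in> hcarrier HK \<Longrightarrow> lift S f 0 = f 0"
  by (simp add: lift_def glue_at_0 V_inv_in A.bounded_linear_on_in)

lemma V_inv_lift: "A.bounded_linear_on S \<Longrightarrow> f \<in> hcarrier HK \<Longrightarrow> V_inv (lift S f) = S (V_inv f)"
  by (simp add: lift_def V_inv_glue V_inv_in A.bounded_linear_on_in)

lemma lift_cong: "(\<And>f. f \<in> hcarrier HA \<Longrightarrow> S f = T f) \<Longrightarrow> lift S = lift T"
  unfolding lift_def by (intro restrict_ext) (simp add: V_inv_in)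

lemma lift_compose:
  assumes "A.bounded_linear_on S" "A.bounded_linear_on T"
  shows "compose (hcarrier HK) (lift S) (lift T) = lift (\<lambda>f. S (T f))"
  unfolding compose_def lift_def[of "\<lambda>f. S (T f)"]
  by (intro restrict_ext) (use assms in \<open>simp add: lift_def glue_in glue_at_0 V_inv_glue V_inv_in A.bounded_linear_on_in\<close>)

lemma lift_inner:
  assumes "A.bounded_linear_on S" "f \<in> hcarrier HK" "g \<in> hcarrier HK"
  shows "hinner HK (lift S f) g = f 0 * cnj (g 0) + hinner HA (S (V_inv f)) (V_inv g)"
  using assms by (simp add: inner_HK lift_in lift_at_0 V_inv_lift)

lemma norm_HK: "f \<in> hcarrier HK \<Longrightarrow> (hnorm HK f)\<^sup>2 = (cmod (f 0))\<^sup>2 + (hnorm HA (V_inv f))\<^sup>2"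
  by (simp add: B.norm_sq inner_HK A.norm_sq V_inv_in complex_norm_square[symmetric] del: complex_mult_cnj of_real_power)

lemma lift_adjoint:
  assumes "A.bounded_linear_on S" "A.bounded_linear_on T" "f \<in> hcarrier HK" "g \<in> hcarrier HK"
    and "\<And>u v. u \<in> hcarrier HA \<Longrightarrow> v \<in> hcarrier HA \<Longrightarrow> hinner HA (S u) v = hinner HA u (T v)"
  shows "hinner HK (lift S f) g = hinner HK f (lift T g)"
  using assms by (simp add: lift_inner inner_HK lift_in lift_at_0 V_inv_lift V_inv_in)

lemma lift_bounded:
  assumes S: "A.bounded_linear_on S" shows "lift S \<in> bounded_ops HK HK"
proof -
  obtain c where c: "c \<ge> 0" "\<And>f. f \<in> hcarrier HA \<Longrightarrow> hnorm HA (S f) \<le> c * hnorm HA f"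
    using A.bounded_linear_on_bound[OF S] by auto
  show ?thesis
  proof (rule bounded_opsI)
    show "linear_on (hcarrier HK) (lift S)"
      unfolding linear_on_def
    proof (intro ballI allI)
      fix f g c d assume f: "f \<in> hcarrier HK" and g: "g \<in> hcarrier HK"
      have fg: "(\<lambda>x. c * f x + d * g x) \<in> hcarrier HK" using f g by (rule B.C_lin)
      have i: "(\<lambda>y. c * lift S f y + d * lift S g y) \<in> hcarrier HK" using S f g by (intro B.C_lin lift_in)
      show "lift S (\<lambda>x. c * f x + d * g x) = (\<lambda>y. c * lift S f y + d * lift S g y)"
      proof (rule HK_eqI[OF lift_in[OF S fg] i])
        show "lift S (\<lambda>x. c * f x + d * g x) 0 = c * lift S f 0 + d * lift S g 0"
          using lift_at_0[OF S fg] lift_at_0[OF S f] lift_at_0[OF S g] by simp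
        show "V_inv (lift S (\<lambda>x. c * f x + d * g x)) = V_inv (\<lambda>y. c * lift S f y + d * lift S g y)"
          using linear_onD[OF A.bounded_linear_on_linear[OF S] V_inv_in[OF f] V_inv_in[OF g]]
          by (simp add: V_inv_lift[OF S fg] V_inv_lift[OF S f] V_inv_lift[OF S g] V_inv_comb f g lift_in[OF S])
      qed
    qed
    fix f assume f: "f \<in> hcarrier HK"
    show "hnorm HK (lift S f) \<le> (c + 1) * hnorm HK f"
    proof (rule power2_le_imp_le)
      have "(hnorm HA (S (V_inv f)))\<^sup>2 \<le> (c * hnorm HA (V_inv f))\<^sup>2"
        using c V_inv_in[OF f] A.norm_nonneg[OF A.bounded_linear_on_in[OF S V_inv_in[OF f]]] by (intro power_mono) auto
      also have "\<dots> \<le> ((c + 1) * hnorm HA (V_inv f))\<^sup>2"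
        using c A.norm_nonneg[OF V_inv_in[OF f]] by (intro power_mono mult_right_mono) auto
      finally have 1: "(hnorm HA (S (V_inv f)))\<^sup>2 \<le> (c + 1)\<^sup>2 * (hnorm HA (V_inv f))\<^sup>2" by (simp add: power_mult_distrib)
      have "1 * (cmod (f 0))\<^sup>2 \<le> (c + 1)\<^sup>2 * (cmod (f 0))\<^sup>2"
        using c by (intro mult_right_mono) auto
      with 1 show "(hnorm HK (lift S f))\<^sup>2 \<le> ((c + 1) * hnorm HK f)\<^sup>2"
        by (simp add: norm_HK f lift_in[OF S] lift_at_0[OF S] V_inv_lift[OF S] power_mult_distrib distrib_left)
      show "0 \<le> (c + 1) * hnorm HK f" using c B.norm_nonneg[OF f] by simp
    qed
  qed (use lift_in[OF S] in \<open>auto simp: lift_def\<close>)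
qed

lemma lift_positive:
  assumes S: "A.bounded_linear_on S"
    and pos: "\<And>f. f \<in> hcarrier HA \<Longrightarrow> \<exists>r\<ge>0. hinner HA (S f) f = of_real r"
  shows "positive_op HK (lift S)"
  unfolding positive_op_def
proof (intro conjI ballI lift_bounded[OF S])
  fix f assume f: "f \<in> hcarrier HK"
  obtain r where r: "r \<ge> 0" "hinner HA (S (V_inv f)) (V_inv f) = of_real r" using pos V_inv_in[OF f] by blast
  have "hinner HK (lift S f) f = of_real ((cmod (f 0))\<^sup>2 + r)"
    by (simp add: lift_inner[OF S f f] r complex_norm_square[symmetric] del: complex_mult_cnj)
  then show "hinner HK (lift S f) f \<in> \<real>" "0 \<le> Re (hinner HK (lift S f) f)"
    using r by (simp_all del: of_real_add)
qed

lemma lift_isometric: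
  assumes S: "A.bounded_linear_on S" and iso: "\<And>f. f \<in> hcarrier HA \<Longrightarrow> hnorm HA (S f) = hnorm HA f"
    and f: "f \<in> hcarrier HK"
  shows "hnorm HK (lift S f) = hnorm HK f"
proof -
  have "(hnorm HK (lift S f))\<^sup>2 = (hnorm HK f)\<^sup>2"
    by (simp add: norm_HK f lift_in[OF S] lift_at_0[OF S] V_inv_lift[OF S] iso V_inv_in)
  then show ?thesis using B.norm_nonneg[OF f] B.norm_nonneg[OF lift_in[OF S f]] by simp
qed

lemma lift_injective:
  assumes S: "A.bounded_linear_on S" and inj: "\<And>f. f \<in> hcarrier HA \<Longrightarrow> S f = (\<lambda>_. 0) \<Longrightarrow> f = (\<lambda>_. 0)"
    and f: "f \<in> hcarrier HK" and 0: "lift S f = (\<lambda>_. 0)"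
  shows "f = (\<lambda>_. 0)"
proof -
  have W0: "V_inv (\<lambda>_. 0) = (\<lambda>_. 0)" using V_inv_comb[OF f f, of 0 0] by simp
  have "f 0 = 0" using lift_at_0[OF S f] 0 by simp
  moreover have "V_inv f = (\<lambda>_. 0)"
  proof (rule inj[OF V_inv_in[OF f]])
    show "S (V_inv f) = (\<lambda>_. 0)" unfolding V_inv_lift[OF S f, symmetric] 0 W0 ..
  qed
  ultimately show ?thesis using W0 by (intro HK_eqI[OF f B.zero_in]) simp_all
qed

lemma lift_dense:
  assumes S: "A.bounded_linear_on S"
    and dense: "\<And>f e. f \<in> hcarrier HA \<Longrightarrow> e > 0 \<Longrightarrow> \<exists>g\<in>hcarrier HA. hnorm HA (\<lambda>x. f x - S g x) < e"
    and f: "f \<in> hcarrier HK" and e: "e > 0"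
  shows "\<exists>g\<in>hcarrier HK. hnorm HK (\<lambda>x. f x - lift S g x) < e"
proof -
  obtain g where g: "g \<in> hcarrier HA" and ge: "hnorm HA (\<lambda>x. V_inv f x - S g x) < e"
    using dense[OF V_inv_in[OF f] e] by (elim bexE)
  define h where "h = glue (f 0) g"
  have h: "h \<in> hcarrier HK" "h 0 = f 0" "V_inv h = g" using g by (simp_all add: h_def glue_in glue_at_0 V_inv_glue)
  have d: "(\<lambda>x. f x - lift S h x) \<in> hcarrier HK" by (intro B.C_diff f lift_in[OF S h(1)])
  have Wd: "V_inv (\<lambda>x. f x - lift S h x) = (\<lambda>x. V_inv f x - S g x)"
    using V_inv_comb[OF f lift_in[OF S h(1)], of 1 "-1"] by (simp only: V_inv_lift[OF S h(1)] h(3)) simp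
  have "(hnorm HK (\<lambda>x. f x - lift S h x))\<^sup>2 = (hnorm HA (\<lambda>x. V_inv f x - S g x))\<^sup>2"
    unfolding norm_HK[OF d] Wd lift_at_0[OF S h(1)] h(2) by simp
  moreover have "0 \<le> hnorm HA (\<lambda>x. V_inv f x - S g x)"
    by (intro A.norm_nonneg A.C_diff V_inv_in f A.bounded_linear_on_in[OF S] g)
  ultimately have "hnorm HK (\<lambda>x. f x - lift S h x) = hnorm HA (\<lambda>x. V_inv f x - S g x)"
    by (rule power2_eq_imp_eq[OF _ B.norm_nonneg[OF d]])
  then show ?thesis using ge by (intro bexI[OF _ h(1)]) simp
qed

text \<open>
  Multiplication by \<open>z\<close> and its inverse are bounded because consecutive weights are comparable.
\<close>
lemma zH2_carrier: "hcarrier (zH2 (\<beta>\<^sub>w \<alpha>)) = {f \<in> hcarrier HK. f 0 = 0}"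
proof (intro set_eqI iffI)
  fix f assume "f \<in> hcarrier (zH2 (\<beta>\<^sub>w \<alpha>))"
  then obtain g where g: "g \<in> hcarrier HK" and f: "f = (\<lambda>z. z * g z)" by (auto simp: zH2_def)
  have "(\<beta>\<^sub>w \<alpha> (Suc n))\<^sup>2 \<le> (sqrt s)\<^sup>2 * (\<beta>\<^sub>w \<alpha> n)\<^sup>2" for n
    using beta_Suc_le[of n] s_gt_1 by simp
  from B.mult_z_in(1)[OF this _ g] have "f \<in> hcarrier HK" using s_gt_1 by (simp add: f)
  then show "f \<in> {f \<in> hcarrier HK. f 0 = 0}" using f by simp
next
  fix f assume "f \<in> {f \<in> hcarrier HK. f 0 = 0}"
  then have f: "f \<in> hcarrier HK" "f 0 = 0" by auto
  let ?a = "\<lambda>n. taylor_coeff f (Suc n)"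
  have "summable (\<lambda>n. (cmod (?a n))\<^sup>2 * (\<beta>\<^sub>w \<alpha> (Suc n))\<^sup>2)"
    using f by (subst summable_Suc_iff[of "\<lambda>n. (cmod (taylor_coeff f n))\<^sup>2 * (\<beta>\<^sub>w \<alpha> n)\<^sup>2"]) (simp add: B.carrier_iff)
  then have s: "summable (\<lambda>n. (cmod (?a n))\<^sup>2 * (\<beta>\<^sub>w \<alpha> n)\<^sup>2)"
  proof (rule summable_comparison_test')
    fix n :: nat
    have "(\<beta>\<^sub>w \<alpha> n)\<^sup>2 \<le> (\<beta>\<^sub>w \<alpha> (Suc n))\<^sup>2" using beta_mono beta_pos[of n] by (intro power_mono) auto
    then show "norm ((cmod (?a n))\<^sup>2 * (\<beta>\<^sub>w \<alpha> n)\<^sup>2) \<le> (cmod (?a n))\<^sup>2 * (\<beta>\<^sub>w \<alpha> (Suc n))\<^sup>2"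
      by (simp add: mult_left_mono)
  qed
  have "f = (\<lambda>z. z * power_fun ?a z)"
  proof
    fix z show "f z = z * power_fun ?a z"
    proof (cases "cmod z < 1")
      case True
      have "(\<lambda>n. ?a n * z ^ Suc n) sums (z * power_fun ?a z)"
        using sums_mult[OF B.power_fun_sums[OF s True], of z] by (simp add: mult_ac)
      moreover have "(\<lambda>n. ?a n * z ^ Suc n) sums f z"
        using B.taylor_sums[OF f(1) True] f(2)
        by (subst sums_Suc_iff[of "\<lambda>n. taylor_coeff f n * z ^ n"]) (simp add: taylor_coeff_0)
      ultimately show ?thesis by (rule sums_unique2[THEN sym])
    qed (simp add: B.outside_disk f B.outside_disk[OF B.power_fun_in[OF s]])
  qed
  then show "f \<in> hcarrier (zH2 (\<beta>\<^sub>w \<alpha>))" using B.power_fun_in[OF s] by (auto simp: zH2_def)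
qed

lemma zH2_eq_V_image: "hcarrier (zH2 (\<beta>\<^sub>w \<alpha>)) = V ` hcarrier HA"
proof (intro set_eqI iffI)
  fix f assume "f \<in> hcarrier (zH2 (\<beta>\<^sub>w \<alpha>))"
  then have f: "f \<in> hcarrier HK" "f 0 = 0" by (auto simp: zH2_carrier)
  have "f = V (V_inv f)" using glue_decomp[OF f(1)] f(2) by (simp add: glue_def)
  then show "f \<in> V ` hcarrier HA" using V_inv_in f by blast
qed (auto simp: zH2_carrier V_in V_at_0)

lemma inner_V: "f \<in> hcarrier HA \<Longrightarrow> g \<in> hcarrier HK \<Longrightarrow> hinner HK (V f) g = hinner HA f (V_inv g)"
  by (simp add: inner_HK V_in V_at_0 V_inv_V)

lemma hinner_zH2: "hinner (zH2 \<beta>) = hinner (H2 \<beta>)" and hnorm_zH2: "hnorm (zH2 \<beta>) = hnorm (H2 \<beta>)"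
  by (auto simp: zH2_def hnorm_def fun_eq_iff)

lemma norm_V: "f \<in> hcarrier HA \<Longrightarrow> hnorm HK (V f) = hnorm HA f"
  by (simp add: hnorm_def inner_V V_in V_inv_V)

lemma unitary_V: "unitary_op HA (zH2 (\<beta>\<^sub>w \<alpha>)) (restrict V (hcarrier HA))"
proof -
  have "restrict V (hcarrier HA) \<in> bounded_ops HA (zH2 (\<beta>\<^sub>w \<alpha>))"
    by (rule bounded_opsI[where c = 1])
      (auto simp: zH2_eq_V_image linear_on_def V_comb A.C_lin hnorm_zH2 norm_V)
  then show ?thesis
    unfolding unitary_op_def by (auto simp: zH2_eq_V_image hinner_zH2 inner_V V_in V_inv_V)
qed

lemma V_monom: "V (A.monom_fun j) = on_disk (\<lambda>z. of_real (\<gamma>\<^sub>w \<alpha> j / \<beta>\<^sub>w \<alpha> (j + 1)) * z ^ (j + 1))"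
proof -
  have m: "(\<lambda>z. of_real ((\<gamma>\<^sub>w \<alpha> j)\<^sup>2) * B.monom_fun (Suc j) z) \<in> hcarrier HK"
    by (intro B.C_scale B.monom_in)
  have "V (A.monom_fun j) = (\<lambda>z. of_real ((\<gamma>\<^sub>w \<alpha> j)\<^sup>2) * B.monom_fun (Suc j) z)"
  proof (rule B.taylor_eqI[OF V_in[OF A.monom_in] m])
    fix n
    have "taylor_coeff (\<lambda>z. of_real ((\<gamma>\<^sub>w \<alpha> j)\<^sup>2) * B.monom_fun (Suc j) z) n =
        of_real ((\<gamma>\<^sub>w \<alpha> j)\<^sup>2) * taylor_coeff (B.monom_fun (Suc j)) n"
      using B.taylor_comb[OF B.monom_in B.monom_in, of "of_real ((\<gamma>\<^sub>w \<alpha> j)\<^sup>2)" "Suc j" 0 0 n] by simp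
    then show "taylor_coeff (V (A.monom_fun j)) n = taylor_coeff (\<lambda>z. of_real ((\<gamma>\<^sub>w \<alpha> j)\<^sup>2) * B.monom_fun (Suc j) z) n"
      by (simp add: taylor_V A.monom_in A.taylor_monom split: nat.split)
  qed
  then show ?thesis
    by (auto simp: beta_Suc B.monom_fun_def on_disk_def power2_eq_square)
qed

text \<open>
  A unitary with the prescribed values agrees with \<open>V\<close> on the monomials, hence everywhere.
\<close>
lemma V_op_eq: "V_op \<alpha> = restrict V (hcarrier HA)"
  unfolding V_op_def weighted_bergman_def
proof (rule the_equality)
  show "unitary_op HA (zH2 (\<beta>\<^sub>w \<alpha>)) (restrict V (hcarrier HA)) \<and>
     (\<forall>j. restrict V (hcarrier HA) (on_disk (\<lambda>z. z ^ j)) =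
        on_disk (\<lambda>z. of_real (\<gamma>\<^sub>w \<alpha> j / \<beta>\<^sub>w \<alpha> (j + 1)) * z ^ (j + 1)))"
    using unitary_V A.monom_in V_monom by (simp add: A.monom_fun_def)
next
  fix Y assume Y: "unitary_op HA (zH2 (\<beta>\<^sub>w \<alpha>)) Y \<and>
     (\<forall>j. Y (on_disk (\<lambda>z. z ^ j)) = on_disk (\<lambda>z. of_real (\<gamma>\<^sub>w \<alpha> j / \<beta>\<^sub>w \<alpha> (j + 1)) * z ^ (j + 1)))"
  then have b: "Y \<in> bounded_ops HA (zH2 (\<beta>\<^sub>w \<alpha>))"
    and iso: "\<And>f. f \<in> hcarrier HA \<Longrightarrow> hnorm HK (Y f) = hnorm HA f"
    by (auto simp: unitary_op_def hinner_zH2 hnorm_def)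
  have mon: "Y (A.monom_fun j) = V (A.monom_fun j)" for j
    unfolding V_monom using Y by (simp only: A.monom_fun_def)
  have Yi: "Y f \<in> hcarrier HK" if "f \<in> hcarrier HA" for f
    using bounded_opsD(1)[OF b that] by (simp add: zH2_carrier)
  note Yl = bounded_opsD(2)[OF b]
  have "{f \<in> hcarrier HA. Y f = V f} = hcarrier HA"
  proof (rule A.monomials_dense)
    show "A.closed_subspace {f \<in> hcarrier HA. Y f = V f}"
    proof (rule A.closed_subspaceI)
      fix f X assume f: "f \<in> hcarrier HA" and X: "\<And>k::nat. X k \<in> {f \<in> hcarrier HA. Y f = V f}"
        and lim: "(\<lambda>k. hnorm HA (\<lambda>x. X k x - f x)) \<longlonglongrightarrow> 0"
      have Xi: "X k \<in> hcarrier HA" and XV: "Y (X k) = V (X k)" for k using X by auto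
      have "Y f = V f"
      proof (rule B.limit_unique[where X = "\<lambda>k. V (X k)"])
        have "(\<lambda>x. V (X k) x - Y f x) = Y (\<lambda>x. X k x - f x)" for k
          using linear_on_diff[OF Yl Xi f] XV by simp
        then show "(\<lambda>k. hnorm HK (\<lambda>x. V (X k) x - Y f x)) \<longlonglongrightarrow> 0"
          using lim by (simp add: iso A.C_diff Xi f)
        have "(\<lambda>x. V (X k) x - V f x) = V (\<lambda>x. X k x - f x)" for k
          using V_comb[OF Xi f, of 1 k "-1"] by simp
        then show "(\<lambda>k. hnorm HK (\<lambda>x. V (X k) x - V f x)) \<longlonglongrightarrow> 0"
          using lim by (simp add: norm_V A.C_diff Xi f)
      qed (use Xi f Yi V_in in auto)
      then show "f \<in> {f \<in> hcarrier HA. Y f = V f}" using f by simp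
    qed (auto simp: A.C_lin V_comb linear_onD[OF Yl])
    show "A.monom_fun n \<in> {f \<in> hcarrier HA. Y f = V f}" for n using A.monom_in mon by simp
  qed
  then have "Y f = V f" if "f \<in> hcarrier HA" for f using that by blast
  then show "Y = restrict V (hcarrier HA)"
    using bounded_opsD(3)[OF b] by (intro extensionalityI[of _ "hcarrier HA"]) auto
qed

lemma adjoint_V_op: "adjoint_op HA (zH2 (\<beta>\<^sub>w \<alpha>)) (V_op \<alpha>) = restrict V_inv (hcarrier (zH2 (\<beta>\<^sub>w \<alpha>)))"
proof (rule A.adjoint_op_eqI)
  show "restrict V_inv (hcarrier (zH2 (\<beta>\<^sub>w \<alpha>))) g \<in> hcarrier HA" if "g \<in> hcarrier (zH2 (\<beta>\<^sub>w \<alpha>))" for g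
    using that by (simp add: zH2_carrier V_inv_in)
  show "hinner (zH2 (\<beta>\<^sub>w \<alpha>)) (V_op \<alpha> f) g = hinner HA f (restrict V_inv (hcarrier (zH2 (\<beta>\<^sub>w \<alpha>))) g)"
    if "f \<in> hcarrier HA" "g \<in> hcarrier (zH2 (\<beta>\<^sub>w \<alpha>))" for f g
    using that by (simp add: V_op_eq hinner_zH2 zH2_carrier inner_V)
qed simp

section \<open>Aluthge transforms of dilated translations\<close>

text \<open>
  The orthogonal sum of the identity on the constants and \<open>k U P\<^sub>t\<close>.
\<close>
definition model_op :: "real \<Rightarrow> real \<Rightarrow> real \<Rightarrow> (complex, complex) fun_op" where
  "model_op k a t = lift (\<lambda>f x. of_real k * affine_op a 0 (affine_op 1 t f) x)"

lemma scaled_translation_bounded: "t \<ge> 0 \<Longrightarrow> A.bounded_linear_on (\<lambda>f x. of_real k * affine_op 1 t f x)"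
  by (intro A.bounded_linear_on_scale translation_bounded)

lemma model_bounded: "a > 0 \<Longrightarrow> t \<ge> 0 \<Longrightarrow> A.bounded_linear_on (\<lambda>f x. of_real k * affine_op a 0 (affine_op 1 t f) x)"
  by (rule A.bounded_linear_on_scale[OF A.bounded_linear_on_compose[OF dilation_bounded translation_bounded]])

text \<open>
  \<open>\<langle>P\<^sub>t f, f\<rangle> = \<parallel>P\<^bsub>t/2\<^esub> f\<parallel>\<^sup>2\<close>.
\<close>
lemma scaled_translation_positive:
  assumes k: "k \<ge> 0" and t: "t \<ge> 0"
  shows "positive_op HK (lift (\<lambda>f x. of_real k * affine_op 1 t f x))"
proof (rule lift_positive[OF scaled_translation_bounded[OF t]])
  fix f assume f: "f \<in> hcarrier HA"
  have "hinner HA (\<lambda>x. of_real k * affine_op 1 t f x) f = of_real (k * (hnorm HA (affine_op 1 (t / 2) f))\<^sup>2)"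
    by (simp add: A.B_scale f translation_in t translation_pos)
  then show "\<exists>r\<ge>0. hinner HA (\<lambda>x. of_real k * affine_op 1 t f x) f = of_real r"
    using k by (intro exI[of _ "k * (hnorm HA (affine_op 1 (t / 2) f))\<^sup>2"]) simp
qed

text \<open>
  Here \<open>|T| = k P\<^sub>t\<close>, so the transform is \<open>k P\<^bsub>t/2\<^esub> U P\<^bsub>t/2\<^esub>\<close>, and moving \<open>U\<close> to the front turns the first
  translation into one by \<open>a t / 2\<close>. The bound \<open>t < 1\<close> is used for the density of the range of \<open>P\<^sub>t\<close>.
\<close>
lemma aluthge_model_op:
  assumes k: "k > 0" and a: "a > 0" and t: "0 \<le> t" "t < 1"
  shows "aluthge HK (model_op k a t) = model_op k a ((1 + a) / 2 * t)"
proof -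
  \<comment> \<open>On the Bergman space: \<open>R = |T|\<close>, \<open>Q = |T|\<^bsup>1/2\<^esup>\<close> and \<open>T' = T\<^sup>*\<close>.\<close>
  define R where "R = (\<lambda>f x. of_real k * affine_op 1 t f x)"
  define Q where "Q = (\<lambda>f x. of_real (sqrt k) * affine_op 1 (t / 2) f x)"
  define T where "T = (\<lambda>f x. of_real k * affine_op a 0 (affine_op 1 t f) x)"
  define T' where "T' = (\<lambda>f x. of_real k * affine_op 1 t (affine_op (1 / a) 0 f) x)"
  have a': "1 / a > 0" and t2: "t / 2 \<ge> 0" using a t by auto
  note bU = dilation_bounded[OF a]
  have bR: "A.bounded_linear_on R" and bQ: "A.bounded_linear_on Q"
    unfolding R_def Q_def using scaled_translation_bounded t by auto
  have bT: "A.bounded_linear_on T" unfolding T_def by (rule model_bounded[OF a t(1)])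
  have bT': "A.bounded_linear_on T'"
    unfolding T'_def
    by (rule A.bounded_linear_on_scale[OF A.bounded_linear_on_compose[OF translation_bounded[OF t(1)] dilation_bounded[OF a']]])
  have sk: "complex_of_real (sqrt k) * of_real (sqrt k) = of_real k"
    using k by (simp flip: of_real_mult)
  have "aluthge HK (lift T) = compose (hcarrier HK) (lift Q) (compose (hcarrier HK) (lift (affine_op a 0)) (lift Q))"
  proof (rule B.aluthge_eqI)
    show "lift (affine_op a 0) \<in> bounded_ops HK HK" by (rule lift_bounded[OF bU])
    show "hnorm HK (lift (affine_op a 0) f) = hnorm HK f" if "f \<in> hcarrier HK" for f
      by (rule lift_isometric[OF bU dilation_isometric[OF a] that])
    show "positive_op HK (lift R)"
      unfolding R_def by (rule scaled_translation_positive) (use k t in auto)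
    show "compose (hcarrier HK) (lift (affine_op a 0)) (lift R) = lift T"
      unfolding lift_compose[OF bU bR] by (rule lift_cong) (simp only: R_def T_def affine_op_scale)
    show "lift T' \<in> hcarrier HK \<rightarrow>\<^sub>E hcarrier HK"
      using lift_bounded[OF bT'] by (simp add: bounded_ops_def)
    show "compose (hcarrier HK) (lift T') (lift T) = compose (hcarrier HK) (lift R) (lift R)"
      unfolding lift_compose[OF bT' bT] lift_compose[OF bR bR]
      by (rule lift_cong) (simp only: R_def T_def T'_def affine_op_scale dilation_inverse[OF a] translation_in[OF t(1)])
    show "hinner HK (lift T f) g = hinner HK f (lift T' g)" if "f \<in> hcarrier HK" "g \<in> hcarrier HK" for f g
    proof (rule lift_adjoint[OF bT bT' that])
      fix u v assume u: "u \<in> hcarrier HA" and v: "v \<in> hcarrier HA"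
      have "hinner HA (T u) v = of_real k * hinner HA (affine_op a 0 (affine_op 1 t u)) v"
        unfolding T_def by (rule A.B_scale) (intro dilation_in[OF a] translation_in[OF t(1)] u v)+
      also have "\<dots> = of_real k * hinner HA u (affine_op 1 t (affine_op (1 / a) 0 v))"
        by (simp only: dilation_adjoint[OF a] translation_symmetric[OF t(1)] u v dilation_in[OF a'] translation_in[OF t(1)])
      also have "\<dots> = hinner HA u (T' v)"
        unfolding T'_def
        by (subst A.B_scale_right) (simp_all add: u v dilation_in[OF a'] translation_in[OF t(1)] del: times_divide_eq_left)
      finally show "hinner HA (T u) v = hinner HA u (T' v)" .
    qed
    have R0: "f = (\<lambda>_. 0)" if f: "f \<in> hcarrier HA" and 0: "R f = (\<lambda>_. 0)" for f
    proof (rule translation_inj[OF t(1) f])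
      show "affine_op 1 t f = (\<lambda>_. 0)" using 0 k by (simp add: R_def fun_eq_iff)
    qed
    show "f = (\<lambda>_. 0)" if "f \<in> hcarrier HK" "lift R f = (\<lambda>_. 0)" for f
      by (rule lift_injective[OF bR R0 that])
    have Rd: "\<exists>g\<in>hcarrier HA. hnorm HA (\<lambda>x. f x - R g x) < e" if f: "f \<in> hcarrier HA" and e: "e > 0" for f e
    proof -
      obtain g where g: "g \<in> hcarrier HA" "hnorm HA (\<lambda>x. f x - affine_op 1 t g x) < e"
        using translation_dense[OF t f e] by (elim bexE)
      define h where "h = (\<lambda>x. of_real (1 / k) * g x)"
      have "h \<in> hcarrier HA" unfolding h_def by (rule A.C_scale[OF g(1)])
      moreover have "R h = affine_op 1 t g"
        unfolding R_def h_def affine_op_scale using k by (simp add: fun_eq_iff)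
      ultimately show ?thesis using g(2) by (intro bexI[of _ h]) simp_all
    qed
    show "\<exists>g\<in>hcarrier HK. hnorm HK (\<lambda>x. f x - lift R g x) < e" if "f \<in> hcarrier HK" "0 < e" for f e
      by (rule lift_dense[OF bR Rd that])
    show "positive_op HK (lift Q)"
      unfolding Q_def by (rule scaled_translation_positive) (use k t in auto)
    show "compose (hcarrier HK) (lift Q) (lift Q) = lift R"
      unfolding lift_compose[OF bQ bQ]
    proof (rule lift_cong)
      fix f assume f: "f \<in> hcarrier HA"
      have "affine_op 1 (t / 2) (affine_op 1 (t / 2) f) = affine_op 1 t f" using translation_add[OF t2 t2 f] by simp
      then show "Q (Q f) = R f" unfolding Q_def R_def affine_op_scale by (simp only: mult.assoc[symmetric] sk)
    qed
  qed
  also have "\<dots> = lift (\<lambda>f. Q (affine_op a 0 (Q f)))"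
    by (simp only: lift_compose[OF bU bQ] lift_compose[OF bQ A.bounded_linear_on_compose[OF bU bQ]])
  also have "\<dots> = model_op k a ((1 + a) / 2 * t)"
    unfolding model_op_def
  proof (rule lift_cong)
    fix f assume f: "f \<in> hcarrier HA"
    have "affine_op 1 (t / 2) (affine_op a 0 (affine_op 1 (t / 2) f)) = affine_op a 0 (affine_op 1 (a * (t / 2)) (affine_op 1 (t / 2) f))"
      by (rule translation_dilation[OF a t2 translation_in[OF t2 f]])
    also have "affine_op 1 (a * (t / 2)) (affine_op 1 (t / 2) f) = affine_op 1 (a * (t / 2) + t / 2) f"
      by (rule translation_add[OF _ t2 f]) (use a t in auto)
    also have "a * (t / 2) + t / 2 = (1 + a) / 2 * t" by (simp add: field_simps)
    finally show "Q (affine_op a 0 (Q f)) = (\<lambda>x. of_real k * affine_op a 0 (affine_op 1 ((1 + a) / 2 * t) f) x)"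
      unfolding Q_def affine_op_scale by (simp only: mult.assoc[symmetric] sk)
  qed
  finally show ?thesis by (simp only: model_op_def T_def)
qed

lemma aluthge_iter_model_op:
  assumes k: "k > 0" and a: "0 < a" "a < 1" and t: "0 \<le> t" "t < 1"
  shows "(aluthge HK ^^ n) (model_op k a t) = model_op k a (((1 + a) / 2) ^ n * t)"
proof (induction n)
  case (Suc n)
  have "((1 + a) / 2) ^ n * t \<le> 1 * t" using a t by (intro mult_right_mono power_le_one) auto
  then have "((1 + a) / 2) ^ n * t < 1" using t by simp
  moreover have "0 \<le> ((1 + a) / 2) ^ n * t" using a t by simp
  ultimately have "aluthge HK (model_op k a (((1 + a) / 2) ^ n * t)) = model_op k a ((1 + a) / 2 * (((1 + a) / 2) ^ n * t))"
    by (intro aluthge_model_op k a)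
  then show ?case using Suc by (simp add: mult.assoc)
qed simp

lemma model_op_tendsto:
  assumes a: "a > 0" and c: "\<And>n::nat. c n \<ge> 0" "c \<longlonglongrightarrow> 0"
  shows "sot_tendsto HK (\<lambda>n. model_op k a (c n)) (lift (\<lambda>f x. of_real k * affine_op a 0 f x))"
  unfolding sot_tendsto_def
proof (intro conjI allI ballI)
  have bN: "A.bounded_linear_on (\<lambda>f x. of_real k * affine_op a 0 f x)"
    by (intro A.bounded_linear_on_scale dilation_bounded a)
  note bT = model_bounded[OF a c(1)]
  show "model_op k a (c n) \<in> bounded_ops HK HK" for n unfolding model_op_def by (rule lift_bounded[OF bT])
  show "lift (\<lambda>f x. of_real k * affine_op a 0 f x) \<in> bounded_ops HK HK" by (rule lift_bounded[OF bN])
  fix f assume f: "f \<in> hcarrier HK"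
  note Wf = V_inv_in[OF f]
  have "hnorm HK (\<lambda>x. model_op k a (c n) f x - lift (\<lambda>f x. of_real k * affine_op a 0 f x) f x) =
      cmod (of_real k) * hnorm HA (\<lambda>x. affine_op 1 (c n) (V_inv f) x - V_inv f x)" for n
  proof -
    let ?T = "\<lambda>f x. of_real k * affine_op a 0 (affine_op 1 (c n) f) x" and ?N = "\<lambda>f x. of_real k * affine_op a 0 f x"
    let ?d = "\<lambda>x. lift ?T f x - lift ?N f x"
    have bT: "A.bounded_linear_on ?T" by (rule bT)
    have d: "?d \<in> hcarrier HK" by (intro B.C_diff lift_in[OF bT] lift_in[OF bN] f)
    have diff: "(\<lambda>x. affine_op 1 (c n) (V_inv f) x - V_inv f x) \<in> hcarrier HA" by (intro A.C_diff translation_in[OF c(1)] Wf)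
    have "V_inv ?d = (\<lambda>x. 1 * V_inv (lift ?T f) x + - 1 * V_inv (lift ?N f) x)"
      using V_inv_comb[OF lift_in[OF bT f] lift_in[OF bN f], of 1 "-1"] by simp
    also have "\<dots> = (\<lambda>x. of_real k * affine_op a 0 (\<lambda>x. affine_op 1 (c n) (V_inv f) x - V_inv f x) x)"
      unfolding V_inv_lift[OF bT f] V_inv_lift[OF bN f] affine_op_diff[of a 0] by (simp add: algebra_simps)
    finally have V_inv: "V_inv ?d = (\<lambda>x. of_real k * affine_op a 0 (\<lambda>x. affine_op 1 (c n) (V_inv f) x - V_inv f x) x)" .
    have "(hnorm HK ?d)\<^sup>2 = (hnorm HA (V_inv ?d))\<^sup>2"
      unfolding norm_HK[OF d] lift_at_0[OF bT f] lift_at_0[OF bN f] by simp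
    then have "hnorm HK ?d = hnorm HA (V_inv ?d)"
      by (rule power2_eq_imp_eq[OF _ B.norm_nonneg[OF d] A.norm_nonneg[OF V_inv_in[OF d]]])
    also have "\<dots> = cmod (of_real k) * hnorm HA (\<lambda>x. affine_op 1 (c n) (V_inv f) x - V_inv f x)"
      unfolding V_inv A.norm_scale[OF dilation_in[OF a diff]] dilation_isometric[OF a diff] ..
    finally show ?thesis by (simp only: model_op_def)
  qed
  then show "(\<lambda>n. hnorm HK (\<lambda>x. model_op k a (c n) f x - lift (\<lambda>f x. of_real k * affine_op a 0 f x) f x)) \<longlonglongrightarrow> 0"
    using tendsto_mult_left[OF translation_tendsto[OF c Wf], of "cmod (of_real k)"] by simp
qed

lemma limit_normal:
  assumes a: "a > 0"
  shows "normal_op HK (lift (\<lambda>f x. of_real k * affine_op a 0 f x))"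
proof -
  define N where "N = (\<lambda>f x. complex_of_real k * affine_op a 0 f x)"
  define N' where "N' = (\<lambda>f x. complex_of_real k * affine_op (1 / a) 0 f x)"
  have a': "1 / a > 0" using a by simp
  have bN: "A.bounded_linear_on N" and bN': "A.bounded_linear_on N'"
    unfolding N_def N'_def by (intro A.bounded_linear_on_scale dilation_bounded a a')+
  have adj: "adjoint_op HK HK (lift N) = lift N'"
  proof (rule B.adjoint_op_eqI)
    fix f g assume f: "f \<in> hcarrier HK" and g: "g \<in> hcarrier HK"
    show "hinner HK (lift N f) g = hinner HK f (lift N' g)"
    proof (rule lift_adjoint[OF bN bN' f g])
      fix u v assume u: "u \<in> hcarrier HA" and v: "v \<in> hcarrier HA"
      show "hinner HA (N u) v = hinner HA u (N' v)"
        unfolding N_def N'_def A.B_scale[OF dilation_in[OF a u] v] A.B_scale_right[OF dilation_in[OF a' v] u]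
        by (simp only: dilation_adjoint[OF a u v] complex_cnj_complex_of_real)
    qed
  qed (use lift_in[OF bN'] in \<open>auto simp: lift_def\<close>)
  have inv: "affine_op a 0 (affine_op (1 / a) 0 f) = f" if "f \<in> hcarrier HA" for f
    using dilation_inverse[OF a' that] by simp
  have "compose (hcarrier HK) (lift N') (lift N) = compose (hcarrier HK) (lift N) (lift N')"
    unfolding lift_compose[OF bN' bN] lift_compose[OF bN bN']
    by (rule lift_cong) (simp only: N_def N'_def affine_op_scale dilation_inverse[OF a] inv)
  then show ?thesis unfolding normal_op_def N_def[symmetric] adj using lift_bounded[OF bN] by simp
qed

section \<open>The composition operator and the limit operator\<close>

text \<open>
  The weights cancel: \<open>V\<close> multiplies the coefficient \<open>r\<^sup>j / \<gamma>(j)\<^sup>2\<close> by \<open>\<gamma>(j)\<^sup>2\<close>.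
\<close>
lemma V_kern:
  assumes r: "cmod (of_real r) < 1" and z: "cmod z < 1"
  shows "V (A.kern (of_real r)) z = z / (1 - of_real r * z)"
proof (rule sums_unique2[OF B.taylor_sums[OF V_in[OF A.kern_in[OF r]] z]])
  let ?t = "\<lambda>n. taylor_coeff (V (A.kern (of_real r))) n * z ^ n"
  have "?t (Suc n) = z * (of_real r * z) ^ n" for n
    unfolding taylor_V[OF A.kern_in[OF r]] A.taylor_kern[OF r]
    using gamma_pos[of n] by (simp add: power_mult_distrib)
  moreover have "cmod (of_real r * z) < 1"
    by (rule norm_mult_less_1[OF r z])
  ultimately have "(\<lambda>n. ?t (Suc n)) sums (z * (1 / (1 - of_real r * z)))"
    using sums_mult[OF geometric_sums[of "of_real r * z"], of z] by (simp only:)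
  then have "?t sums (z * (1 / (1 - of_real r * z)) + ?t 0)" by (subst (asm) sums_Suc_iff) simp
  then show "?t sums (z / (1 - of_real r * z))"
    unfolding taylor_V[OF A.kern_in[OF r]] by simp
qed

lemma V_scale: "f \<in> hcarrier HA \<Longrightarrow> V (\<lambda>x. c * f x) = (\<lambda>x. c * V f x)"
  using V_comb[of f f c 0] by simp

lemma V_hk:
  assumes x: "x > 0" and z: "cmod z < 1"
  shows "V (hk x) z = of_real ((x + 1) powr (1 - s)) * (z / (of_real x * (1 - z) + (1 + z)))"
proof -
  have "of_real (x + 1) * (1 - of_real (disk_pt x) * z) = of_real (x + 1) - of_real (x + 1) * of_real (disk_pt x) * z"
    by (simp add: algebra_simps)
  also have "\<dots> = of_real x * (1 - z) + (1 + z)"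
    unfolding disk_pt_mult[OF x] by (simp add: algebra_simps)
  finally have e: "of_real x * (1 - z) + (1 + z) = of_real (x + 1) * (1 - of_real (disk_pt x) * z)" ..
  have "(x + 1) powr (1 - s) = (x + 1) powr (- s) * (x + 1)"
    using x powr_add[of "x + 1" "- s" 1] by simp
  then have p: "complex_of_real ((x + 1) powr (1 - s)) = of_real ((x + 1) powr (- s)) * of_real (x + 1)"
    by (simp only: of_real_mult)
  have nz: "complex_of_real (x + 1) \<noteq> 0" using x by (simp only: of_real_eq_0_iff)
  have c: "p * (z / u) = p * v * (z / (v * u))" if "v \<noteq> 0" for p u v :: complex
    using that by simp
  show ?thesis
    unfolding hk_eq_kern[OF x] V_scale[OF A.kern_in[OF disk_pt[OF x]]] V_kern[OF disk_pt[OF x] z] e p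
    by (rule c[OF nz])
qed

lemma symbol_disk:
  assumes a: "0 < a" "a < 1" and z: "cmod z < 1"
  shows "- (1 - of_real a) * z + 1 \<noteq> (0::complex)" and "cmod (of_real a * z / (- (1 - of_real a) * z + 1)) < 1"
proof -
  have "cmod ((1 - of_real a) * z) = (1 - a) * cmod z"
  proof -
    have "(1 - of_real a) * z = of_real (1 - a) * z" by simp
    then show ?thesis using a by (simp only: norm_mult norm_of_real abs_of_pos diff_gt_0_iff_gt)
  qed
  moreover have "1 - cmod ((1 - of_real a) * z) \<le> cmod (1 - (1 - of_real a) * z)"
    using norm_triangle_ineq2[of 1 "(1 - of_real a) * z"] by simp
  moreover have "a * cmod z < 1 - (1 - a) * cmod z" using z by (simp add: algebra_simps)
  moreover have "cmod (of_real a * z) = a * cmod z" using a by (simp add: norm_mult)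
  ultimately have lt: "cmod (of_real a * z) < cmod (1 - (1 - of_real a) * z)" by linarith
  have e: "- (1 - of_real a) * z + 1 = 1 - (1 - of_real a) * z" by (simp add: algebra_simps)
  show nz: "- (1 - of_real a) * z + 1 \<noteq> 0" unfolding e using lt by auto
  show "cmod (of_real a * z / (- (1 - of_real a) * z + 1)) < 1"
    using lt nz unfolding e norm_divide by (subst divide_less_eq_1_pos) auto
qed

text \<open>
  \<open>C\<^sub>\<sigma> V = V (\<kappa> U P\<^bsub>1-a\<^esub>)\<close>. Both sides are continuous in \<open>f\<close> at each point of the disk, and on a kernel both
  are the same explicit rational function.
\<close>
lemma V_intertwines:
  assumes a: "0 < a" "a < 1" and f: "f \<in> hcarrier HA" and z: "cmod z < 1"
  shows "V f (of_real a * z / (- (1 - of_real a) * z + 1)) =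
     V (\<lambda>x. of_real (a powr (- \<alpha> / 2)) * affine_op a 0 (affine_op 1 (1 - a) f) x) z"
proof -
  let ?\<sigma> = "of_real a * z / (- (1 - of_real a) * z + 1)"
  let ?T = "\<lambda>f x. of_real (a powr (- \<alpha> / 2)) * affine_op a 0 (affine_op 1 (1 - a) f) x"
  have t: "1 - a \<ge> 0" using a by simp
  note bT = model_bounded[OF a(1) t, of "a powr (- \<alpha> / 2)"]
  note nz = symbol_disk(1)[OF a z] and sz = symbol_disk(2)[OF a z]
  have "{f \<in> hcarrier HA. V f ?\<sigma> = V (?T f) z} = hcarrier HA"
  proof (rule hk_dense)
    show "A.closed_subspace {f \<in> hcarrier HA. V f ?\<sigma> = V (?T f) z}"
    proof (rule A.closed_subspaceI)
      fix f X assume f: "f \<in> hcarrier HA" and X: "\<And>k::nat. X k \<in> {f \<in> hcarrier HA. V f ?\<sigma> = V (?T f) z}"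
        and lim: "(\<lambda>k. hnorm HA (\<lambda>x. X k x - f x)) \<longlonglongrightarrow> 0"
      have Xi: "X k \<in> hcarrier HA" and XV: "V (X k) ?\<sigma> = V (?T (X k)) z" for k using X by auto
      have Vlim: "(\<lambda>k. V (Y k) y) \<longlonglongrightarrow> V g y"
        if Yi: "\<And>k. Y k \<in> hcarrier HA" and g: "g \<in> hcarrier HA" and y: "cmod y < 1"
          and l: "(\<lambda>k. hnorm HA (\<lambda>x. Y k x - g x)) \<longlonglongrightarrow> 0" for Y :: "nat \<Rightarrow> complex \<Rightarrow> complex" and g y
      proof (rule B.eval_tendsto[OF V_in[OF Yi] V_in[OF g] _ y])
        have "(\<lambda>x. V (Y k) x - V g x) = V (\<lambda>x. Y k x - g x)" for k
          using V_comb[OF Yi g, of 1 k "-1"] by simp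
        then show "(\<lambda>k. hnorm HK (\<lambda>x. V (Y k) x - V g x)) \<longlonglongrightarrow> 0"
          using l by (simp only: norm_V A.C_diff Yi g)
      qed
      have "(\<lambda>k. V (X k) ?\<sigma>) \<longlonglongrightarrow> V f ?\<sigma>" by (rule Vlim[OF Xi f sz lim])
      moreover have "(\<lambda>k. V (?T (X k)) z) \<longlonglongrightarrow> V (?T f) z"
        by (rule Vlim[OF _ _ z A.bounded_linear_on_tendsto[OF bT Xi f lim]])
          (intro A.bounded_linear_on_in[OF bT] Xi f)+
      ultimately have "V f ?\<sigma> = V (?T f) z" unfolding XV by (rule LIMSEQ_unique)
      then show "f \<in> {f \<in> hcarrier HA. V f ?\<sigma> = V (?T f) z}" using f by simp
    next
      fix f g c d assume fg: "f \<in> {f \<in> hcarrier HA. V f ?\<sigma> = V (?T f) z}" "g \<in> {f \<in> hcarrier HA. V f ?\<sigma> = V (?T f) z}"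
      then have i: "f \<in> hcarrier HA" "g \<in> hcarrier HA" "?T f \<in> hcarrier HA" "?T g \<in> hcarrier HA"
        using A.bounded_linear_on_in[OF bT] by auto
      have "V (?T (\<lambda>x. c * f x + d * g x)) = (\<lambda>x. c * V (?T f) x + d * V (?T g) x)"
        unfolding linear_onD[OF A.bounded_linear_on_linear[OF bT] i(1,2)] by (rule V_comb[OF i(3,4)])
      then show "(\<lambda>x. c * f x + d * g x) \<in> {f \<in> hcarrier HA. V f ?\<sigma> = V (?T f) z}"
        using fg by (simp add: A.C_lin V_comb)
    qed auto
    fix x :: real assume "x > 1"
    then have x: "x > 0" by simp
    define y where "y = (x + (1 - a)) / a"
    have y: "y > 0" "y + 1 = (x + 1) / a" using x a by (auto simp: y_def field_simps)
    have T: "?T (hk x) = (\<lambda>z. of_real (a powr (1 - s)) * hk y z)"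
    proof -
      have h: "affine_op a 0 (affine_op 1 (1 - a) (hk x)) = (\<lambda>z. of_real (a powr (- s / 2)) * hk y z)"
        using translation_hk[OF t x] affine_op_hk[of a 0 "x + (1 - a)"] x a by (simp add: y_def)
      have "a powr (- \<alpha> / 2) * a powr (- s / 2) = a powr (1 - s)"
      proof -
        have "- \<alpha> / 2 + - s / 2 = 1 - s" by (simp add: s_def field_simps)
        then show ?thesis by (simp only: powr_add[symmetric])
      qed
      then have "complex_of_real (a powr (- \<alpha> / 2)) * of_real (a powr (- s / 2)) = of_real (a powr (1 - s))"
        by (simp only: of_real_mult[symmetric])
      then show ?thesis unfolding h by (simp only: mult.assoc[symmetric])
    qed
    define D where "D = - (1 - of_real a) * z + (1 :: complex)"
    \<comment> \<open>\<open>F\<close> is the common denominator: both sides equal a constant times \<open>a z / F\<close>.\<close>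
    define F where "F = of_real x * (1 - z) + (1 - z + 2 * of_real a * z)"
    have D: "D \<noteq> 0" using nz by (simp add: D_def)
    have "of_real x * (1 - ?\<sigma>) + (1 + ?\<sigma>) = F / D"
      unfolding D_def[symmetric] using D by (simp add: field_simps) (simp add: D_def F_def algebra_simps)
    then have L: "?\<sigma> / (of_real x * (1 - ?\<sigma>) + (1 + ?\<sigma>)) = of_real a * z / F"
      unfolding D_def[symmetric] using D by simp
    have ya: "of_real y * complex_of_real a = of_real x + (1 - of_real a)"
      using a by (simp add: y_def)
    have "of_real a * (of_real y * (1 - z) + (1 + z)) = of_real y * complex_of_real a * (1 - z) + of_real a * (1 + z)"
      by (simp add: algebra_simps)
    also have "\<dots> = F" unfolding ya by (simp add: F_def algebra_simps)
    finally have "of_real y * (1 - z) + (1 + z) = F / of_real a" using a by (simp add: field_simps)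
    then have R: "z / (of_real y * (1 - z) + (1 + z)) = of_real a * z / F" by simp
    have "(y + 1) powr (1 - s) = (x + 1) powr (1 - s) / a powr (1 - s)"
      unfolding y(2) using x a by (simp add: powr_divide)
    then have "a powr (1 - s) * (y + 1) powr (1 - s) = (x + 1) powr (1 - s)" using a by simp
    then have c: "complex_of_real (a powr (1 - s)) * of_real ((y + 1) powr (1 - s)) = of_real ((x + 1) powr (1 - s))"
      by (simp only: of_real_mult[symmetric])
    have "V (?T (hk x)) z = of_real (a powr (1 - s)) * (of_real ((y + 1) powr (1 - s)) * (of_real a * z / F))"
      unfolding T V_scale[OF hk_in[OF y(1)]] V_hk[OF y(1) z] R ..
    also have "\<dots> = V (hk x) ?\<sigma>"
      unfolding V_hk[OF x sz] L by (simp only: mult.assoc[symmetric] c)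
    finally show "hk x \<in> {f \<in> hcarrier HA. V f ?\<sigma> = V (?T f) z}" using hk_in[OF x] by simp
  qed
  then show ?thesis using f by blast
qed

text \<open>
  Because \<open>\<sigma>(0) = 0\<close>, composition with \<open>\<sigma>\<close> respects the splitting \<open>f = f(0) + V (V\<^sup>* f)\<close>.
\<close>
lemma comp_op_eq_model_op:
  assumes a: "0 < a" "a < 1"
  shows "comp_op HK (\<lambda>z. of_real a * z / (- (1 - of_real a) * z + 1)) = model_op (a powr (- \<alpha> / 2)) a (1 - a)"
  unfolding comp_op_def model_op_def lift_def
proof (rule restrict_ext)
  fix f assume f: "f \<in> hcarrier HK"
  let ?T = "\<lambda>f x. of_real (a powr (- \<alpha> / 2)) * affine_op a 0 (affine_op 1 (1 - a) f) x"
  have bT: "A.bounded_linear_on ?T" using a by (intro model_bounded) auto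
  have i: "glue (f 0) (?T (V_inv f)) \<in> hcarrier HK" by (intro glue_in A.bounded_linear_on_in[OF bT] V_inv_in f)
  show "on_disk (\<lambda>z. f (of_real a * z / (- (1 - of_real a) * z + 1))) = glue (f 0) (?T (V_inv f))"
  proof
    fix z show "on_disk (\<lambda>z. f (of_real a * z / (- (1 - of_real a) * z + 1))) z = glue (f 0) (?T (V_inv f)) z"
    proof (cases "cmod z < 1")
      case True
      let ?\<sigma> = "of_real a * z / (- (1 - of_real a) * z + 1)"
      have "f ?\<sigma> = glue (f 0) (V_inv f) ?\<sigma>" by (simp only: glue_decomp[OF f])
      also have "\<dots> = f 0 + V (V_inv f) ?\<sigma>"
        unfolding glue_def B.monom_fun_def on_disk_def using symbol_disk(2)[OF a True] by simp
      also have "\<dots> = f 0 + V (?T (V_inv f)) z" by (simp only: V_intertwines[OF a V_inv_in[OF f] True])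
      also have "\<dots> = glue (f 0) (?T (V_inv f)) z" unfolding glue_def B.monom_fun_def on_disk_def using True by simp
      finally show ?thesis using True by (simp add: on_disk_def)
    next
      case False
      then show ?thesis using B.outside_disk[OF i False] by (simp add: on_disk_def)
    qed
  qed
qed

text \<open>
  Composition alone preserves the Bergman space: divide the weighted composition by its weight. With
  \<open>b = (1 - a) / (1 + a)\<close>, the inverse weight is a multiple of \<open>(1 - b z)\<^sup>s\<close>, whose Taylor series
  converges absolutely on the closed disk because \<open>b < 1\<close>.
\<close>
lemma comp_mob_in:
  assumes a: "0 < a" "a < 1" and f: "f \<in> hcarrier HA"
  shows "on_disk (\<lambda>z. f (affine_mob a 0 z)) \<in> hcarrier HA"
proof -
  define b where "b = (1 - a) / (1 + a)"
  have b: "0 < b" "b < 1" using a by (auto simp: b_def)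
  define q where "q n = complex_of_real (pochhammer (- s) n / fact n)" for n
  have qs: "(\<lambda>n. q n * z ^ n) sums (1 - z) powr of_real s" if "cmod z < 1" for z
    using binomial_series_complex[OF that, of "- s"] by (simp add: q_def)
  have "summable (\<lambda>n. norm (q n * of_real b ^ n))"
  proof (rule powser_insidea)
    show "summable (\<lambda>n. q n * of_real ((1 + b) / 2) ^ n)"
      by (rule sums_summable[OF qs]) (use b in \<open>simp del: of_real_divide of_real_add\<close>)
    show "norm (complex_of_real b) < norm (complex_of_real ((1 + b) / 2))"
      unfolding norm_of_real using b by simp
  qed
  then have sm: "summable (\<lambda>n. cmod (q n * of_real b ^ n))" .
  have bz: "cmod (of_real b * z) < 1" if "cmod z < 1" for z
    by (rule norm_mult_less_1[OF _ that]) (use b in simp)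
  have g: "(\<lambda>n. q n * of_real b ^ n * z ^ n) sums (1 - of_real b * z) powr of_real s" if "cmod z < 1" for z
    using qs[OF bz[OF that]] by (simp add: power_mult_distrib mult.assoc)
  have m: "on_disk (\<lambda>z. (1 - of_real b * z) powr of_real s * affine_op a 0 f z) \<in> hcarrier HA"
    by (rule A.multiplier_in[OF gamma_dec dilation_in[OF a(1) f] sm g])
  define c where "c = a powr (s / 2) * (2 / (1 + a)) powr s"
  have c: "c > 0" using a by (simp add: c_def)
  have "on_disk (\<lambda>z. (1 - of_real b * z) powr of_real s * affine_op a 0 f z) = (\<lambda>z. of_real c * on_disk (\<lambda>z. f (affine_mob a 0 z)) z)"
  proof
    fix z
    show "on_disk (\<lambda>z. (1 - of_real b * z) powr of_real s * affine_op a 0 f z) z = of_real c * on_disk (\<lambda>z. f (affine_mob a 0 z)) z"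
    proof (cases "cmod z < 1")
      case True
      define u where "u = 1 - of_real b * z"
      have u: "Re u > 0" using disk_Re[OF bz[OF True]] by (simp add: u_def)
      then have u0: "u \<noteq> 0" by auto
      have iu: "Re (inverse u) > 0"
      proof -
        have "Re (inverse u) = Re u / (cmod u)\<^sup>2" by (simp add: cmod_power2)
        then show ?thesis using u u0 by simp
      qed
      have c': "Re (complex_of_real (2 / (1 + a))) > 0" using a by (simp only: Re_complex_of_real) simp
      have "of_real (1 + a) * u = of_real (1 + a) - of_real ((1 + a) * b) * z"
        unfolding u_def of_real_mult by (simp add: algebra_simps)
      also have "(1 + a) * b = 1 - a" using a by (simp add: b_def)
      also have "of_real (1 + a) - of_real (1 - a) * z = affine_den a 0 z" by (simp add: affine_den_def algebra_simps)
      finally have "2 / affine_den a 0 z = of_real (2 / (1 + a)) * inverse u" by (simp add: divide_inverse mult.assoc flip: inverse_mult_distrib)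
      then have "(2 / affine_den a 0 z) powr of_real s = of_real (2 / (1 + a)) powr of_real s * inverse u powr of_real s"
        by (simp only: powr_mult_right_half_plane[OF c' iu])
      also have "complex_of_real (2 / (1 + a)) powr of_real s = of_real ((2 / (1 + a)) powr s)"
        by (rule powr_of_real) (use a in auto)
      finally have d: "(2 / affine_den a 0 z) powr of_real s = of_real ((2 / (1 + a)) powr s) * inverse u powr of_real s" .
      have "u powr of_real s * inverse u powr of_real s = (u * inverse u) powr of_real s"
        by (rule powr_mult_right_half_plane[OF u iu, symmetric])
      then have uu: "u powr of_real s * inverse u powr of_real s = 1" using u0 by simp
      have "u powr of_real s * (of_real (a powr (s / 2)) * (of_real ((2 / (1 + a)) powr s) * inverse u powr of_real s) * f (affine_mob a 0 z))
          = (u powr of_real s * inverse u powr of_real s) * (of_real (a powr (s / 2)) * of_real ((2 / (1 + a)) powr s) * f (affine_mob a 0 z))"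
        by (simp only: mult_ac)
      then show ?thesis using True
        unfolding affine_op_def on_disk_def u_def[symmetric] d uu c_def of_real_mult by simp
    qed (simp add: on_disk_def)
  qed
  then have "(\<lambda>z. of_real (1 / c) * (of_real c * on_disk (\<lambda>z. f (affine_mob a 0 z)) z)) \<in> hcarrier HA"
    using A.C_scale[OF m, of "of_real (1 / c)"] by simp
  moreover have "(\<lambda>z. of_real (1 / c) * (of_real c * on_disk (\<lambda>z. f (affine_mob a 0 z)) z)) = on_disk (\<lambda>z. f (affine_mob a 0 z))"
    using c by (simp add: fun_eq_iff)
  ultimately show ?thesis by simp
qed

lemma weighted_comp_eq_affine_op:
  assumes a: "0 < a" "a < 1" and f: "f \<in> hcarrier HA"
    and \<psi>: "\<psi> = (\<lambda>z. ((1 + of_real a) * z - (1 - of_real a)) / (- (1 - of_real a) * z + (1 + of_real a)))"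
    and w: "w = (\<lambda>z. (2 * of_real (sqrt a) / (- (1 - of_real a) * z + (1 + of_real a))) powr of_real (\<alpha> + 2))"
  shows "compose (hcarrier HA) (mult_op HA w) (comp_op HA \<psi>) f = affine_op a 0 f"
proof -
  have d: "- (1 - of_real a) * z + (1 + of_real a) = affine_den a 0 z" for z by (simp add: affine_den_def algebra_simps)
  have \<psi>m: "\<psi> = affine_mob a 0" unfolding \<psi> d by (simp add: affine_mob_def fun_eq_iff algebra_simps)
  have wz: "w z = of_real (a powr (s / 2)) * (2 / affine_den a 0 z) powr of_real s" if z: "cmod z < 1" for z
  proof -
    have "Re (2 / affine_den a 0 z) = 2 * Re (affine_den a 0 z) / (cmod (affine_den a 0 z))\<^sup>2"
      by (simp add: Re_divide cmod_power2)
    then have u: "Re (2 / affine_den a 0 z) > 0" using affine_den_Re[of a 0 z] affine_den_nz[of a 0 z] a z by simp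
    have r: "Re (complex_of_real (sqrt a)) > 0" using a by simp
    have "2 * of_real (sqrt a) / affine_den a 0 z = of_real (sqrt a) * (2 / affine_den a 0 z)" by simp
    then have "w z = of_real (sqrt a) powr of_real s * (2 / affine_den a 0 z) powr of_real s"
      unfolding w d s_def[symmetric] by (simp only: powr_mult_right_half_plane[OF r u])
    also have "of_real (sqrt a) powr of_real s = complex_of_real (sqrt a powr s)"
      by (rule powr_of_real) (use a in auto)
    also have "sqrt a powr s = a powr (s / 2)"
      using a by (simp add: powr_half_sqrt[symmetric] powr_powr)
    finally show ?thesis .
  qed
  have c: "comp_op HA \<psi> f = on_disk (\<lambda>z. f (affine_mob a 0 z))" using f by (simp add: comp_op_def \<psi>m)
  have "mult_op HA w (comp_op HA \<psi> f) = affine_op a 0 f"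
    unfolding c mult_op_def affine_op_def using comp_mob_in[OF a f] wz by (auto simp: on_disk_def fun_eq_iff)
  then show ?thesis using f by (simp add: compose_def)
qed

lemma kern_0_eq_one: "H2_kernel (\<beta>\<^sub>w \<alpha>) 0 = one"
  unfolding B.H2_kernel_eq
  by (rule B.taylor_eqI) (auto simp: B.kern_in B.monom_in B.taylor_kern B.taylor_monom beta_0 power_0_left)

text \<open>
  The orthogonal complement of the functions vanishing at \<open>0\<close> consists of the constants, on which
  \<open>K\<^sub>0 \<otimes> K\<^sub>0\<close> is the identity; the Bergman part is identified by \<open>weighted_comp_eq_affine_op\<close>.
\<close>
lemma limit_eq:
  assumes a: "0 < a" "a < 1"
    and \<psi>: "\<psi> = (\<lambda>z. ((1 + of_real a) * z - (1 - of_real a)) / (- (1 - of_real a) * z + (1 + of_real a)))"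
    and w: "w = (\<lambda>z. (2 * of_real (sqrt a) / (- (1 - of_real a) * z + (1 + of_real a))) powr of_real (\<alpha> + 2))"
  defines "Z \<equiv> zH2 (\<beta>\<^sub>w \<alpha>)"
  shows "direct_sum_op HK (hcarrier Z) (rank_one HK (H2_kernel (\<beta>\<^sub>w \<alpha>) 0) (H2_kernel (\<beta>\<^sub>w \<alpha>) 0))
     (compose (hcarrier Z) (V_op \<alpha>) (compose (hcarrier Z)
        (scale_op HA (of_real (1 / a powr (\<alpha> / 2))) (compose (hcarrier HA) (mult_op HA w) (comp_op HA \<psi>)))
        (adjoint_op HA Z (V_op \<alpha>)))) = lift (\<lambda>f x. of_real (a powr (- \<alpha> / 2)) * affine_op a 0 f x)"
    (is "direct_sum_op HK _ ?P ?B = lift ?N")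
proof -
  have bN: "A.bounded_linear_on ?N" by (intro A.bounded_linear_on_scale dilation_bounded a)
  have Zc: "v \<in> hcarrier Z \<longleftrightarrow> v \<in> hcarrier HK \<and> v 0 = 0" for v by (auto simp: Z_def zH2_carrier)
  have k: "1 / a powr (\<alpha> / 2) = a powr (- \<alpha> / 2)" by (simp add: powr_minus_divide)
  have B: "?B v = V (?N (V_inv v))" if v: "v \<in> hcarrier Z" for v
  proof -
    have Wv: "V_inv v \<in> hcarrier HA" using v V_inv_in by (simp add: Zc)
    have "?B v = V_op \<alpha> (?N (V_inv v))"
      unfolding Z_def adjoint_V_op using v Wv
      by (simp add: compose_eq Z_def[symmetric] scale_op_def weighted_comp_eq_affine_op[OF a Wv \<psi> w] k)
    then show ?thesis using A.bounded_linear_on_in[OF bN Wv] by (simp add: V_op_eq)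
  qed
  have P: "?P (\<lambda>x. c * one x) = (\<lambda>x. c * one x)" for c
  proof -
    have "hinner HK (\<lambda>x. c * one x) one = c"
      by (simp add: inner_HK B.C_scale B.monom_in one_at_0 V_inv_one A.inner_zero_right V_inv_in)
    then show ?thesis unfolding kern_0_eq_one by (simp add: rank_one_def B.C_scale B.monom_in)
  qed
  have oc: "u \<in> orth_compl HK (hcarrier Z) \<longleftrightarrow> (\<exists>c. u = (\<lambda>x. c * one x))" for u
  proof
    assume u: "u \<in> orth_compl HK (hcarrier Z)"
    then have uH: "u \<in> hcarrier HK" by (simp add: orth_compl_def)
    have VW: "V (V_inv u) \<in> hcarrier Z" by (simp add: Zc V_in V_inv_in uH V_at_0)
    then have "hinner HK u (V (V_inv u)) = 0" using u by (simp add: orth_compl_def)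
    then have "hinner HA (V_inv u) (V_inv u) = 0"
      unfolding inner_HK[OF uH V_in[OF V_inv_in[OF uH]]] V_at_0[OF V_inv_in[OF uH]] V_inv_V[OF V_inv_in[OF uH]] by simp
    then have W0: "V_inv u = (\<lambda>_. 0)" by (intro A.definite V_inv_in uH)
    have V0: "V (\<lambda>_. 0) = (\<lambda>_. 0)" using V_comb[OF A.zero_in A.zero_in, of 0 0] by simp
    have "u = (\<lambda>x. u 0 * one x)"
      by (rule trans[OF glue_decomp[OF uH, symmetric]]) (simp only: W0 glue_def V0 add_0_right)
    then show "\<exists>c. u = (\<lambda>x. c * one x)" by (rule exI)
  next
    assume "\<exists>c. u = (\<lambda>x. c * one x)"
    then obtain c where u: "u = (\<lambda>x. c * one x)" by (elim exE)
    have W0: "V_inv u = (\<lambda>_. 0)" unfolding u using V_inv_comb[OF B.monom_in B.monom_in, of c 0 0 0] by (simp add: V_inv_one)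
    have uH: "u \<in> hcarrier HK" unfolding u by (intro B.C_scale B.monom_in)
    then show "u \<in> orth_compl HK (hcarrier Z)"
      by (auto simp: orth_compl_def Zc inner_HK W0 A.inner_zero_left V_inv_in)
  qed
  show ?thesis
    unfolding direct_sum_op_def lift_def
  proof (rule restrict_ext)
    fix f assume f: "f \<in> hcarrier HK"
    have VW: "V (V_inv f) \<in> hcarrier Z" by (simp add: Zc V_in V_inv_in f V_at_0)
    have N: "glue (f 0) (?N (V_inv f)) = (\<lambda>x. ?P (\<lambda>x. f 0 * one x) x + ?B (V (V_inv f)) x)"
      unfolding P B[OF VW] V_inv_V[OF V_inv_in[OF f]] by (simp add: glue_def)
    show "(THE h. \<exists>u\<in>orth_compl HK (hcarrier Z). \<exists>v\<in>hcarrier Z. f = (\<lambda>x. u x + v x) \<and> h = (\<lambda>x. ?P u x + ?B v x)) = glue (f 0) (?N (V_inv f))"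
    proof (rule the_equality)
      have "f = (\<lambda>x. f 0 * one x + V (V_inv f) x)" by (rule glue_decomp[OF f, unfolded glue_def, symmetric])
      moreover have "(\<lambda>x. f 0 * one x) \<in> orth_compl HK (hcarrier Z)"
        unfolding oc by (rule exI[of _ "f 0"]) (rule refl)
      ultimately show "\<exists>u\<in>orth_compl HK (hcarrier Z). \<exists>v\<in>hcarrier Z. f = (\<lambda>x. u x + v x) \<and> glue (f 0) (?N (V_inv f)) = (\<lambda>x. ?P u x + ?B v x)"
        using N VW by (intro bexI[of _ "\<lambda>x. f 0 * one x"] bexI[of _ "V (V_inv f)"] conjI)
    next
      fix h assume "\<exists>u\<in>orth_compl HK (hcarrier Z). \<exists>v\<in>hcarrier Z. f = (\<lambda>x. u x + v x) \<and> h = (\<lambda>x. ?P u x + ?B v x)"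
      then obtain u v where u: "u \<in> orth_compl HK (hcarrier Z)" and v: "v \<in> hcarrier Z"
        and fuv: "f = (\<lambda>x. u x + v x)" and h: "h = (\<lambda>x. ?P u x + ?B v x)"
        by (elim bexE conjE)
      obtain c where c: "u = (\<lambda>x. c * one x)" using u unfolding oc by (elim exE)
      have "f 0 = c" using fun_cong[OF fuv, of 0] fun_cong[OF c, of 0] v by (simp add: one_at_0 Zc)
      with c have uc: "u = (\<lambda>x. f 0 * one x)" by (simp only:)
      have "v x = V (V_inv f) x" for x
      proof -
        have "u x + v x = f 0 * one x + V (V_inv f) x"
          using fun_cong[OF glue_decomp[OF f, unfolded glue_def], of x] fun_cong[OF fuv, of x] by (simp only:)
        then show ?thesis unfolding fun_cong[OF uc, of x] by simp
      qed
      then have "v = V (V_inv f)" by (rule ext)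
      then show "h = glue (f 0) (?N (V_inv f))" unfolding N h uc by (simp only:)
    qed
  qed
qed

end

theorem theorem4p2:
  fixes a \<alpha> :: real and \<sigma> \<psi> w :: "complex \<Rightarrow> complex"
    and H A Z :: "complex fun_space" and V N :: "(complex, complex) fun_op"
  assumes "0 < a" and "a < 1" and "\<alpha> > -1"
  defines "\<sigma> \<equiv> (\<lambda>z. of_real a * z / (- (1 - of_real a) * z + 1))"
    and "\<psi> \<equiv> (\<lambda>z. ((1 + of_real a) * z - (1 - of_real a)) /
                  (- (1 - of_real a) * z + (1 + of_real a)))"
    and "w \<equiv> (\<lambda>z. (2 * of_real (sqrt a) / (- (1 - of_real a) * z + (1 + of_real a)))
                  powr of_real (\<alpha> + 2))"
    and "H \<equiv> H2 (\<beta>\<^sub>w \<alpha>)"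
    and "Z \<equiv> zH2 (\<beta>\<^sub>w \<alpha>)"
    and "A \<equiv> weighted_bergman \<alpha>"
    and "V \<equiv> V_op \<alpha>"
    and "N \<equiv> direct_sum_op H (hcarrier Z)
           (rank_one H (H2_kernel (\<beta>\<^sub>w \<alpha>) 0) (H2_kernel (\<beta>\<^sub>w \<alpha>) 0))
           (compose (hcarrier Z) V
             (compose (hcarrier Z)
               (scale_op A (of_real (1 / a powr (\<alpha> / 2)))
                 (compose (hcarrier A) (mult_op A w) (comp_op A \<psi>)))
               (adjoint_op A Z V)))"
  shows "sot_tendsto H (\<lambda>n. (aluthge H ^^ n) (comp_op H \<sigma>)) N \<and> normal_op H N"
proof -
  \<comment> \<open>The interpretation brings another constant \<open>V\<close> into scope, whose definition has the same name.\<close>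
  note V_op_def' = V_def
  interpret bergman \<alpha> by unfold_locales (rule assms(3))
  note a = assms(1,2)
  let ?k = "a powr (- \<alpha> / 2)"
  have N: "N = lift (\<lambda>f x. of_real ?k * affine_op a 0 f x)"
    unfolding N_def H_def Z_def A_def V_op_def' weighted_bergman_def
    by (rule limit_eq[OF a]) (simp_all only: \<psi>_def w_def)
  have k: "?k > 0" using a by simp
  have iter: "(aluthge H ^^ n) (comp_op H \<sigma>) = model_op ?k a (((1 + a) / 2) ^ n * (1 - a))" for n
    unfolding H_def \<sigma>_def comp_op_eq_model_op[OF a] by (rule aluthge_iter_model_op[OF k a]) (use a in auto)
  have "(\<lambda>n. ((1 + a) / 2) ^ n * (1 - a)) \<longlonglongrightarrow> 0 * (1 - a)"
    using a by (intro tendsto_mult tendsto_const LIMSEQ_power_zero) auto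
  then have "sot_tendsto H (\<lambda>n. (aluthge H ^^ n) (comp_op H \<sigma>)) N"
    unfolding iter unfolding N H_def using a by (intro model_op_tendsto) auto
  moreover have "normal_op H N" unfolding N H_def by (rule limit_normal[OF a(1)])
  ultimately show ?thesis ..
qed

end
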